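(* Let $S$ be a closed, connected, oriented surface of genus $g\ge 1$, let $\pi_1(S)$ be its fundamental group, let $n\ge 1$, and let $\rho:\pi_1(S)\to\mathbb{T}^n$ be a representation. Then the image of $\rho$ is dense in $\mathbb{T}^n$ if and only if the mapping class group orbit $\mathrm{Mod}(S)\cdot\rho$ is dense in the representation space $\mathrm{Hom}(\pi_1(S),\mathbb{T}^n)$.
   Context: $\mathbb{T}^n$ is the $n$-dimensional torus $(\mathbb{S}^1)^n\cong\mathbb{R}^n/2\pi\mathbb{Z}^n$, a compact abelian Lie group. A representation is a group homomorphism; $\mathrm{Hom}(\pi_1(S),\mathbb{T}^n)$ carries the compact-open topology (equivalently, after choosing standard generators $\alpha_1,\beta_1,\dots,\alpha_g,\beta_g$ of $\pi_1(S)$, the topology of $(\mathbb{T}^n)^{2g}$ via $\rho\mapsto(\rho(\alpha_1),\rho(\beta_1),\dots,\rho(\alpha_g),\rho(\beta_g))$). The mapping class group is $\mathrm{Mod}(S)=\mathrm{Homeo}(S)/\text{isotopy}\cong\mathrm{Out}(\pi_1(S))$ (Dehn–Nielsen–Baer). It acts on $\mathrm{Hom}(\pi_1(S),\mathbb{T}^n)$ by $\phi\cdot\rho=\rho\circ\phi^{-1}$; this is well defined on outer automorphisms because $\mathbb{T}^n$ is abelian. *)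

theory Defs
  imports "HOL-Analysis.Analysis" "HOL-Algebra.Group"
begin

section \<open>Closed oriented surfaces of genus g\<close>

text \<open>
  The closed unit disc is regarded as a polygon with \<open>4 * g\<close> sides: side number \<open>j\<close> is the circular
  arc \<open>t \<mapsto> polygon_side g j t\<close>, \<open>0 \<le> t \<le> 1\<close>, and the sides are numbered counterclockwise.
\<close>

definition polygon_side :: "nat \<Rightarrow> nat \<Rightarrow> real \<Rightarrow> complex" where
  "polygon_side g j t = cis (2 * pi * (real j + t) / real (4 * g))"

text \<open>
  The sides are glued according to the boundary word
  \<open>\<alpha>\<^sub>1 \<beta>\<^sub>1 \<alpha>\<^sub>1\<inverse> \<beta>\<^sub>1\<inverse> \<dots> \<alpha>\<^sub>g \<beta>\<^sub>g \<alpha>\<^sub>g\<inverse> \<beta>\<^sub>g\<inverse>\<close>.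
  Each letter occurs once with each sign, so the sides are paired by orientation-reversing maps of
  the boundary circle; this is what makes the resulting closed surface orientable.
\<close>

definition side_pairing :: "nat \<Rightarrow> (complex \<times> complex) set" where
  "side_pairing g =
     {(polygon_side g (4 * i) t, polygon_side g (4 * i + 2) (1 - t)) | i t. i < g \<and> t \<in> {0..1}} \<union>
     {(polygon_side g (4 * i + 1) t, polygon_side g (4 * i + 3) (1 - t)) | i t. i < g \<and> t \<in> {0..1}}"

definition gluing :: "nat \<Rightarrow> (complex \<times> complex) set" where
  "gluing g = (side_pairing g \<union> (side_pairing g)\<inverse>)\<^sup>*"

definition closed_surface :: "'a::topological_space set \<Rightarrow> bool" where
  "closed_surface S \<longleftrightarrow>
     compact S \<and> Hausdorff_space (top_of_set S) \<and>
     (\<forall>x\<in>S. \<exists>U. openin (top_of_set S) U \<and> x \<in> U \<and> U homeomorphic (UNIV :: (real^2) set))"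

text \<open>
  The last conjunct says that \<open>S\<close> is homeomorphic to the quotient space of the glued polygon, which
  is the connected sum of \<open>g\<close> tori.
\<close>

definition closed_oriented_surface :: "nat \<Rightarrow> 'a::topological_space set \<Rightarrow> bool" where
  "closed_oriented_surface g S \<longleftrightarrow>
     closed_surface S \<and> connected S \<and>
     (\<exists>q. quotient_map (top_of_set (cball 0 1)) (top_of_set S) q \<and>
          (\<forall>z\<in>cball 0 1. \<forall>w\<in>cball 0 1. q z = q w \<longleftrightarrow> (z, w) \<in> gluing g))"


section \<open>The fundamental group\<close>

definition based_loops :: "'a::topological_space set \<Rightarrow> 'a \<Rightarrow> (real \<Rightarrow> 'a) set" where
  "based_loops S x = {p. path p \<and> path_image p \<subseteq> S \<and> pathstart p = x \<and> pathfinish p = x}"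

definition loop_homotopy :: "'a::topological_space set \<Rightarrow> 'a \<Rightarrow> ((real \<Rightarrow> 'a) \<times> (real \<Rightarrow> 'a)) set" where
  "loop_homotopy S x = {(p, q). p \<in> based_loops S x \<and> q \<in> based_loops S x \<and> homotopic_paths S p q}"

definition fundamental_group :: "'a::topological_space set \<Rightarrow> 'a \<Rightarrow> (real \<Rightarrow> 'a) set monoid" where
  "fundamental_group S x =
     \<lparr> carrier = based_loops S x // loop_homotopy S x,
       mult = (\<lambda>A B. \<Union>p\<in>A. \<Union>q\<in>B. loop_homotopy S x `` {p +++ q}),
       one = loop_homotopy S x `` {\<lambda>_. x} \<rparr>"


section \<open>The mapping class group\<close>

text \<open>
  Elements of \<open>homeos S\<close> are functions on the whole type, but only their values on \<open>S\<close> matter: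
  functions that agree on \<open>S\<close> are isotopic, so they represent the same mapping class.
\<close>

definition homeos :: "'a::topological_space set \<Rightarrow> ('a \<Rightarrow> 'a) set" where
  "homeos S = {f. \<exists>f'. homeomorphism S S f f'}"

definition isotopy :: "'a::topological_space set \<Rightarrow> (('a \<Rightarrow> 'a) \<times> ('a \<Rightarrow> 'a)) set" where
  "isotopy S = {(f, h). homotopic_with_canon (\<lambda>k. k \<in> homeos S) S S f h}"

definition mapping_class_group :: "'a::topological_space set \<Rightarrow> ('a \<Rightarrow> 'a) set monoid" where
  "mapping_class_group S =
     \<lparr> carrier = homeos S // isotopy S,
       mult = (\<lambda>A B. \<Union>f\<in>A. \<Union>h\<in>B. isotopy S `` {f \<circ> h}),
       one = isotopy S `` {id} \<rparr>"


section \<open>Representations into the torus\<close>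

definition torus :: "(complex ^ 'n::finite) monoid" where
  "torus = \<lparr> carrier = {z. \<forall>i. cmod (z $ i) = 1},
             mult = (\<lambda>z w. \<chi> i. z $ i * w $ i),
             one = (\<chi> i. 1) \<rparr>"

abbreviation torus_topology :: "(complex ^ 'n::finite) topology" where
  "torus_topology \<equiv> top_of_set (carrier torus)"

definition compact_open_topology :: "'a topology \<Rightarrow> 'b topology \<Rightarrow> ('a \<Rightarrow> 'b) topology" where
  "compact_open_topology X Y =
     topology_generated_by
       {{f. continuous_map X Y f \<and> f \<in> extensional (topspace X) \<and> f ` K \<subseteq> U} | K U.
          compactin X K \<and> openin Y U}"

text \<open>
  Homomorphisms are taken to be extensional so that each one is a single HOL function.
\<close>

definition representations ::
    "'a::topological_space set \<Rightarrow> 'a \<Rightarrow> ((real \<Rightarrow> 'a) set \<Rightarrow> complex ^ 'n::finite) set" where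
  "representations S x =
     hom (fundamental_group S x) torus \<inter> extensional (carrier (fundamental_group S x))"

definition representation_space ::
    "'a::topological_space set \<Rightarrow> 'a \<Rightarrow> ((real \<Rightarrow> 'a) set \<Rightarrow> complex ^ 'n::finite) topology" where
  "representation_space S x =
     subtopology
       (compact_open_topology (discrete_topology (carrier (fundamental_group S x))) torus_topology)
       (representations S x)"


section \<open>The action of the mapping class group\<close>

text \<open>
  A homeomorphism \<open>f\<close> need not fix the base point \<open>x\<close>.  Given a path \<open>d\<close> from \<open>x\<close> to \<open>f x\<close>, it induces
  the automorphism \<open>[p] \<mapsto> [d \<cdot> (f \<circ> p) \<cdot> d\<inverse>]\<close> of the fundamental group.  Changing \<open>d\<close> changes it by an
  inner automorphism, so the class in the outer automorphism group depends on \<open>f\<close> only.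
\<close>

definition induced_automorphism ::
    "'a::topological_space set \<Rightarrow> 'a \<Rightarrow> ('a \<Rightarrow> 'a) \<Rightarrow> (real \<Rightarrow> 'a) \<Rightarrow> (real \<Rightarrow> 'a) set \<Rightarrow> (real \<Rightarrow> 'a) set"
  where
  "induced_automorphism S x f d A =
     (\<Union>p\<in>A. loop_homotopy S x `` {d +++ (f \<circ> p) +++ reversepath d})"

definition precompose_inverse ::
    "('g, 'm) monoid_scheme \<Rightarrow> ('g \<Rightarrow> 'g) \<Rightarrow> ('g \<Rightarrow> 'b) \<Rightarrow> ('g \<Rightarrow> 'b)" where
  "precompose_inverse G \<phi> \<rho> = restrict (\<rho> \<circ> inv_into (carrier G) \<phi>) (carrier G)"

text \<open>
  The representation \<open>\<rho> \<circ> \<phi>\<inverse>\<close> depends neither on the path \<open>d\<close>, because the torus is abelian, nor on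
  the representative \<open>f\<close> of the mapping class \<open>c\<close>.  So each \<open>c\<close> contributes exactly one element.
\<close>

definition mapping_class_orbit ::
    "'a::topological_space set \<Rightarrow> 'a \<Rightarrow> ((real \<Rightarrow> 'a) set \<Rightarrow> complex ^ 'n::finite) \<Rightarrow>
       ((real \<Rightarrow> 'a) set \<Rightarrow> complex ^ 'n) set" where
  "mapping_class_orbit S x \<rho> =
     {precompose_inverse (fundamental_group S x) (induced_automorphism S x f d) \<rho> | c f d.
        c \<in> carrier (mapping_class_group S) \<and> f \<in> c \<and>
        path d \<and> path_image d \<subseteq> S \<and> pathstart d = x \<and> pathfinish d = f x}"


definition dense_in :: "'a topology \<Rightarrow> 'a set \<Rightarrow> bool" where
  "dense_in X A \<longleftrightarrow> A \<subseteq> topspace X \<and> X closure_of A = topspace X"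

end

theory Submission
  imports Defs "HOL-Complex_Analysis.Complex_Analysis" "HOL-Real_Asymp.Real_Asymp"
begin

text \<open>
  A representation into the torus is the same as a tuple of points of the torus, one for each of the \<open>2 * g\<close>
  standard generators, and a mapping class acts on these tuples through an integral symplectic matrix.
  Dehn twists about curves that cross one or two pairs of sides of the polygon realise enough
  transvections.  If the image is dense, then every nontrivial character of the torus has infinite
  order on some generator.  Suitable twists spread this to all generators and all characters from a given
  finite set, and then the powers of each generator are \<open>\<epsilon>\<close>-dense, so that further twists move the tuple
  close to any given one.  Conversely, the image of a representation does not change along its orbit,
  and every point of the torus is in the image of some representation.
\<close>

section \<open>Powers of torus elements and symplectic moves\<close>

text \<open>For a fixed character at most one exponent of a move destroys genericity. There are
  infinitely many characters but only countably many exponents, so an exponent that is good for all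
  characters at once need not exist. Density of powers is therefore needed in an effective form: the
  finite set \<open>X\<close> in \<open>powers_dense_in_torus\<close> depends on \<epsilon> and the
  dimension but not on the point, so it can be fixed before any move is made. Genericity means
  infinite order rather than a nontrivial value because only infinite order survives all but
  finitely many powers of a move.

  Twists inside single handles never mix the holonomies of different handles; the belts around two
  neighbouring handles do this.

  On the topological side a unitary character of paths has a potential on every convex parameter
  domain: on the disc, on a chart, on the strip that covers an annulus. Comparing two potentials on
  a common domain is the one device behind the triviality criterion for loops and the action of
  twists on holonomies. Crossing numbers with the same annuli provide characters with prescribed
  holonomies.\<close>

definition torus_char :: "('n::finite \<Rightarrow> int) \<Rightarrow> ('n \<Rightarrow> complex) \<Rightarrow> complex" where
  "torus_char \<kappa> z = (\<Prod>i\<in>UNIV. z i powi \<kappa> i)"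

definition unimodular :: "('n \<Rightarrow> complex) \<Rightarrow> bool" where
  "unimodular z \<longleftrightarrow> (\<forall>i. cmod (z i) = 1)"

lemma unimodular_nonzero: "unimodular z \<Longrightarrow> z i \<noteq> 0"
  unfolding unimodular_def by (metis norm_zero zero_neq_one)

lemma unimodular_mult: "unimodular z \<Longrightarrow> unimodular w \<Longrightarrow> unimodular (\<lambda>i. z i * w i)"
  by (simp add: unimodular_def norm_mult)

lemma unimodular_power: "unimodular z \<Longrightarrow> unimodular (\<lambda>i. z i ^ k)"
  by (simp add: unimodular_def norm_power)

lemma unimodular_inverse: "unimodular z \<Longrightarrow> unimodular (\<lambda>i. inverse (z i))"
  by (simp add: unimodular_def norm_inverse)

lemma torus_char_mult:
  "torus_char \<kappa> (\<lambda>i. z i * w i) = torus_char \<kappa> z * torus_char \<kappa> w"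
  by (simp add: torus_char_def power_int_mult_distrib prod.distrib)

lemma torus_char_power: "torus_char \<kappa> (\<lambda>i. z i ^ k) = torus_char \<kappa> z ^ k"
  by (induction k) (simp_all add: torus_char_mult, simp add: torus_char_def)

lemma norm_torus_char: "unimodular z \<Longrightarrow> cmod (torus_char \<kappa> z) = 1"
  by (simp add: torus_char_def unimodular_def norm_power_int prod_norm[symmetric])

section \<open>Mean values of trigonometric sums and density of powers\<close>

text \<open>The geometric sums themselves stay bounded by \<open>2 / cmod (w - 1)\<close>.\<close>

lemma geometric_mean_tendsto:
  fixes w :: complex
  assumes "cmod w = 1" "w \<noteq> 1"
  shows "(\<lambda>M. (\<Sum>m<M. w ^ m) / of_nat M) \<longlonglongrightarrow> 0"
proof (rule Lim_null_comparison)
  show "\<forall>\<^sub>F M in sequentially. norm ((\<Sum>m<M. w ^ m) / of_nat M) \<le> (2 / cmod (w - 1)) / real M"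
  proof (intro always_eventually allI)
    fix M
    have "cmod (w ^ M - 1) \<le> 2"
      using norm_triangle_ineq4[of "w ^ M" 1] assms by (simp add: norm_power)
    then have "cmod (\<Sum>m<M. w ^ m) \<le> 2 / cmod (w - 1)"
      using assms by (simp add: geometric_sum norm_divide divide_right_mono)
    then have "cmod (\<Sum>m<M. w ^ m) / real M \<le> 2 / cmod (w - 1) / real M"
      by (rule divide_right_mono) simp
    then show "norm ((\<Sum>m<M. w ^ m) / of_nat M) \<le> (2 / cmod (w - 1)) / real M"
      by (simp add: norm_divide)
  qed
  show "(\<lambda>M. (2 / cmod (w - 1)) / real M) \<longlonglongrightarrow> 0"
    by real_asymp
qed

text \<open>Parseval's identity for the mean over the exponents. After expanding the square, the
  mean of an off-diagonal term vanishes because distinct unit numbers have a quotient different from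
  1.\<close>

lemma trig_sum_mean_square:
  fixes A y :: "'k \<Rightarrow> complex"
  assumes "finite K" and y: "\<And>k. k \<in> K \<Longrightarrow> cmod (y k) = 1" and inj: "inj_on y K"
  shows "(\<lambda>M. (\<Sum>m<M. (cmod (\<Sum>k\<in>K. A k * y k ^ m))\<^sup>2) / real M) \<longlonglongrightarrow> (\<Sum>k\<in>K. (cmod (A k))\<^sup>2)"
proof -
  have mean: "(\<lambda>M. (\<Sum>m<M. (y k * cnj (y l)) ^ m) / of_nat M) \<longlonglongrightarrow> (if k = l then 1 else 0)"
    if "k \<in> K" "l \<in> K" for k l
  proof (cases "k = l")
    case True
    have "y k * cnj (y l) = 1"
      using y[OF that(1)] True by (simp add: complex_norm_square[symmetric])
    moreover have "(\<lambda>M. of_nat M / of_nat M :: complex) \<longlonglongrightarrow> 1"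
      by (rule tendsto_eventually) (auto intro!: eventually_sequentiallyI[of 1])
    ultimately show ?thesis using True by simp
  next
    case False
    have "y k * cnj (y l) \<noteq> 1"
    proof
      assume *: "y k * cnj (y l) = 1"
      have "cnj (y l) * y l = 1"
        using y[OF that(2)] by (simp add: complex_norm_square[symmetric] mult.commute)
      then have "y k = y l"
        using * by (metis mult.assoc mult.left_neutral mult.right_neutral)
      then show False using inj that False by (auto dest: inj_onD)
    qed
    then show ?thesis
      using geometric_mean_tendsto[of "y k * cnj (y l)"] y that False by (simp add: norm_mult)
  qed
  have eq: "complex_of_real ((\<Sum>m<M. (cmod (\<Sum>k\<in>K. A k * y k ^ m))\<^sup>2) / real M) =
      (\<Sum>k\<in>K. \<Sum>l\<in>K. A k * cnj (A l) * ((\<Sum>m<M. (y k * cnj (y l)) ^ m) / of_nat M))" for M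
  proof -
    have "complex_of_real ((cmod (\<Sum>k\<in>K. A k * y k ^ m))\<^sup>2) =
        (\<Sum>k\<in>K. \<Sum>l\<in>K. A k * cnj (A l) * (y k * cnj (y l)) ^ m)" for m
      unfolding complex_norm_square
      by (simp add: sum_product power_mult_distrib mult_ac)
    then have "complex_of_real (\<Sum>m<M. (cmod (\<Sum>k\<in>K. A k * y k ^ m))\<^sup>2) =
        (\<Sum>m<M. \<Sum>k\<in>K. \<Sum>l\<in>K. A k * cnj (A l) * (y k * cnj (y l)) ^ m)"
      by simp
    also have "\<dots> = (\<Sum>k\<in>K. \<Sum>m<M. \<Sum>l\<in>K. A k * cnj (A l) * (y k * cnj (y l)) ^ m)"
      by (rule sum.swap)
    also have "\<dots> = (\<Sum>k\<in>K. \<Sum>l\<in>K. \<Sum>m<M. A k * cnj (A l) * (y k * cnj (y l)) ^ m)"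
      by (intro sum.cong refl sum.swap)
    finally show ?thesis
      unfolding of_real_divide by (simp only: sum_divide_distrib sum_distrib_left of_real_of_nat_eq times_divide_eq_right)
  qed
  have "(\<lambda>M. \<Sum>k\<in>K. \<Sum>l\<in>K. A k * cnj (A l) * ((\<Sum>m<M. (y k * cnj (y l)) ^ m) / of_nat M))
      \<longlonglongrightarrow> (\<Sum>k\<in>K. \<Sum>l\<in>K. A k * cnj (A l) * (if k = l then 1 else 0))"
    by (intro tendsto_sum tendsto_mult tendsto_const mean)
  also have "(\<Sum>k\<in>K. \<Sum>l\<in>K. A k * cnj (A l) * (if k = l then 1 else 0)) =
      complex_of_real (\<Sum>k\<in>K. (cmod (A k))\<^sup>2)"
    using \<open>finite K\<close>
    by (simp add: complex_norm_square if_distrib del: of_real_power cong: if_cong)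
  finally show ?thesis
    unfolding eq[symmetric] tendsto_of_real_iff .
qed

text \<open>The parallelogram law for \<open>1\<close> and \<open>x\<close>; it turns the distance
  of \<open>x\<close> from 1 into a loss in the modulus of a kernel factor.\<close>

lemma parallelogram_unit:
  fixes x :: complex
  assumes "cmod x = 1"
  shows "(cmod (1 + x))\<^sup>2 = 4 - (cmod (x - 1))\<^sup>2"
proof -
  have "(Re x)\<^sup>2 + (Im x)\<^sup>2 = 1"
    using assms by (metis cmod_power2 one_power2)
  then show ?thesis
    unfolding cmod_power2 by (simp add: power2_eq_square algebra_simps)
qed

text \<open>
  The squared modulus of the kernel \<open>\<Prod>\<^sub>i (1 + z\<^sub>i\<^sup>m cnj t\<^sub>i)\<^sup>L\<close> is exponentially small in \<open>L\<close>, relative to its maximum,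
  when \<open>z\<^sup>m\<close> is not near \<open>t\<close>, whereas its mean over \<open>m\<close> is only polynomially small as long as no
  nontrivial character of bounded size kills \<open>z\<close>.
\<close>

lemma powers_dense_in_torus:
  fixes \<epsilon> :: real
  assumes "\<epsilon> > 0"
  shows "\<exists>X :: ('n::finite \<Rightarrow> int) set. finite X \<and> (\<lambda>_. 0) \<notin> X \<and>
    (\<forall>z t. unimodular z \<longrightarrow> unimodular t \<longrightarrow> (\<forall>\<kappa>\<in>X. torus_char \<kappa> z \<noteq> 1) \<longrightarrow>
      (\<exists>m::nat. \<forall>i. cmod (z i ^ m - t i) < \<epsilon>))"
proof -
  define d where "d = CARD('n)"
  define e where "e = min \<epsilon> 1"
  have e: "0 < e" "e \<le> \<epsilon>" "e \<le> 1" using assms by (auto simp: e_def)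
  \<comment> \<open>A coordinate at distance at least \<open>e\<close> from its target has kernel
    factor of squared modulus at most \<open>4 - e^2 = 4 * r\<close>. Capping \<open>e\<close> at 1
    keeps \<open>r\<close> positive.\<close>
  define r where "r = 1 - e\<^sup>2 / 4"
  have "e\<^sup>2 \<le> 1" using e by (simp add: power_le_one)
  then have r: "0 < r" "r < 1" using e by (auto simp: r_def)
  \<comment> \<open>The factor \<open>(2 * L) ^ d\<close> is the loss in the lower bound
    \<open>4 ^ L / (2 * L)\<close> for the central binomial coefficient, once per
    coordinate.\<close>
  have "(\<lambda>L. real (2 * L) ^ d * r ^ L) \<longlonglongrightarrow> 0"
    using r by real_asymp
  then have "\<forall>\<^sub>F L in sequentially. real (2 * L) ^ d * r ^ L < 1"
    by (rule order_tendstoD) simp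
  then obtain L where L: "real (2 * L) ^ d * r ^ L < 1" "L > 0"
    by (metis (mono_tags, lifting) eventually_conj eventually_gt_at_top eventually_happens
        trivial_limit_sequentially)
  define K :: "('n \<Rightarrow> nat) set" where "K = PiE UNIV (\<lambda>_. {..L})"
  have finK: "finite K" by (simp add: K_def finite_PiE)
  \<comment> \<open>Differences of distinct exponents that occur in the expanded kernel. If none of
    these characters kills \<open>z\<close>, the frequencies of the kernel are pairwise
    distinct.\<close>
  define X :: "('n \<Rightarrow> int) set"
    where "X = (\<lambda>(\<kappa>, \<mu>). \<lambda>i. int (\<kappa> i) - int (\<mu> i)) ` {(\<kappa>, \<mu>) \<in> K \<times> K. \<kappa> \<noteq> \<mu>}"
  show ?thesis
  proof (intro exI[of _ X] conjI allI impI)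
    have "{(\<kappa>, \<mu>) \<in> K \<times> K. \<kappa> \<noteq> \<mu>} \<subseteq> K \<times> K" by auto
    then show "finite X"
      unfolding X_def using finK by (meson finite_SigmaI finite_imageI finite_subset)
    show "(\<lambda>_. 0) \<notin> X"
      by (auto simp: X_def fun_eq_iff)
  next
    fix z t :: "'n \<Rightarrow> complex"
    assume z: "unimodular z" and t: "unimodular t" and ne: "\<forall>\<kappa>\<in>X. torus_char \<kappa> z \<noteq> 1"
    \<comment> \<open>Coefficients and frequencies of the kernel as a trigonometric sum in the
      exponent \<open>m\<close>, from the binomial theorem in each coordinate.\<close>
    define A where "A \<kappa> = (\<Prod>i\<in>UNIV. of_nat (L choose \<kappa> i) * cnj (t i) ^ \<kappa> i)" for \<kappa> :: "'n \<Rightarrow> nat"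
    define y where "y \<kappa> = (\<Prod>i\<in>UNIV. z i ^ \<kappa> i)" for \<kappa> :: "'n \<Rightarrow> nat"
    have expand: "(\<Sum>\<kappa>\<in>K. A \<kappa> * y \<kappa> ^ m) = (\<Prod>i\<in>UNIV. (1 + z i ^ m * cnj (t i)) ^ L)" for m
    proof -
      have "(\<Prod>i\<in>UNIV. (1 + z i ^ m * cnj (t i)) ^ L) =
          (\<Prod>i\<in>UNIV. \<Sum>k\<le>L. of_nat (L choose k) * (z i ^ m * cnj (t i)) ^ k)"
        by (intro prod.cong refl) (subst add.commute, simp add: binomial_ring)
      also have "\<dots> = (\<Sum>\<kappa>\<in>K. \<Prod>i\<in>UNIV. of_nat (L choose \<kappa> i) * (z i ^ m * cnj (t i)) ^ \<kappa> i)"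
        unfolding K_def by (rule prod_sum_PiE) auto
      also have "\<dots> = (\<Sum>\<kappa>\<in>K. A \<kappa> * y \<kappa> ^ m)"
        by (intro sum.cong refl)
          (simp add: A_def y_def power_mult_distrib prod.distrib prod_power_distrib
            power_mult[symmetric] mult_ac)
      finally show ?thesis ..
    qed
    have y1: "cmod (y \<kappa>) = 1" for \<kappa>
      using z by (simp add: y_def unimodular_def prod_norm[symmetric] norm_power)
    have "inj_on y K"
    proof (rule inj_onI, rule ccontr)
      fix \<kappa> \<mu> assume *: "\<kappa> \<in> K" "\<mu> \<in> K" "y \<kappa> = y \<mu>" "\<kappa> \<noteq> \<mu>"
      have "torus_char (\<lambda>i. int (\<kappa> i) - int (\<mu> i)) z = y \<kappa> / y \<mu>"
        using unimodular_nonzero[OF z]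
        by (simp add: torus_char_def y_def power_int_diff prod_dividef)
      moreover have "y \<mu> \<noteq> 0" using y1[of \<mu>] by auto
      ultimately have "torus_char (\<lambda>i. int (\<kappa> i) - int (\<mu> i)) z = 1" using * by simp
      moreover have "(\<lambda>i. int (\<kappa> i) - int (\<mu> i)) \<in> X"
        unfolding X_def using * by (force intro!: image_eqI[of _ _ "(\<kappa>, \<mu>)"])
      ultimately show False using ne by blast
    qed
    from trig_sum_mean_square[OF finK y1 this, of A]
    have lim: "(\<lambda>M. (\<Sum>m<M. (cmod (\<Prod>i\<in>UNIV. (1 + z i ^ m * cnj (t i)) ^ L))\<^sup>2) / real M)
        \<longlonglongrightarrow> (\<Sum>\<kappa>\<in>K. (cmod (A \<kappa>))\<^sup>2)"
      by (simp add: expand)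
    \<comment> \<open>The Parseval sum factors over the coordinates, and each factor is a sum of
      squared binomial coefficients, which is a central binomial coefficient.\<close>
    have "(\<Sum>\<kappa>\<in>K. (cmod (A \<kappa>))\<^sup>2) = (\<Sum>\<kappa>\<in>K. \<Prod>i\<in>UNIV. real (L choose \<kappa> i) ^ 2)"
      using t by (intro sum.cong refl)
        (simp add: A_def unimodular_def prod_norm[symmetric] norm_mult norm_power prod_power_distrib)
    also have "\<dots> = (\<Prod>i\<in>(UNIV::'n set). \<Sum>k\<le>L. real (L choose k) ^ 2)"
      unfolding K_def by (rule prod_sum_PiE[symmetric]) auto
    also have "(\<Sum>k\<le>L. real (L choose k) ^ 2) = real ((2 * L) choose L)"
      by (simp flip: choose_square_sum)
    finally have sumA: "(\<Sum>\<kappa>\<in>K. (cmod (A \<kappa>))\<^sup>2) = real ((2 * L) choose L) ^ d"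
      by (simp add: d_def)
    have big: "(4 ^ L / (2 * real L)) ^ d \<le> real ((2 * L) choose L) ^ d"
      by (intro power_mono central_binomial_lower_bound L) simp
    show "\<exists>m. \<forall>i. cmod (z i ^ m - t i) < \<epsilon>"
    proof (rule ccontr)
      assume "\<not> ?thesis"
      then have far: "\<exists>i. cmod (z i ^ m - t i) \<ge> e" for m
        using e by (meson not_le order_trans)
      have bound: "(cmod (\<Prod>i\<in>UNIV. (1 + z i ^ m * cnj (t i)) ^ L))\<^sup>2 \<le> (4 ^ L) ^ d * r ^ L" for m
      proof -
        define f where "f i = (cmod (1 + z i ^ m * cnj (t i)))\<^sup>2" for i
        have u: "cmod (z i ^ m * cnj (t i)) = 1" for i
          using z t by (simp add: unimodular_def norm_mult norm_power)
        have f: "f i = 4 - (cmod (z i ^ m - t i))\<^sup>2" for i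
        proof -
          have "cmod (z i ^ m * cnj (t i) - 1) = cmod (z i ^ m * cnj (t i) - t i * cnj (t i))"
            using t by (simp add: unimodular_def complex_norm_square[symmetric])
          also have "\<dots> = cmod (z i ^ m - t i)"
            using t by (simp add: unimodular_def norm_mult left_diff_distrib[symmetric])
          finally show ?thesis unfolding f_def by (simp add: parallelogram_unit[OF u])
        qed
        have f0: "0 \<le> f i" for i by (simp add: f_def)
        have f4: "f i \<le> 4" for i by (simp add: f)
        from far[of m] obtain j where j: "cmod (z j ^ m - t j) \<ge> e" ..
        have "e\<^sup>2 \<le> (cmod (z j ^ m - t j))\<^sup>2" by (rule power_mono[OF j]) (use e in simp)
        then have fj: "f j \<le> 4 * r" by (simp add: f r_def)
        have "(\<Prod>i\<in>UNIV. f i) = f j * (\<Prod>i\<in>UNIV - {j}. f i)"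
          by (rule prod.remove) auto
        also have "\<dots> \<le> (4 * r) * (\<Prod>i\<in>UNIV - {j}. 4)"
          by (intro mult_mono fj prod_mono prod_nonneg) (use f0 f4 r in auto)
        also have "\<dots> = r * 4 ^ d"
          using card_gt_0_iff[of "UNIV :: 'n set"]
          by (simp add: d_def card_Diff_singleton power_eq_if)
        finally have "(\<Prod>i\<in>UNIV. f i) \<le> r * 4 ^ d" .
        then have "(\<Prod>i\<in>UNIV. f i) ^ L \<le> (r * 4 ^ d) ^ L"
          by (intro power_mono prod_nonneg f0)
        then show ?thesis
          by (simp add: f_def prod_norm[symmetric] norm_power prod_power_distrib power_mult_distrib
              power_mult[symmetric] mult.commute)
      qed
      have "(\<Sum>\<kappa>\<in>K. (cmod (A \<kappa>))\<^sup>2) \<le> (4 ^ L) ^ d * r ^ L"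
      proof (rule LIMSEQ_le_const2[OF lim], intro exI[of _ 1] allI impI)
        fix M :: nat assume "1 \<le> M"
        have "(\<Sum>m<M. (cmod (\<Prod>i\<in>UNIV. (1 + z i ^ m * cnj (t i)) ^ L))\<^sup>2)
            \<le> (\<Sum>m<M. (4 ^ L) ^ d * r ^ L)"
          by (intro sum_mono bound)
        then show "(\<Sum>m<M. (cmod (\<Prod>i\<in>UNIV. (1 + z i ^ m * cnj (t i)) ^ L))\<^sup>2) / real M
            \<le> (4 ^ L) ^ d * r ^ L"
          using \<open>1 \<le> M\<close> by (simp add: divide_le_eq mult.commute)
      qed
      then have "(4 ^ L / (2 * real L)) ^ d \<le> (4 ^ L) ^ d * r ^ L"
        using big sumA by linarith
      then have "(4 ^ L) ^ d \<le> (4 ^ L) ^ d * (real (2 * L) ^ d * r ^ L)"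
        using L(2) by (simp add: power_divide divide_le_eq mult_ac)
      then show False using L(1) by simp
    qed
  qed
qed

text \<open>Approximating the shifted target \<open>t * z^(-N)\<close> by the \<open>m\<close>-th
  power produces the exponent \<open>N + m\<close>. Infinitely many exponents are wanted so that
  finitely many bad ones can be discarded.\<close>

lemma infinitely_many_powers_near:
  assumes z: "unimodular z" and t: "unimodular t"
    and ex: "\<And>t. unimodular t \<Longrightarrow> \<exists>m::nat. \<forall>i. cmod (z i ^ m - t i) < \<epsilon>"
  shows "infinite {m::nat. \<forall>i. cmod (z i ^ m - t i) < \<epsilon>}"
proof -
  have "\<exists>m\<ge>N. \<forall>i. cmod (z i ^ m - t i) < \<epsilon>" for N
  proof -
    have "unimodular (\<lambda>i. t i * inverse (z i) ^ N)"
      using z t by (intro unimodular_mult unimodular_power unimodular_inverse)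
    from ex[OF this] obtain m where m: "\<And>i. cmod (z i ^ m - t i * inverse (z i) ^ N) < \<epsilon>"
      by blast
    have "cmod (z i ^ (N + m) - t i) < \<epsilon>" for i
    proof -
      have "z i ^ (N + m) - t i = z i ^ N * (z i ^ m - t i * inverse (z i) ^ N)"
        using unimodular_nonzero[OF z, of i] by (simp add: power_add field_simps)
      then show ?thesis using m[of i] z by (simp add: norm_mult norm_power unimodular_def)
    qed
    then show ?thesis by (meson le_add1)
  qed
  then show ?thesis
    by (simp add: infinite_nat_iff_unbounded_le)
qed

section \<open>Characters of infinite order and symplectic moves\<close>

definition infinite_order :: "complex \<Rightarrow> bool" where
  "infinite_order u \<longleftrightarrow> (\<forall>N>0. u ^ N \<noteq> 1)"

text \<open>Two bad exponents \<open>k < l\<close> would make \<open>v ^ (l - k)\<close> a root of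
  unity, hence \<open>v\<close>, and then also \<open>u\<close>. So at most one exponent is
  bad.\<close>

lemma infinite_order_mult_power:
  assumes "u \<noteq> 0" "v \<noteq> 0" and "infinite_order u \<or> infinite_order v"
  shows "finite {k::nat. \<not> infinite_order (u * v ^ k)}"
proof -
  have uniq: "k = l" if k: "\<not> infinite_order (u * v ^ k)" and l: "\<not> infinite_order (u * v ^ l)" and "k \<le> l"
    for k l
  proof (rule ccontr)
    assume "k \<noteq> l"
    with \<open>k \<le> l\<close> have "k < l" by simp
    obtain N where N: "N > 0" "(u * v ^ k) ^ N = 1"
      using k by (auto simp: infinite_order_def)
    obtain M where M: "M > 0" "(u * v ^ l) ^ M = 1"
      using l by (auto simp: infinite_order_def)
    have e1: "(u * v ^ k) ^ (N * M) = 1" and e2: "(u * v ^ l) ^ (N * M) = 1"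
      using N M by (simp add: power_mult, metis mult.commute power_mult power_one)
    have "(u * v ^ l) ^ (N * M) = (u * v ^ k) ^ (N * M) * v ^ ((l - k) * (N * M))"
      using \<open>k < l\<close> by (simp add: power_mult_distrib power_mult[symmetric] power_add[symmetric]
          mult.assoc flip: distrib_right)
    then have v: "v ^ ((l - k) * (N * M)) = 1" using e1 e2 by simp
    then have "\<not> infinite_order v"
      using \<open>k < l\<close> N M unfolding infinite_order_def
      by (metis nat_0_less_mult_iff zero_less_diff)
    then have "infinite_order u" using assms by blast
    moreover have "u ^ (N * M * (l - k)) = 1"
    proof -
      have "1 = ((u * v ^ k) ^ (N * M)) ^ (l - k)" using e1 by simp
      also have "\<dots> = u ^ (N * M * (l - k)) * (v ^ ((l - k) * (N * M))) ^ k"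
        by (simp add: power_mult_distrib power_mult[symmetric] mult_ac)
      finally show ?thesis using v by simp
    qed
    ultimately show False
      using \<open>k < l\<close> N M unfolding infinite_order_def
      by (metis nat_0_less_mult_iff zero_less_diff)
  qed
  show ?thesis
  proof (cases "{k::nat. \<not> infinite_order (u * v ^ k)} = {}")
    case False
    then obtain k where "\<not> infinite_order (u * v ^ k)" by blast
    then have "{k::nat. \<not> infinite_order (u * v ^ k)} \<subseteq> {k}"
      using uniq by (metis (mono_tags, lifting) insertCI mem_Collect_eq nat_le_linear subsetI)
    then show ?thesis by (rule finite_subset) simp
  qed (simp del: Collect_empty_eq)
qed

text \<open>
  The three moves are transvections in the integral symplectic group.  Among the reachable states
  choose one that maximises the number of pairs of a relevant character and a coordinate on which the
  character has infinite order; a generic power of a move can only increase it.  Hence there every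
  relevant character has infinite order on every coordinate, and the handles can be steered to their
  targets one after the other.
\<close>

lemma symplectic_moves_dense:
  fixes R :: "(nat \<Rightarrow> 'n::finite \<Rightarrow> complex) \<Rightarrow> (nat \<Rightarrow> 'n \<Rightarrow> complex) \<Rightarrow> bool"
  assumes "R a0 b0"
    and uni: "\<And>a b i. R a b \<Longrightarrow> i < g \<Longrightarrow> unimodular (a i) \<and> unimodular (b i)"
    and A: "\<And>a b i. R a b \<Longrightarrow> i < g \<Longrightarrow> R a (b(i := \<lambda>l. b i l * a i l))"
    and B: "\<And>a b i. R a b \<Longrightarrow> i < g \<Longrightarrow> R (a(i := \<lambda>l. a i l * b i l)) b"
    and E: "\<And>a b i. R a b \<Longrightarrow> Suc i < g \<Longrightarrow>
      R (a(i := \<lambda>l. a i l * b (Suc i) l, Suc i := \<lambda>l. a (Suc i) l * b i l)) b"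
    and nd: "\<And>a b \<kappa>. R a b \<Longrightarrow> \<kappa> \<noteq> (\<lambda>_. 0) \<Longrightarrow>
      \<exists>i<g. infinite_order (torus_char \<kappa> (a i)) \<or> infinite_order (torus_char \<kappa> (b i))"
    and y: "\<And>i. unimodular (ya i)" "\<And>i. unimodular (yb i)"
    and "\<epsilon> > 0"
  shows "\<exists>a b. R a b \<and> (\<forall>i<g. \<forall>l. cmod (a i l - ya i l) < \<epsilon> \<and> cmod (b i l - yb i l) < \<epsilon>)"
proof -
  have Ak: "R a (b(i := \<lambda>l. b i l * a i l ^ k))" if "R a b" "i < g" for a b i and k :: nat
    using that
  proof (induction k)
    case (Suc k)
    from A[OF Suc.IH[OF Suc.prems] Suc.prems(2)] show ?case
      by (rule back_subst[of "R a"]) (auto simp: fun_eq_iff mult_ac)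
  qed simp
  have Bk: "R (a(i := \<lambda>l. a i l * b i l ^ k)) b" if "R a b" "i < g" for a b i and k :: nat
    using that
  proof (induction k)
    case (Suc k)
    from B[OF Suc.IH[OF Suc.prems] Suc.prems(2)] show ?case
      by (rule back_subst[of "\<lambda>a. R a b"]) (auto simp: fun_eq_iff mult_ac)
  qed simp
  have Ek: "R (a(i := \<lambda>l. a i l * b (Suc i) l ^ k, Suc i := \<lambda>l. a (Suc i) l * b i l ^ k)) b"
    if "R a b" "Suc i < g" for a b i and k :: nat
    using that
  proof (induction k)
    case (Suc k)
    from E[OF Suc.IH[OF Suc.prems] Suc.prems(2)] show ?case
      by (rule back_subst[of "\<lambda>a. R a b"]) (auto simp: fun_eq_iff mult_ac)
  qed simp
  obtain X :: "('n \<Rightarrow> int) set" where X: "finite X" "(\<lambda>_. 0) \<notin> X"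
    and near: "\<And>z t. unimodular z \<Longrightarrow> unimodular t \<Longrightarrow> (\<forall>\<kappa>\<in>X. torus_char \<kappa> z \<noteq> 1) \<Longrightarrow>
      (\<exists>m::nat. \<forall>i. cmod (z i ^ m - t i) < \<epsilon>)"
    using powers_dense_in_torus[OF \<open>\<epsilon> > 0\<close>] by metis
  define G where "G z = {\<kappa> \<in> X. infinite_order (torus_char \<kappa> z)}" for z :: "'n \<Rightarrow> complex"
  have finG: "finite (G z)" and GX: "G z \<subseteq> X" for z using X by (auto simp: G_def)
  have spread: "finite {k::nat. \<not> G z \<union> G w \<subseteq> G (\<lambda>l. z l * w l ^ k)}"
    if "unimodular z" "unimodular w" for z w
  proof -
    have ne: "torus_char \<kappa> z \<noteq> 0" "torus_char \<kappa> w \<noteq> 0" for \<kappa>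
      using that norm_torus_char[of z \<kappa>] norm_torus_char[of w \<kappa>] by auto
    have "{k::nat. \<not> G z \<union> G w \<subseteq> G (\<lambda>l. z l * w l ^ k)} \<subseteq>
      (\<Union>\<kappa>\<in>G z \<union> G w. {k. \<not> infinite_order (torus_char \<kappa> z * torus_char \<kappa> w ^ k)})"
      by (auto simp: G_def torus_char_mult torus_char_power)
    moreover have "finite \<dots>"
      using finG by (intro finite_UN_I finite_UnI infinite_order_mult_power ne) (auto simp: G_def)
    ultimately show ?thesis by (rule finite_subset)
  qed
  have spread_ex: "\<exists>k::nat. G z \<union> G w \<subseteq> G (\<lambda>l. z l * w l ^ k)"
    if "unimodular z" "unimodular w" for z w
    using ex_new_if_finite[OF infinite_UNIV_nat spread[OF that]] by auto
  define \<mu> where "\<mu> s = (\<Sum>i<g. card (G (fst s i)) + card (G (snd s i)))"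
    for s :: "(nat \<Rightarrow> 'n \<Rightarrow> complex) \<times> (nat \<Rightarrow> 'n \<Rightarrow> complex)"
  have "\<mu> s \<le> (\<Sum>i<g. card X + card X)" for s
    unfolding \<mu>_def by (intro sum_mono add_mono card_mono X GX)
  then have "\<exists>s. R (fst s) (snd s) \<and> (\<forall>s'. R (fst s') (snd s') \<longrightarrow> \<mu> s' \<le> \<mu> s)"
    using ex_has_greatest_nat[of "\<lambda>s. R (fst s) (snd s)" "(a0, b0)" \<mu>] \<open>R a0 b0\<close>
    by (metis (no_types, lifting) fst_conv snd_conv le_imp_less_Suc less_imp_le)
  then obtain a b where R: "R a b" and max: "\<And>a' b'. R a' b' \<Longrightarrow> \<mu> (a', b') \<le> \<mu> (a, b)"
    by auto
  \<comment> \<open>All summands of \<mu> are monotone, so at the maximum a move that loses no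
    character gains none either.\<close>
  have stable: "G (a' j) = G (a j) \<and> G (b' j) = G (b j)"
    if "R a' b'" "\<And>j. j < g \<Longrightarrow> G (a j) \<subseteq> G (a' j)" "\<And>j. j < g \<Longrightarrow> G (b j) \<subseteq> G (b' j)" "j < g"
    for a' b' j
  proof -
    have le: "card (G (a i)) + card (G (b i)) \<le> card (G (a' i)) + card (G (b' i))" if "i < g" for i
      using that \<open>\<And>j. j < g \<Longrightarrow> G (a j) \<subseteq> G (a' j)\<close> \<open>\<And>j. j < g \<Longrightarrow> G (b j) \<subseteq> G (b' j)\<close>
      by (intro add_mono card_mono finG)
    have "\<mu> (a, b) = \<mu> (a', b')"
      using max[OF that(1)] sum_mono[of "{..<g}", OF le] by (force simp: \<mu>_def)
    then have sums: "(\<Sum>i<g. card (G (a i)) + card (G (b i))) = (\<Sum>i<g. card (G (a' i)) + card (G (b' i)))"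
      by (simp add: \<mu>_def)
    have "card (G (a j)) + card (G (b j)) = card (G (a' j)) + card (G (b' j))"
      by (rule sum_mono_inv[OF sums]) (use le \<open>j < g\<close> in auto)
    then have "card (G (a j)) = card (G (a' j))" "card (G (b j)) = card (G (b' j))"
      using card_mono[OF finG that(2)[OF \<open>j < g\<close>]] card_mono[OF finG that(3)[OF \<open>j < g\<close>]] by linarith+
    then show ?thesis
      using that(2,3)[OF \<open>j < g\<close>] finG by (metis card_subset_eq)
  qed
  \<comment> \<open>A good power of the move would add the characters of \<open>b i\<close> to those
    of \<open>a i\<close>; by maximality they are already there.\<close>
  have GB: "G (b i) \<subseteq> G (a i)" if i: "i < g" for i
  proof -
    obtain k where k: "G (a i) \<union> G (b i) \<subseteq> G (\<lambda>l. a i l * b i l ^ k)"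
      using spread_ex uni[OF R i] by blast
    from stable[OF Bk[OF R i, of k] _ _ i] k show ?thesis by (auto split: if_splits)
  qed
  have GA: "G (a i) \<subseteq> G (b i)" if i: "i < g" for i
  proof -
    obtain k where k: "G (b i) \<union> G (a i) \<subseteq> G (\<lambda>l. b i l * a i l ^ k)"
      using spread_ex uni[OF R i] by blast
    from stable[OF Ak[OF R i, of k] _ _ i] k show ?thesis by (auto split: if_splits)
  qed
  \<comment> \<open>This move changes two coordinates with one exponent, so the exponent has to
    avoid the bad sets of both.\<close>
  have GE: "G (b (Suc i)) \<subseteq> G (a i) \<and> G (b i) \<subseteq> G (a (Suc i))" if i: "Suc i < g" for i
  proof -
    have "finite ({k. \<not> G (a i) \<union> G (b (Suc i)) \<subseteq> G (\<lambda>l. a i l * b (Suc i) l ^ k)} \<union>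
      {k. \<not> G (a (Suc i)) \<union> G (b i) \<subseteq> G (\<lambda>l. a (Suc i) l * b i l ^ k)})"
      using uni[OF R, of i] uni[OF R i] i by (intro finite_UnI spread) auto
    from ex_new_if_finite[OF infinite_UNIV_nat this]
    obtain k where k: "G (a i) \<union> G (b (Suc i)) \<subseteq> G (\<lambda>l. a i l * b (Suc i) l ^ k)"
      "G (a (Suc i)) \<union> G (b i) \<subseteq> G (\<lambda>l. a (Suc i) l * b i l ^ k)" by auto
    define a' where "a' = a(i := \<lambda>l. a i l * b (Suc i) l ^ k, Suc i := \<lambda>l. a (Suc i) l * b i l ^ k)"
    have a': "a' i = (\<lambda>l. a i l * b (Suc i) l ^ k)" "a' (Suc i) = (\<lambda>l. a (Suc i) l * b i l ^ k)"
      "\<And>j. j \<noteq> i \<Longrightarrow> j \<noteq> Suc i \<Longrightarrow> a' j = a j"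
      by (simp_all add: a'_def)
    have R': "R a' b" unfolding a'_def by (rule Ek[OF R i])
    have sub: "G (a j) \<subseteq> G (a' j)" for j
      using k a' by (cases "j = i"; cases "j = Suc i") auto
    have "G (a' i) = G (a i)" "G (a' (Suc i)) = G (a (Suc i))"
      using stable[OF R' sub order_refl] i by auto
    then show ?thesis using k a' by simp
  qed
  \<comment> \<open>Within a handle \<open>GA\<close> and \<open>GB\<close> give equality; together
    with \<open>GE\<close> the inclusions between neighbouring handles close up to a cycle.\<close>
  have all: "G (a i) = G (a 0) \<and> G (b i) = G (a 0)" if "i < g" for i
    using that
  proof (induction i)
    case 0
    then show ?case using GA GB by blast
  next
    case (Suc i)
    then show ?case using GA[of i] GB[of i] GA[of "Suc i"] GB[of "Suc i"] GE[of i] by auto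
  qed
  have full: "X \<subseteq> G (a i) \<and> X \<subseteq> G (b i)" if "i < g" for i
  proof -
    have "\<kappa> \<in> G (a 0)" if "\<kappa> \<in> X" for \<kappa>
    proof -
      have "\<kappa> \<noteq> (\<lambda>_. 0)" using X that by blast
      from nd[OF R this] that all show ?thesis unfolding G_def by blast
    qed
    then show ?thesis using all[OF that] by blast
  qed
  \<comment> \<open>Steering without loss of genericity: infinitely many powers of \<open>z\<close>
    are close to \<open>t / w\<close>, and only finitely many exponents spoil a character in
    \<open>X\<close>.\<close>
  have step: "\<exists>k::nat. X \<subseteq> G (\<lambda>l. w l * z l ^ k) \<and> (\<forall>l. cmod (w l * z l ^ k - t l) < \<epsilon>)"
    if z: "unimodular z" "X \<subseteq> G z" and w: "unimodular w" "X \<subseteq> G w" and t: "unimodular t" for z w t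
  proof -
    have ne1: "\<forall>\<kappa>\<in>X. torus_char \<kappa> z \<noteq> 1"
    proof (intro ballI notI)
      fix \<kappa> assume "\<kappa> \<in> X" "torus_char \<kappa> z = 1"
      moreover from this have "infinite_order (torus_char \<kappa> z)" using z by (auto simp: G_def)
      ultimately show False by (auto simp: infinite_order_def)
    qed
    have "infinite {m::nat. \<forall>i. cmod (z i ^ m - t i * inverse (w i)) < \<epsilon>}"
      using near[OF z(1) _ ne1] w t z
      by (intro infinitely_many_powers_near unimodular_mult unimodular_inverse) auto
    then have "infinite ({m::nat. \<forall>i. cmod (z i ^ m - t i * inverse (w i)) < \<epsilon>} -
        {k. \<not> G w \<union> G z \<subseteq> G (\<lambda>l. w l * z l ^ k)})"
      by (rule Diff_infinite_finite[OF spread[OF w(1) z(1)]])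
    from infinite_imp_nonempty[OF this]
    obtain k where k: "\<forall>i. cmod (z i ^ k - t i * inverse (w i)) < \<epsilon>"
      "G w \<union> G z \<subseteq> G (\<lambda>l. w l * z l ^ k)"
      by blast
    have "cmod (w l * z l ^ k - t l) < \<epsilon>" for l
    proof -
      have "w l * z l ^ k - t l = w l * (z l ^ k - t l * inverse (w l))"
        using unimodular_nonzero[OF w(1), of l] by (simp add: field_simps)
      then show ?thesis using k(1) w by (simp add: norm_mult unimodular_def)
    qed
    then show ?thesis using k w by blast
  qed
  have "\<exists>a b. R a b \<and>
      (\<forall>i<h. \<forall>l. cmod (a i l - ya i l) < \<epsilon> \<and> cmod (b i l - yb i l) < \<epsilon>) \<and>
      (\<forall>i. h \<le> i \<longrightarrow> i < g \<longrightarrow> X \<subseteq> G (a i) \<and> X \<subseteq> G (b i))" if "h \<le> g" for h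
    using that
  proof (induction h)
    case 0
    then show ?case using R full by auto
  next
    case (Suc h)
    then obtain a b where ab: "R a b"
      "\<forall>i<h. \<forall>l. cmod (a i l - ya i l) < \<epsilon> \<and> cmod (b i l - yb i l) < \<epsilon>"
      "\<forall>i. h \<le> i \<longrightarrow> i < g \<longrightarrow> X \<subseteq> G (a i) \<and> X \<subseteq> G (b i)" and h: "h < g" by auto
    \<comment> \<open>The coordinate \<open>b h\<close> is moved first and must stay generic,
      because its powers then steer \<open>a h\<close>. Neither move touches another handle.\<close>
    obtain k where k: "X \<subseteq> G (\<lambda>l. b h l * a h l ^ k)" "\<forall>l. cmod (b h l * a h l ^ k - yb h l) < \<epsilon>"
      using step[of "a h" "b h" "yb h"] uni[OF ab(1) h] ab(3) h y by auto
    define b' where "b' = b(h := \<lambda>l. b h l * a h l ^ k)"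
    have R': "R a b'" unfolding b'_def by (rule Ak[OF ab(1) h])
    obtain m where m: "\<forall>l. cmod (a h l * b' h l ^ m - ya h l) < \<epsilon>"
      using step[of "b' h" "a h" "ya h"] uni[OF R' h] ab(3) h y k by (auto simp: b'_def)
    have R'': "R (a(h := \<lambda>l. a h l * b' h l ^ m)) b'" by (rule Bk[OF R' h])
    show ?case
    proof (intro exI conjI)
      show "R (a(h := \<lambda>l. a h l * b' h l ^ m)) b'" by (rule R'')
    qed (use m k ab in \<open>auto simp: b'_def less_Suc_eq\<close>)
  qed
  from this[of g] show ?thesis by auto
qed

section \<open>Path characters and holonomies\<close>

lemma homotopic_paths_convex_domain:
  fixes C :: "'b::real_normed_vector set" and S :: "'a::topological_space set"
  assumes "convex C" "continuous_on C h" "h ` C \<subseteq> S"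
    and "path \<pi>" "path_image \<pi> \<subseteq> C" "path \<pi>'" "path_image \<pi>' \<subseteq> C"
    and "pathstart \<pi> = pathstart \<pi>'" "pathfinish \<pi> = pathfinish \<pi>'"
  shows "homotopic_paths S (h \<circ> \<pi>) (h \<circ> \<pi>')"
proof -
  have "homotopic_paths C \<pi> \<pi>'"
    using convex_imp_simply_connected[OF assms(1)] assms
    unfolding simply_connected_eq_homotopic_paths by auto
  then show ?thesis
    by (rule homotopic_paths_continuous_image) (use assms in auto)
qed

text \<open>The case of the parameter interval. The identity and inverse laws for concatenation
  follow by writing both sides as \<open>p\<close> composed with paths in \<open>[0, 1]\<close>,
  which works in every topological space.\<close>

lemma homotopic_paths_reparam:
  fixes p :: "real \<Rightarrow> 'a::topological_space"
  assumes "path p" "path_image p \<subseteq> S"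
    and "path \<pi>" "path_image \<pi> \<subseteq> {0..1}" "path \<pi>'" "path_image \<pi>' \<subseteq> {0..1}"
    and "pathstart \<pi> = pathstart \<pi>'" "pathfinish \<pi> = pathfinish \<pi>'"
  shows "homotopic_paths S (p \<circ> \<pi>) (p \<circ> \<pi>')"
  by (rule homotopic_paths_convex_domain[where C = "{0..1}"])
    (use assms in \<open>auto simp: path_def path_image_def\<close>)

lemma path_compose_linepath:
  fixes p :: "real \<Rightarrow> 'a::topological_space"
  assumes "path p" "path_image p \<subseteq> S" "closed_segment x y \<subseteq> {0..1}"
  shows "path (p \<circ> linepath x y)" "path_image (p \<circ> linepath x y) \<subseteq> S"
proof -
  have "continuous_on (path_image (linepath x y)) p"
    using assms(1,3) continuous_on_subset by (fastforce simp: path_def)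
  then show "path (p \<circ> linepath x y)"
    by (rule path_continuous_image[OF path_linepath])
  show "path_image (p \<circ> linepath x y) \<subseteq> S"
    using assms(2,3) by (auto simp: path_image_compose path_image_def[of p])
qed

lemma ratio_swap:
  fixes w v w' v' :: "'b::field"
  assumes "v \<noteq> 0" "v' \<noteq> 0" "w \<noteq> 0" "w / v = w' / v'"
  shows "w' / w = v' / v"
proof -
  have "w' * v = v' * w" using assms by (simp add: frac_eq_eq mult.commute)
  then show ?thesis using assms by (simp add: frac_eq_eq)
qed

lemma compose_linepath_01: "p \<circ> linepath (0::real) 1 = p"
  by (auto simp: linepath_def)

lemma compose_linepath_10: "p \<circ> linepath (1::real) 0 = reversepath p"
  by (auto simp: linepath_def reversepath_def)

lemma compose_linepath_same: "p \<circ> linepath x x = (\<lambda>_. p x)"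
  by (auto simp: linepath_def scaleR_left_distrib[symmetric])

lemma path_const: "path (\<lambda>_. x)"
  by (simp add: path_def)

lemma pathstart_const [simp]: "pathstart (\<lambda>_. x) = x"
  by (simp add: pathstart_def)

lemma pathfinish_const [simp]: "pathfinish (\<lambda>_. x) = x"
  by (simp add: pathfinish_def)

lemma path_image_const [simp]: "path_image (\<lambda>_. x) = {x}"
  by (auto simp: path_image_def)

lemma homotopic_paths_right_id:
  fixes p :: "real \<Rightarrow> 'a::topological_space"
  assumes "path p" "path_image p \<subseteq> S" "pathfinish p = x"
  shows "homotopic_paths S (p +++ (\<lambda>_. x)) p"
proof -
  have "homotopic_paths S (p \<circ> (linepath 0 1 +++ linepath 1 1)) (p \<circ> linepath 0 1)"
    by (rule homotopic_paths_reparam) (use assms in \<open>auto simp: path_image_join closed_segment_eq_real_ivl\<close>)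
  then show ?thesis
    using assms by (simp add: path_compose_join compose_linepath_01 compose_linepath_same pathfinish_def)
qed

lemma homotopic_paths_left_id:
  fixes p :: "real \<Rightarrow> 'a::topological_space"
  assumes "path p" "path_image p \<subseteq> S" "pathstart p = x"
  shows "homotopic_paths S ((\<lambda>_. x) +++ p) p"
proof -
  have "homotopic_paths S (p \<circ> (linepath 0 0 +++ linepath 0 1)) (p \<circ> linepath 0 1)"
    by (rule homotopic_paths_reparam) (use assms in \<open>auto simp: path_image_join closed_segment_eq_real_ivl\<close>)
  then show ?thesis
    using assms by (simp add: path_compose_join compose_linepath_01 compose_linepath_same pathstart_def)
qed

lemma homotopic_paths_right_inv:
  fixes p :: "real \<Rightarrow> 'a::topological_space"
  assumes "path p" "path_image p \<subseteq> S" "pathstart p = x"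
  shows "homotopic_paths S (p +++ reversepath p) (\<lambda>_. x)"
proof -
  have "homotopic_paths S (p \<circ> (linepath 0 1 +++ linepath 1 0)) (p \<circ> linepath 0 0)"
    by (rule homotopic_paths_reparam)
      (use assms in \<open>auto simp: path_image_join closed_segment_eq_real_ivl\<close>)
  then show ?thesis
    using assms
    by (simp add: path_compose_join compose_linepath_01 compose_linepath_10 compose_linepath_same
        pathstart_def)
qed

lemma homotopic_paths_left_inv:
  fixes p :: "real \<Rightarrow> 'a::topological_space"
  assumes "path p" "path_image p \<subseteq> S" "pathfinish p = x"
  shows "homotopic_paths S (reversepath p +++ p) (\<lambda>_. x)"
  using homotopic_paths_right_inv[of "reversepath p" S x] assms by simp

text \<open>
  A path character is a flat unitary line bundle over \<open>S\<close> together with a trivialisation of its fibres.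
  It restricts to a homomorphism on the loops at any base point, so base points play no role.
\<close>

locale path_character =
  fixes S :: "'a::topological_space set" and c :: "(real \<Rightarrow> 'a) \<Rightarrow> complex"
  assumes join: "path p \<Longrightarrow> path_image p \<subseteq> S \<Longrightarrow> path r \<Longrightarrow> path_image r \<subseteq> S \<Longrightarrow>
      pathfinish p = pathstart r \<Longrightarrow> c (p +++ r) = c p * c r"
    and homotopic: "homotopic_paths S p r \<Longrightarrow> c p = c r"
    and norm_1: "path p \<Longrightarrow> path_image p \<subseteq> S \<Longrightarrow> cmod (c p) = 1"
begin

lemma nonzero: "path p \<Longrightarrow> path_image p \<subseteq> S \<Longrightarrow> c p \<noteq> 0"
  using norm_1[of p] by auto

lemma cong:
  "path p \<Longrightarrow> path_image p \<subseteq> S \<Longrightarrow> (\<And>t. t \<in> {0..1} \<Longrightarrow> p t = r t) \<Longrightarrow> c p = c r"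
  by (rule homotopic) (rule homotopic_paths_eq)

lemma const: "x \<in> S \<Longrightarrow> c (\<lambda>_. x) = 1"
  using join[of "\<lambda>_. x" "\<lambda>_. x"] nonzero[of "\<lambda>_. x"] homotopic_paths_right_id[of "\<lambda>_. x" S x, THEN homotopic]
  by (simp add: path_const)

lemma reverse:
  assumes "path p" "path_image p \<subseteq> S"
  shows "c (reversepath p) = inverse (c p)"
proof -
  have "pathstart p \<in> S" using assms by auto
  then have "c p * c (reversepath p) = 1"
    using homotopic[OF homotopic_paths_right_inv[OF assms refl]] const[of "pathstart p"]
      join[of p "reversepath p"] assms by simp
  then show ?thesis by (metis inverse_unique)
qed

text \<open>Take \<open>u z\<close> to be the value of \<open>c\<close> on the image of the segment
  from a fixed point to \<open>z\<close>. By convexity that segment followed by a path is homotopic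
  to the segment to the end of the path.\<close>

lemma potential:
  fixes C :: "'b::real_normed_vector set"
  assumes "convex C" "continuous_on C h" "h ` C \<subseteq> S"
  obtains u where "\<And>z. z \<in> C \<Longrightarrow> cmod (u z) = 1"
    and "\<And>\<pi>. path \<pi> \<Longrightarrow> path_image \<pi> \<subseteq> C \<Longrightarrow> c (h \<circ> \<pi>) = u (pathfinish \<pi>) / u (pathstart \<pi>)"
proof (cases "C = {}")
  case True
  show ?thesis
    by (rule that[of "\<lambda>_. 1"]) (use True in auto)
next
  case False
  then obtain a where a: "a \<in> C" by blast
  define u where "u z = c (h \<circ> linepath a z)" for z
  have path_h: "path (h \<circ> \<pi>) \<and> path_image (h \<circ> \<pi>) \<subseteq> S" if "path \<pi>" "path_image \<pi> \<subseteq> C" for \<pi>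
    using that assms continuous_on_subset[OF assms(2) that(2)]
    by (auto intro!: path_continuous_image simp: path_image_compose)
  have line: "path_image (linepath a z) \<subseteq> C" if "z \<in> C" for z
    using a that assms(1) by (simp add: closed_segment_subset)
  have unit: "cmod (u z) = 1" if "z \<in> C" for z
    unfolding u_def using norm_1 path_h[OF path_linepath line[OF that]] by blast
  show ?thesis
  proof (rule that[of u])
    fix \<pi> assume \<pi>: "path \<pi>" "path_image \<pi> \<subseteq> C"
    have ends: "pathstart \<pi> \<in> C" "pathfinish \<pi> \<in> C"
      using \<pi>(2) by auto
    have "c (h \<circ> (linepath a (pathstart \<pi>) +++ \<pi>)) = c (h \<circ> linepath a (pathfinish \<pi>))"
      by (intro homotopic homotopic_paths_convex_domain[OF assms])
        (use \<pi> line ends in \<open>auto simp: path_image_join\<close>)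
    then have "u (pathstart \<pi>) * c (h \<circ> \<pi>) = u (pathfinish \<pi>)"
      unfolding path_compose_join u_def
      using path_h[OF path_linepath line[OF ends(1)]] path_h[OF \<pi>]
      by (subst (asm) join) (auto simp: pathfinish_compose pathstart_compose)
    then show "c (h \<circ> \<pi>) = u (pathfinish \<pi>) / u (pathstart \<pi>)"
      using unit[OF ends(1)] by (metis nonzero_mult_div_cancel_left norm_zero zero_neq_one)
  qed (rule unit)
qed

end

section \<open>The glued polygon and its holonomies\<close>

locale glued_surface =
  fixes g :: nat and S :: "'a::topological_space set" and q :: "complex \<Rightarrow> 'a"
  assumes genus: "g \<ge> 1"
    and quotient: "quotient_map (top_of_set (cball 0 1)) (top_of_set S) q"
    and q_eq: "z \<in> cball 0 1 \<Longrightarrow> w \<in> cball 0 1 \<Longrightarrow> q z = q w \<longleftrightarrow> (z, w) \<in> gluing g"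
    and chart: "x \<in> S \<Longrightarrow> \<exists>U. openin (top_of_set S) U \<and> x \<in> U \<and> U homeomorphic (UNIV :: (real^2) set)"
begin

abbreviation side where "side \<equiv> polygon_side g"

lemma norm_side [simp]: "cmod (side j t) = 1"
  by (simp add: polygon_side_def)

lemma side_in_disc: "side j t \<in> cball 0 1"
  by simp

lemma chord_in_disc: "closed_segment (side j t) (side k s) \<subseteq> cball 0 1"
  by (intro closed_segment_subset convex_cball side_in_disc)

lemma continuous_side: "continuous_on A (side j)"
  unfolding polygon_side_def by (intro continuous_intros) (use genus in auto)

lemma q_continuous: "continuous_on (cball 0 1) q"
  using quotient_imp_continuous_map[OF quotient] by simp

lemma q_surj: "q ` cball 0 1 = S"
  using quotient_imp_surjective_map[OF quotient] by simp

lemma q_in: "z \<in> cball 0 1 \<Longrightarrow> q z \<in> S"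
  using q_surj by blast

lemma path_q:
  assumes "path \<pi>" "path_image \<pi> \<subseteq> cball 0 1"
  shows "path (q \<circ> \<pi>)" "path_image (q \<circ> \<pi>) \<subseteq> S"
  using assms continuous_on_subset[OF q_continuous assms(2)] q_surj
  by (auto intro!: path_continuous_image simp: path_image_compose)

lemma glue:
  assumes "i < g" "j = 4 * i \<or> j = 4 * i + 1" "t \<in> {0..1}"
  shows "q (side j t) = q (side (j + 2) (1 - t))"
proof -
  have "(side j t, side (j + 2) (1 - t)) \<in> side_pairing g"
    using assms unfolding side_pairing_def by (auto simp: numeral_eq_Suc)
  then show ?thesis by (subst q_eq) (auto simp: gluing_def)
qed

text \<open>The gluing relation is generated by the side pairing, so a function on the disc descends
  to \<open>S\<close> once it respects the pairs. Potentials, twists and crossing maps are all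
  obtained in this way.\<close>

lemma gluing_invariant:
  assumes "\<And>i j t. i < g \<Longrightarrow> j = 4 * i \<or> j = 4 * i + 1 \<Longrightarrow> t \<in> {0..1} \<Longrightarrow>
      f (side j t) = f (side (j + 2) (1 - t))"
    and "z \<in> cball 0 1" "w \<in> cball 0 1" "q z = q w"
  shows "f z = f w"
proof -
  have pair: "f z = f w" if "(z, w) \<in> side_pairing g" for z w
    using that assms(1)[of _ "4 * _"] assms(1)[of _ "4 * _ + 1"]
    unfolding side_pairing_def by (auto simp: numeral_eq_Suc)
  have "(z, w) \<in> (side_pairing g \<union> (side_pairing g)\<inverse>)\<^sup>*"
    using assms q_eq by (auto simp: gluing_def)
  then show ?thesis
    by (induction rule: rtrancl_induct) (use pair in fastforce)+
qed

text \<open>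
  Only \<open>j = 4 * i\<close> and \<open>j = 4 * i + 1\<close> are meaningful: side \<open>j\<close> is then glued to side \<open>j + 2\<close>, and the chord
  joining the midpoints of these sides is a loop in \<open>S\<close>.  The \<open>2 * g\<close> loops obtained in this way generate
  the fundamental group.
\<close>

definition holonomy :: "((real \<Rightarrow> 'a) \<Rightarrow> complex) \<Rightarrow> nat \<Rightarrow> complex" where
  "holonomy c j = c (q \<circ> linepath (side (j + 2) (1/2)) (side j (1/2)))"

lemma disc_potential:
  assumes "path_character S c"
  obtains u where "\<And>z. z \<in> cball 0 1 \<Longrightarrow> cmod (u z) = 1"
    and "\<And>\<pi>. path \<pi> \<Longrightarrow> path_image \<pi> \<subseteq> cball 0 1 \<Longrightarrow>
      c (q \<circ> \<pi>) = u (pathfinish \<pi>) / u (pathstart \<pi>)"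
proof (rule path_character.potential[OF assms convex_cball q_continuous])
  show "q ` cball 0 1 \<subseteq> S" using q_surj by simp
qed (rule that)

text \<open>The arcs from the midpoints of two glued sides to the points \<open>t\<close> and
  \<open>1 - t\<close> have the same image in \<open>S\<close>, so the quotient of the two boundary
  values of \<open>u\<close> is constant along the side. At the midpoints it is the
  holonomy.\<close>

lemma potential_jump:
  assumes c: "path_character S c"
    and unit: "\<And>z. z \<in> cball 0 1 \<Longrightarrow> cmod (u z) = 1"
    and u: "\<And>\<pi>. path \<pi> \<Longrightarrow> path_image \<pi> \<subseteq> cball 0 1 \<Longrightarrow>
      c (q \<circ> \<pi>) = u (pathfinish \<pi>) / u (pathstart \<pi>)"
    and j: "i < g" "j = 4 * i \<or> j = 4 * i + 1" and t: "t \<in> {0..1}"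
  shows "u (side j t) = holonomy c j * u (side (j + 2) (1 - t))"
proof -
  interpret path_character S c by (rule c)
  define A where "A = side j \<circ> linepath (1/2) t"
  define B where "B = side (j + 2) \<circ> linepath (1/2) (1 - t)"
  have A: "path A" "path_image A \<subseteq> cball 0 1" and B: "path B" "path_image B \<subseteq> cball 0 1"
    unfolding A_def B_def path_image_compose
    by (intro path_continuous_image continuous_side path_linepath image_subsetI side_in_disc)+
  have "c (q \<circ> A) = c (q \<circ> B)"
  proof (rule cong)
    fix s :: real assume "s \<in> {0..1}"
    then have "linepath (1/2) t s \<in> closed_segment (1/2) t"
      by (rule linepath_in_path)
    moreover have "closed_segment (1/2) t \<subseteq> {0..1}"
      using t by (intro closed_segment_subset) auto
    ultimately have "linepath (1/2) t s \<in> {0..1}" by blast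
    moreover have "1 - linepath (1/2) t s = linepath (1/2) (1 - t) s"
      by (simp add: linepath_def algebra_simps)
    ultimately show "(q \<circ> A) s = (q \<circ> B) s"
      using glue[OF j, of "linepath (1/2) t s"] by (simp add: A_def B_def)
  qed (use path_q A in auto)
  then have *: "u (side j t) / u (side j (1/2)) = u (side (j + 2) (1 - t)) / u (side (j + 2) (1/2))"
    using u[OF A] u[OF B] by (simp add: A_def B_def pathstart_compose pathfinish_compose)
  have "holonomy c j = u (side j (1/2)) / u (side (j + 2) (1/2))"
    unfolding holonomy_def using u[of "linepath (side (j + 2) (1/2)) (side j (1/2))"] chord_in_disc by simp
  moreover have "u (side j (1/2)) \<noteq> 0" "u (side (j + 2) (1/2)) \<noteq> 0"
    using unit side_in_disc by (metis norm_zero zero_neq_one)+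
  moreover have "u (side j t) = (u (side j t) / u (side j (1/2))) * u (side j (1/2))"
    using calculation(2) by simp
  ultimately show ?thesis unfolding * by simp
qed

text \<open>
  This takes the place of van Kampen's theorem.  The potential \<open>v\<close> of \<open>c\<close> on the disc descends to \<open>S\<close>.
  On a chart domain \<open>U\<close> there is also a potential of \<open>c\<close>; its quotient by \<open>v\<close> is locally constant on the
  preimage of \<open>U\<close>, so it is locally constant on \<open>U\<close> and therefore constant.  Thus \<open>v\<close> is a
  potential of \<open>c\<close> along every path in \<open>S\<close>.
\<close>

theorem path_character_trivial:
  assumes c: "path_character S c"
    and holonomy: "\<And>i j. i < g \<Longrightarrow> j = 4 * i \<or> j = 4 * i + 1 \<Longrightarrow> holonomy c j = 1"
    and p: "path p" "path_image p \<subseteq> S" "pathfinish p = pathstart p"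
  shows "c p = 1"
proof -
  interpret path_character S c by (rule c)
  let ?D = "cball (0::complex) 1"
  obtain v where unit: "\<And>z. z \<in> ?D \<Longrightarrow> cmod (v z) = 1"
    and v: "\<And>\<pi>. path \<pi> \<Longrightarrow> path_image \<pi> \<subseteq> ?D \<Longrightarrow>
      c (q \<circ> \<pi>) = v (pathfinish \<pi>) / v (pathstart \<pi>)"
    by (rule disc_potential[OF c]) (rule that)
  have v_eq: "v z = v w" if "z \<in> ?D" "w \<in> ?D" "q z = q w" for z w
  proof (rule gluing_invariant[where f = v, OF _ that])
    fix i j :: nat and t :: real
    assume ij: "i < g" "j = 4 * i \<or> j = 4 * i + 1" and t: "t \<in> {0..1}"
    have "v (side j t) = holonomy c j * v (side (j + 2) (1 - t))"
      by (rule potential_jump[where u = v]) (fact c unit v ij t)+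
    then show "v (side j t) = v (side (j + 2) (1 - t))"
      unfolding holonomy[OF ij] by simp
  qed
  \<comment> \<open>The descended potential; \<open>v_eq\<close> makes the choice of the preimage
    irrelevant.\<close>
  define vb where "vb y = v (inv_into ?D q y)" for y
  have vb: "vb (q z) = v z" if "z \<in> ?D" for z
    unfolding vb_def
  proof (rule v_eq)
    show "inv_into ?D q (q z) \<in> ?D" using that by (intro inv_into_into imageI)
    show "q (inv_into ?D q (q z)) = q z" using that by (intro f_inv_into_f imageI)
  qed (rule that)
  have vb1: "cmod (vb y) = 1" if "y \<in> S" for y
    using that vb unit unfolding q_surj[symmetric] by fastforce
  have local: "\<exists>U. openin (top_of_set S) U \<and> y \<in> U \<and>
      (\<forall>p. path p \<longrightarrow> path_image p \<subseteq> U \<longrightarrow> c p = vb (pathfinish p) / vb (pathstart p))"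
    if "y \<in> S" for y
  proof -
    from chart[OF that] obtain U where U: "openin (top_of_set S) U" "y \<in> U"
      "U homeomorphic (UNIV :: (real^2) set)" by blast
    have US: "U \<subseteq> S" using U(1) by (rule openin_imp_subset)
    obtain k :: "real^2 \<Rightarrow> 'a" and k' where k: "homeomorphism UNIV U k k'"
      using U(3) unfolding homeomorphic_def using homeomorphism_symD by blast
    have kc: "continuous_on UNIV k" "k ` UNIV \<subseteq> S" "k ` UNIV = U" "continuous_on U k'"
      using k US by (auto simp: homeomorphism_def)
    obtain w where w1: "\<And>z. cmod (w z) = 1"
      and w: "\<And>\<pi>. path \<pi> \<Longrightarrow> c (k \<circ> \<pi>) = w (pathfinish \<pi>) / w (pathstart \<pi>)"
      by (rule potential[OF convex_UNIV kc(1,2)]) (rule that, simp_all)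
    have wU: "c r = w (k' (pathfinish r)) / w (k' (pathstart r))"
      if r: "path r" "path_image r \<subseteq> U" for r
    proof -
      have "path (k' \<circ> r)"
        using r(1) continuous_on_subset[OF kc(4) r(2)] by (rule path_continuous_image)
      moreover have "c r = c (k \<circ> (k' \<circ> r))"
      proof (rule cong)
        fix t :: real assume "t \<in> {0..1}"
        then have "r t \<in> U" using r by (auto simp: path_image_def)
        then show "r t = (k \<circ> (k' \<circ> r)) t" using k by (simp add: homeomorphism_def)
      qed (use r US in auto)
      ultimately show ?thesis using w by (simp add: pathstart_compose pathfinish_compose)
    qed
    \<comment> \<open>Quotient of the two candidate potentials on the chart domain.\<close>
    define R where "R y = w (k' y) / vb y" for y
    have "R constant_on U"
    proof (rule locally_constant_imp_constant)
      show "connected U"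
        using connected_continuous_image[OF kc(1) connected_UNIV] kc(3) by simp
      fix a assume "a \<in> U"
      define T where "T = {y \<in> U. R y = R a}"
      \<comment> \<open>Openness of \<open>T\<close> is tested in the disc, because \<open>q\<close>
        is a quotient map. There a short segment lies over \<open>U\<close>, and both potentials
        compute the value of \<open>c\<close> on its image.\<close>
      have "openin (top_of_set ?D) {z \<in> ?D. q z \<in> T}"
        unfolding openin_contains_ball
      proof (intro conjI ballI)
        fix z assume z: "z \<in> {z \<in> ?D. q z \<in> T}"
        have "openin (top_of_set ?D) {z \<in> ?D. q z \<in> U}"
          using openin_continuous_map_preimage[OF quotient_imp_continuous_map[OF quotient] U(1)]
          by simp
        then obtain e where e: "e > 0" "ball z e \<inter> ?D \<subseteq> {z \<in> ?D. q z \<in> U}"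
          using z unfolding openin_contains_ball T_def by blast
        have "q z2 \<in> T" if z2: "z2 \<in> ball z e \<inter> ?D" for z2
        proof -
          have seg: "closed_segment z z2 \<subseteq> ball z e \<inter> ?D"
            using z z2 e by (intro closed_segment_subset convex_Int convex_ball convex_cball) auto
          have "path_image (q \<circ> linepath z z2) \<subseteq> U"
            using seg e by (auto simp: path_image_compose)
          moreover have "path (q \<circ> linepath z z2)"
            using seg by (intro path_q) auto
          ultimately have "c (q \<circ> linepath z z2) = w (k' (q z2)) / w (k' (q z))"
            by (subst wU) (auto simp: pathstart_compose pathfinish_compose)
          moreover have "c (q \<circ> linepath z z2) = vb (q z2) / vb (q z)"
            using z z2 seg by (subst v) (auto simp: vb)
          moreover have "vb (q z2) \<noteq> 0" "vb (q z) \<noteq> 0"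
            using vb1[OF q_in, of z] vb1[OF q_in, of z2] z z2 by auto
          moreover have "w (k' (q z)) \<noteq> 0"
            using w1 by (metis norm_zero zero_neq_one)
          ultimately have "R (q z2) = R (q z)"
            by (simp add: R_def field_simps)
          then show ?thesis using z z2 e unfolding T_def by auto
        qed
        then show "\<exists>e>0. ball z e \<inter> ?D \<subseteq> {z \<in> ?D. q z \<in> T}" using e by auto
      qed auto
      moreover have "T \<subseteq> S" using US by (auto simp: T_def)
      then have "openin (top_of_set ?D) {z \<in> ?D. q z \<in> T} \<longleftrightarrow> openin (top_of_set S) T"
        using quotient unfolding quotient_map_def by simp
      ultimately have "openin (top_of_set S) T" by simp
      then have "openin (top_of_set U) T"
        by (rule openin_subset_trans) (use US T_def in auto)
      then show "\<exists>T. openin (top_of_set U) T \<and> a \<in> T \<and> (\<forall>x\<in>T. R x = R a)"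
        using \<open>a \<in> U\<close> by (intro exI[of _ T]) (auto simp: T_def)
    qed
    then obtain r where r: "\<And>y. y \<in> U \<Longrightarrow> R y = r" unfolding constant_on_def by blast
    have "c p = vb (pathfinish p) / vb (pathstart p)" if p: "path p" "path_image p \<subseteq> U" for p
    proof -
      have e: "pathstart p \<in> U" "pathfinish p \<in> U" using p by auto
      have "vb (pathstart p) \<noteq> 0" "vb (pathfinish p) \<noteq> 0"
        using vb1 e US by (metis norm_zero subsetD zero_neq_one)+
      moreover have "w (k' (pathstart p)) \<noteq> 0"
        using w1 by (metis norm_zero zero_neq_one)
      moreover have "R (pathstart p) = R (pathfinish p)" using r e by simp
      ultimately show ?thesis
        unfolding wU[OF p] R_def by (rule ratio_swap)
    qed
    then show ?thesis using U by blast
  qed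
  have pt: "p t \<in> S" if "t \<in> {0..1}" for t
    using p that by (auto simp: path_image_def)
  \<comment> \<open>Compares \<open>c\<close> on the initial part of \<open>p\<close> with the
    descended potential. Local constancy gives \<open>f 0 = f 1\<close>, and the denominators agree
    because \<open>p\<close> is a loop.\<close>
  define f where "f t = c (p \<circ> linepath 0 t) / vb (p t)" for t
  have "f constant_on {0..1}"
  proof (rule locally_constant_imp_constant)
    fix a :: real assume a: "a \<in> {0..1}"
    from local[OF pt[OF a]] obtain U where U: "openin (top_of_set S) U" "p a \<in> U"
      and Uc: "\<And>r. path r \<Longrightarrow> path_image r \<subseteq> U \<Longrightarrow> c r = vb (pathfinish r) / vb (pathstart r)"
      by blast
    have "continuous_map (top_of_set {0..1}) (top_of_set S) p"
      using p by (auto simp: path_def path_image_def)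
    from openin_continuous_map_preimage[OF this U(1)]
    have "openin (top_of_set {0..1}) {t \<in> {0..1}. p t \<in> U}" by simp
    then obtain e where e: "e > 0" "ball a e \<inter> {0..1} \<subseteq> {t \<in> {0..1}. p t \<in> U}"
      using a U unfolding openin_contains_ball by blast
    have fa: "f t = f a" if t: "t \<in> ball a e \<inter> {0..1}" for t
    proof -
      have seg: "closed_segment a t \<subseteq> ball a e \<inter> {0..1}"
        using t a e by (intro closed_segment_subset convex_Int convex_ball) auto
      have s0: "closed_segment 0 s \<subseteq> {0..1}" if "s \<in> {0..1}" for s :: real
        using that by (intro closed_segment_subset) auto
      have pp: "path (p \<circ> linepath x y) \<and> path_image (p \<circ> linepath x y) \<subseteq> S"
        if "closed_segment x y \<subseteq> {0..1}" for x y
        using path_compose_linepath[OF p(1,2) that] by blast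
      have "c (p \<circ> linepath 0 t) = c (p \<circ> (linepath 0 a +++ linepath a t))"
        using p s0 a t seg
        by (intro homotopic homotopic_paths_reparam) (auto simp: path_image_join)
      also have "\<dots> = c (p \<circ> linepath 0 a) * c (p \<circ> linepath a t)"
        unfolding path_compose_join using pp[OF s0[OF a]] pp[of a t] seg
        by (intro join) (auto simp: pathstart_compose pathfinish_compose)
      also have "c (p \<circ> linepath a t) = vb (p t) / vb (p a)"
        using pp[of a t] seg e
        by (subst Uc) (auto simp: path_image_compose pathstart_compose pathfinish_compose)
      finally have *: "c (p \<circ> linepath 0 t) = c (p \<circ> linepath 0 a) * (vb (p t) / vb (p a))" .
      have "vb (p t) \<noteq> 0"
        using vb1[OF pt, of t] t by auto
      then show ?thesis unfolding f_def * by simp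
    qed
    have "openin (top_of_set {0..1}) (ball a e \<inter> {0..1})"
      by (subst Int_commute) (rule openin_open_Int[OF open_ball])
    moreover have "a \<in> ball a e \<inter> {0..1}" using e(1) a by simp
    ultimately show "\<exists>T. openin (top_of_set {0..1}) T \<and> a \<in> T \<and> (\<forall>x\<in>T. f x = f a)"
      using fa by blast
  qed simp
  then have "f 0 = f 1" unfolding constant_on_def by (metis atLeastAtMost_iff order_refl zero_le_one)
  then show ?thesis
    using p vb1[OF pt, of 0] const[OF pt, of 0]
    by (auto simp: f_def compose_linepath_01 compose_linepath_same pathstart_def pathfinish_def)
qed

end

section \<open>Dehn twists\<close>

text \<open>The pieces that attain the value \<open>f z\<close> and the remaining ones form two
  closed sets that cover \<open>D\<close> and do not meet in it. This passes from constancy on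
  single pieces to constancy on the disc.\<close>

lemma constant_on_closed_pieces:
  fixes f :: "'b::topological_space \<Rightarrow> 'c"
  assumes "connected D" "finite K" "\<Union>K = D"
    and "\<And>k. k \<in> K \<Longrightarrow> closed k" "\<And>k. k \<in> K \<Longrightarrow> f constant_on k"
    and "z \<in> D" "w \<in> D"
  shows "f z = f w"
proof (rule ccontr)
  assume ne: "f z \<noteq> f w"
  define A where "A = \<Union>{k \<in> K. \<exists>y\<in>k. f y = f z}"
  define B where "B = \<Union>{k \<in> K. \<not> (\<exists>y\<in>k. f y = f z)}"
  have "closed A" "closed B"
    unfolding A_def B_def using assms by (auto intro!: closed_Union)
  moreover have "D \<subseteq> A \<union> B" using assms(3) by (auto simp: A_def B_def)
  moreover have fA: "f y = f z" if "y \<in> A" for y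
    using that assms(5) unfolding A_def constant_on_def by (clarsimp, metis)
  moreover have "A \<inter> B \<inter> D = {}" using fA by (auto simp: B_def)
  moreover have "z \<in> A \<inter> D" using assms(3,6) by (auto simp: A_def)
  moreover have "w \<in> B \<inter> D" using assms(3,7) fA ne \<open>D \<subseteq> A \<union> B\<close> by auto
  ultimately show False using assms(1) unfolding connected_closed by blast
qed

text \<open>Each cell between consecutive integers is a translate of the basic one, and equality at
  the two ends allows neighbouring closed cells to be pasted.\<close>

lemma continuous_on_periodic_extension:
  fixes Q :: "real \<times> real \<Rightarrow> 'a::topological_space"
  assumes Q: "continuous_on (A \<times> {0..1}) Q" and A: "closed A"
    and per: "\<And>x. x \<in> A \<Longrightarrow> Q (x, 0) = Q (x, 1)"
  shows "continuous_on (A \<times> UNIV) (\<lambda>(x, s). Q (x, frac s))"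
proof -
  let ?P = "\<lambda>(x, s). Q (x, frac s)"
  have cell: "continuous_on (A \<times> {real_of_int n..real_of_int n + 1}) ?P" for n :: int
  proof -
    have "continuous_on (A \<times> {real_of_int n..real_of_int n + 1})
        (\<lambda>y. Q (fst y, snd y - real_of_int n))"
      by (rule continuous_on_compose2[OF Q]) (auto intro!: continuous_intros)
    then show ?thesis
    proof (rule continuous_on_cong[THEN iffD1, rotated 2])
      fix y assume y: "y \<in> A \<times> {real_of_int n..real_of_int n + 1}"
      show "Q (fst y, snd y - real_of_int n) = ?P y"
      proof (cases "snd y = real_of_int n + 1")
        case True
        then show ?thesis using y per by (auto simp: case_prod_beta)
      next
        case False
        then have "frac (snd y) = snd y - real_of_int n"
          using y by (auto simp: frac_unique_iff)
        then show ?thesis by (simp add: case_prod_beta)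
      qed
    qed simp
  qed
  have "continuous (at y within A \<times> UNIV) ?P" if y: "y \<in> A \<times> UNIV" for y
  proof -
    \<comment> \<open>The integer nearest to \<open>snd y\<close>, so that the point is interior to
      the two cells that meet at \<open>n\<close>.\<close>
    define n where "n = \<lfloor>snd y + 1/2\<rfloor>"
    have n: "real_of_int n - 1 < snd y" "snd y < real_of_int n + 1"
      unfolding n_def by linarith+
    define T where "T = A \<times> {real_of_int n - 1..real_of_int n + 1}"
    have "T = A \<times> {real_of_int (n - 1)..real_of_int (n - 1) + 1} \<union> A \<times> {real_of_int n..real_of_int n + 1}"
      by (auto simp: T_def)
    then have "continuous_on T ?P"
      using cell[of "n - 1"] cell[of n] A
      by (auto intro!: continuous_on_closed_Un closed_Times simp del: of_int_diff)
    then have "continuous (at y within T) ?P"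
      using y n by (auto simp: continuous_on_eq_continuous_within T_def)
    moreover have "at y within T = at y within A \<times> UNIV"
      by (rule at_within_nhd[of _ "UNIV \<times> {real_of_int n - 1<..<real_of_int n + 1}"])
        (use y n in \<open>auto simp: T_def intro!: open_Times\<close>)
    ultimately show ?thesis by simp
  qed
  then show ?thesis by (simp add: continuous_on_eq_continuous_within)
qed

lemma path_character_compose:
  assumes "path_character S c" "continuous_on S f" "f ` S \<subseteq> S"
  shows "path_character S (\<lambda>p. c (f \<circ> p))"
proof -
  interpret path_character S c by (rule assms)
  have pf: "path (f \<circ> p)" "path_image (f \<circ> p) \<subseteq> S" if "path p" "path_image p \<subseteq> S" for p
    using that assms(3) continuous_on_subset[OF assms(2) that(2)]
    by (auto intro!: path_continuous_image simp: path_image_compose)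
  show ?thesis
  proof
    fix p r assume "path p" "path_image p \<subseteq> S" "path r" "path_image r \<subseteq> S" "pathfinish p = pathstart r"
    then show "c (f \<circ> (p +++ r)) = c (f \<circ> p) * c (f \<circ> r)"
      unfolding path_compose_join
      by (intro join pf) (auto simp: pathstart_compose pathfinish_compose)
  next
    fix p r assume "homotopic_paths S p r"
    then show "c (f \<circ> p) = c (f \<circ> r)"
      by (intro homotopic homotopic_paths_continuous_image[OF _ assms(2)]) (use assms(3) in auto)
  next
    fix p assume "path p" "path_image p \<subseteq> S"
    then show "cmod (c (f \<circ> p)) = 1" by (intro norm_1 pf)
  qed
qed

text \<open>
  An annulus in \<open>S\<close> with coordinates \<open>X\<close> across and \<open>Y\<close> along it.  Its preimage in the disc is \<open>N\<close>, and \<open>P\<close>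
  is the covering of the annulus by \<open>[0, 1] \<times> \<real>\<close>.  Outside the annulus, on \<open>M\<close>, the function \<open>X\<close> takes the
  values 0 and 1 only; the twist moves the points of the annulus by \<open>X\<close> in the direction of \<open>Y\<close>.
  \<open>P\<close> need not be injective: it suffices that the twist is compatible with the gluing.
\<close>

locale annulus = glued_surface g S q
  for g :: nat and S :: "'a::topological_space set" and q :: "complex \<Rightarrow> 'a" +
  fixes N M :: "complex set" and X Y :: "complex \<Rightarrow> real" and P :: "real \<times> real \<Rightarrow> 'a"
    and K :: "complex set set"
  assumes NM: "N \<union> M = cball 0 1" and closed_N: "closed N" and closed_M: "closed M"
    and X_cont: "continuous_on (cball 0 1) X" and Y_cont: "continuous_on N Y"
    and X_range: "z \<in> N \<Longrightarrow> X z \<in> {0..1}"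
    and X_M: "z \<in> M \<Longrightarrow> X z = 0 \<or> X z = 1"
    and P_cont: "continuous_on ({0..1} \<times> UNIV) P" and P_in: "P ` ({0..1} \<times> UNIV) \<subseteq> S"
    and P_period: "x \<in> {0..1} \<Longrightarrow> P (x, s + 1) = P (x, s)"
    and P_N: "z \<in> N \<Longrightarrow> P (X z, Y z) = q z"
    and P_surj: "x \<in> {0..1} \<Longrightarrow> \<exists>z\<in>N. X z = x \<and> Y z - s \<in> \<int>"
    and pairs: "i < g \<Longrightarrow> j = 4 * i \<or> j = 4 * i + 1 \<Longrightarrow> t \<in> {0..1} \<Longrightarrow>
      polygon_side g j t \<in> M \<and> polygon_side g (j + 2) (1 - t) \<in> M \<or>
      polygon_side g j t \<in> N \<and> polygon_side g (j + 2) (1 - t) \<in> N \<and>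
        X (polygon_side g j t) = X (polygon_side g (j + 2) (1 - t)) \<and>
        Y (polygon_side g j t) - Y (polygon_side g (j + 2) (1 - t)) \<in> \<int>"
    and finite_K: "finite K" and K_cover: "\<Union>K = cball 0 1"
    and closed_K: "k \<in> K \<Longrightarrow> closed k" and convex_K: "k \<in> K \<Longrightarrow> convex k"
    and K_NM: "k \<in> K \<Longrightarrow> k \<subseteq> N \<or> k \<subseteq> M \<and> X constant_on k"
begin

lemma N_subset: "N \<subseteq> cball 0 1" and M_subset: "M \<subseteq> cball 0 1"
  using NM by auto

lemma X_cont_N: "continuous_on N X"
  using X_cont N_subset by (rule continuous_on_subset)

lemma P_period_Ints:
  assumes x: "x \<in> {0..1}" and n: "n \<in> \<int>"
  shows "P (x, s + n) = P (x, s)"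
proof -
  have nat: "P (x, s + real m) = P (x, s)" for s m
  proof (induction m)
    case (Suc m)
    then show ?case using P_period[OF x, of "s + real m"] by (simp add: ac_simps)
  qed simp
  obtain k :: int where k: "n = of_int k" using n by (auto elim: Ints_cases)
  show ?thesis
  proof (cases "k \<ge> 0")
    case True
    then show ?thesis using nat[of s "nat k"] k by simp
  next
    case False
    then show ?thesis using nat[of "s + n" "nat (- k)"] k by simp
  qed
qed

lemma P_eq:
  assumes "x \<in> {0..1}" "s - s' \<in> \<int>"
  shows "P (x, s) = P (x, s')"
  using P_period_Ints[OF assms, of s'] by simp

section \<open>The twist as a homeomorphism\<close>

text \<open>The values lie in \<open>S\<close> and not in the disc, since a point pushed along the
  annulus may leave the polygon through one side and return through the glued one.\<close>

definition shift :: "real \<Rightarrow> complex \<Rightarrow> 'a" where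
  "shift \<sigma> z = (if z \<in> N then P (X z, Y z + \<sigma> * X z) else q z)"

definition twist :: "real \<Rightarrow> 'a \<Rightarrow> 'a" where
  "twist \<sigma> y = shift \<sigma> (inv_into (cball 0 1) q y)"

text \<open>Where \<open>X\<close> is 0 or 1, an integral \<sigma> shifts by whole periods. This
  makes the two branches of \<open>shift\<close> agree where \<open>N\<close> and \<open>M\<close>
  overlap.\<close>

lemma shift_M:
  assumes "z \<in> M" "\<sigma> \<in> \<int>"
  shows "shift \<sigma> z = q z"
proof (cases "z \<in> N")
  case True
  have "P (X z, Y z + \<sigma> * X z) = P (X z, Y z)"
    using X_M[OF assms(1)] assms(2) by (intro P_period_Ints X_range True) auto
  then show ?thesis using True P_N by (simp add: shift_def)
qed (simp add: shift_def)

context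
  fixes \<sigma> :: real
  assumes \<sigma>: "\<sigma> \<in> \<int>"
begin

lemma continuous_shift: "continuous_on (cball 0 1) (shift \<sigma>)"
  unfolding NM[symmetric]
proof (intro continuous_on_closed_Un closed_N closed_M)
  have "continuous_on N (\<lambda>z. P (X z, Y z + \<sigma> * X z))"
    by (rule continuous_on_compose2[OF P_cont])
      (use X_range in \<open>auto intro!: continuous_intros X_cont_N Y_cont\<close>)
  then show "continuous_on N (shift \<sigma>)"
    by (rule continuous_on_cong[THEN iffD1, rotated 2]) (auto simp: shift_def)
  have "continuous_on M q" using continuous_on_subset[OF q_continuous M_subset] .
  then show "continuous_on M (shift \<sigma>)"
    by (rule continuous_on_cong[THEN iffD1, rotated 2]) (auto simp: shift_M \<sigma>)
qed

lemma shift_in: "z \<in> cball 0 1 \<Longrightarrow> shift \<sigma> z \<in> S"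
  using P_in X_range q_in by (auto simp: shift_def image_subset_iff)

text \<open>Glued points have equal shifts: on \<open>M\<close> the shift is \<open>q\<close>, and
  on \<open>N\<close> their coordinates agree up to a whole period.\<close>

lemma twist_q:
  assumes "z \<in> cball 0 1"
  shows "twist \<sigma> (q z) = shift \<sigma> z"
  unfolding twist_def
proof (rule gluing_invariant[where f = "shift \<sigma>"])
  fix i j :: nat and t :: real
  assume ij: "i < g" "j = 4 * i \<or> j = 4 * i + 1" and t: "t \<in> {0..1}"
  define z where "z = side j t"
  define w where "w = side (j + 2) (1 - t)"
  from pairs[OF ij t] show "shift \<sigma> (side j t) = shift \<sigma> (side (j + 2) (1 - t))"
    unfolding z_def[symmetric] w_def[symmetric]
  proof (elim disjE conjE)
    assume "z \<in> M" "w \<in> M"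
    then show "shift \<sigma> z = shift \<sigma> w"
      using glue[OF ij t] by (simp add: shift_M \<sigma> z_def w_def)
  next
    assume *: "z \<in> N" "w \<in> N" "X z = X w" "Y z - Y w \<in> \<int>"
    then show "shift \<sigma> z = shift \<sigma> w"
      unfolding shift_def by (auto intro!: P_eq X_range)
  qed
next
  show "inv_into (cball 0 1) q (q z) \<in> cball 0 1" using assms by (intro inv_into_into imageI)
  show "q (inv_into (cball 0 1) q (q z)) = q z" using assms by (intro f_inv_into_f imageI)
qed (rule assms)

lemma continuous_twist: "continuous_on S (twist \<sigma>)"
proof -
  have "continuous_map (top_of_set (cball 0 1)) (top_of_set S) (shift \<sigma>)"
    using continuous_shift shift_in by auto
  then have "continuous_map (top_of_set (cball 0 1)) (top_of_set S) (twist \<sigma> \<circ> q)"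
    by (rule continuous_map_eq) (simp add: twist_q)
  then have "continuous_map (top_of_set S) (top_of_set S) (twist \<sigma>)"
    by (rule continuous_compose_quotient_map[OF quotient])
  then show ?thesis by simp
qed

lemma twist_in: "y \<in> S \<Longrightarrow> twist \<sigma> y \<in> S"
  unfolding q_surj[symmetric] using shift_in twist_q q_surj by auto

text \<open>By \<open>P_surj\<close> every point of the covering strip differs by a whole period
  from the coordinates of some point of \<open>N\<close>. This is what allows a second twist to be
  evaluated after the first.\<close>

lemma twist_P:
  assumes x: "x \<in> {0..1}"
  shows "twist \<sigma> (P (x, s)) = P (x, s + \<sigma> * x)"
proof -
  obtain z where z: "z \<in> N" "X z = x" "Y z - s \<in> \<int>"
    using P_surj[OF x, of s] by blast
  have "P (x, s) = P (x, Y z)"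
    using z(3) by (intro P_eq[OF x]) (simp add: Ints_minus[of "Y z - s", simplified])
  also have "\<dots> = q z" using P_N[OF z(1)] z(2) by simp
  finally have "twist \<sigma> (P (x, s)) = shift \<sigma> z" using twist_q z(1) N_subset by auto
  also have "\<dots> = P (x, s + \<sigma> * x)"
    using z x by (auto simp: shift_def intro!: P_eq)
  finally show ?thesis .
qed

end

lemma twist_inverse:
  assumes \<sigma>: "\<sigma> \<in> \<int>" and y: "y \<in> S"
  shows "twist \<sigma> (twist (- \<sigma>) y) = y"
proof -
  obtain z where z: "z \<in> cball 0 1" "y = q z" using y q_surj by blast
  have \<sigma>': "- \<sigma> \<in> \<int>" using \<sigma> by simp
  show ?thesis
  proof (cases "z \<in> N")
    case True
    have "twist (- \<sigma>) y = P (X z, Y z - \<sigma> * X z)"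
      using z True by (simp add: twist_q[OF \<sigma>'] shift_def)
    then show ?thesis
      using twist_P[OF \<sigma> X_range[OF True], of "Y z - \<sigma> * X z"] P_N[OF True] z by simp
  next
    case False
    then show ?thesis using z by (simp add: twist_q[OF \<sigma>] twist_q[OF \<sigma>'] shift_def)
  qed
qed

lemma homeomorphism_twist: "homeomorphism S S (twist 1) (twist (- 1))"
  by (rule homeomorphismI)
    (use twist_inverse[of 1] twist_inverse[of "-1"] twist_in continuous_twist in auto)

text \<open>
  The twist multiplies the potential of \<open>c\<close> on the disc by a function \<open>\<theta>\<close> that jumps by the factor \<open>\<tau>\<close>, the
  value of \<open>c\<close> on the core of the annulus, from \<open>X = 0\<close> to \<open>X = 1\<close>.
\<close>

lemma holonomy_twist:
  assumes c: "path_character S c"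
  obtains \<tau> \<theta> where "\<And>x. x \<in> {0..1} \<Longrightarrow> \<tau> = c (P \<circ> linepath (x, 0) (x, 1))"
    and "\<And>z. z \<in> M \<Longrightarrow> X z = 0 \<Longrightarrow> \<theta> z = 1"
    and "\<And>z. z \<in> M \<Longrightarrow> X z = 1 \<Longrightarrow> \<theta> z = \<tau>"
    and "\<And>z w. z \<in> N \<Longrightarrow> w \<in> N \<Longrightarrow> X z = X w \<Longrightarrow> Y z - Y w \<in> \<int> \<Longrightarrow> \<theta> z = \<theta> w"
    and "\<And>z. \<theta> z \<noteq> 0"
    and "\<And>j. holonomy (\<lambda>p. c (twist 1 \<circ> p)) j =
      holonomy c j * \<theta> (side j (1/2)) / \<theta> (side (j + 2) (1/2))"
proof -
  interpret path_character S c by (rule c)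
  let ?D = "cball (0::complex) 1"
  let ?A = "{0..1::real} \<times> (UNIV :: real set)"
  have cA: "convex ?A" by (intro convex_Times) auto
  obtain u where u1: "\<And>z. z \<in> ?D \<Longrightarrow> cmod (u z) = 1"
    and u: "\<And>\<pi>. path \<pi> \<Longrightarrow> path_image \<pi> \<subseteq> ?D \<Longrightarrow> c (q \<circ> \<pi>) = u (pathfinish \<pi>) / u (pathstart \<pi>)"
    by (rule disc_potential[OF c]) (rule that)
  have c': "path_character S (\<lambda>p. c (twist 1 \<circ> p))"
    by (rule path_character_compose[OF c continuous_twist]) (auto intro: twist_in)
  obtain u' where u'1: "\<And>z. z \<in> ?D \<Longrightarrow> cmod (u' z) = 1"
    and u': "\<And>\<pi>. path \<pi> \<Longrightarrow> path_image \<pi> \<subseteq> ?D \<Longrightarrow>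
      c (twist 1 \<circ> (q \<circ> \<pi>)) = u' (pathfinish \<pi>) / u' (pathstart \<pi>)"
    by (rule disc_potential[OF c']) (rule that)
  obtain v where v1: "\<And>y. y \<in> ?A \<Longrightarrow> cmod (v y) = 1"
    and v: "\<And>\<pi>. path \<pi> \<Longrightarrow> path_image \<pi> \<subseteq> ?A \<Longrightarrow> c (P \<circ> \<pi>) = v (pathfinish \<pi>) / v (pathstart \<pi>)"
    by (rule potential[OF cA P_cont P_in]) (rule that)
  have seg: "closed_segment y y' \<subseteq> ?A" if "y \<in> ?A" "y' \<in> ?A" for y y'
    using cA that by (rule closed_segment_subset[rotated 2])
  have vline: "c (P \<circ> linepath y y') = v y' / v y" if "y \<in> ?A" "y' \<in> ?A" for y y'
    using v[of "linepath y y'"] seg[OF that] by simp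
  have v0: "v y \<noteq> 0" if "y \<in> ?A" for y using v1[OF that] by auto
  have u0: "u z \<noteq> 0" "u' z \<noteq> 0" if "z \<in> ?D" for z using u1[OF that] u'1[OF that] by auto
  define \<tau> where "\<tau> = v (0, 1) / v (0, 0)"
  \<comment> \<open>The segment from \<open>(0, 1)\<close> to \<open>(x, s + 1)\<close> is a
    translate of that from \<open>(0, 0)\<close> to \<open>(x, s)\<close> and has the same image
    under \<open>P\<close>. So the factor over one period is the same everywhere on the
    strip.\<close>
  have \<tau>: "v (x, s + 1) = \<tau> * v (x, s)" if x: "x \<in> {0..1}" for x s
  proof -
    have "c (P \<circ> linepath (0, 1) (x, s + 1)) = c (P \<circ> linepath (0, 0) (x, s))"
    proof (rule cong)
      let ?l = "linepath (0, 1) (x, s + 1)"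
      have im: "path_image ?l \<subseteq> ?A" using seg x by simp
      show "path (P \<circ> ?l)"
        using continuous_on_subset[OF P_cont im] by (intro path_continuous_image) auto
      show "path_image (P \<circ> ?l) \<subseteq> S" using im P_in by (auto simp: path_image_compose)
      fix t :: real assume "t \<in> {0..1}"
      then have "t * x \<in> {0..1}" using x by (auto simp: mult_le_one)
      then have "P (t * x, t * s + 1) = P (t * x, t * s)" by (rule P_period)
      then show "(P \<circ> ?l) t = (P \<circ> linepath (0, 0) (x, s)) t"
        by (simp add: linepath_def algebra_simps)
    qed
    then have "v (x, s + 1) / v (0, 1) = v (x, s) / v (0, 0)"
      using vline x by simp
    moreover have "v (0, 1) \<noteq> 0" "v (0, 0) \<noteq> 0" using v0 by auto
    ultimately show ?thesis by (simp add: \<tau>_def field_simps)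
  qed
  have \<tau>0: "\<tau> \<noteq> 0" using v0 by (simp add: \<tau>_def)
  have \<tau>_int: "v (x, s + n) / v (x, s' + n) = v (x, s) / v (x, s')"
    if x: "x \<in> {0..1}" and "n \<in> \<int>" for x s s' n
  proof -
    have nat: "v (x, s + real m) = \<tau> ^ m * v (x, s)" for s m
    proof (induction m)
      case (Suc m)
      then show ?case using \<tau>[OF x, of "s + real m"] by (simp add: ac_simps)
    qed simp
    obtain k :: int where k: "n = of_int k" using \<open>n \<in> \<int>\<close> by (auto elim: Ints_cases)
    show ?thesis
    proof (cases "k \<ge> 0")
      case True
      then show ?thesis using nat[of s "nat k"] nat[of s' "nat k"] k \<tau>0 by simp
    next
      case False
      then show ?thesis
        using nat[of "s + n" "nat (- k)"] nat[of "s' + n" "nat (- k)"] k \<tau>0 by simp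
    qed
  qed
  \<comment> \<open>Inside the annulus, the lifted potential after the shift divided by the one
    before it. This is 1 where \<open>X = 0\<close> and \<tau> where \<open>X = 1\<close>, and these
    values continue it to the rest of the disc.\<close>
  define \<theta> where "\<theta> z = (if z \<in> N then v (X z, Y z + X z) / v (X z, Y z) else if X z = 0 then 1 else \<tau>)" for z
  have \<theta>0: "\<theta> z \<noteq> 0" for z using v0 X_range \<tau>0 by (auto simp: \<theta>_def)
  have \<theta>_M0: "\<theta> z = 1" if "X z = 0" for z
    using that v0 by (auto simp: \<theta>_def)
  have \<theta>_M1: "\<theta> z = \<tau>" if "X z = 1" for z
    using that v0 \<tau>[of 1 "Y z"] by (auto simp: \<theta>_def)
  \<comment> \<open>The potential of the pulled back character divided by the predicted one; it is
    constant on each convex piece by comparison along a segment.\<close>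
  define \<psi> where "\<psi> z = u' z / (u z * \<theta> z)" for z
  have \<psi>_const: "\<psi> constant_on k" if k: "k \<in> K" for k
  proof -
    have "\<psi> w = \<psi> z" if zw: "z \<in> k" "w \<in> k" for z w
    proof -
      have kD: "k \<subseteq> ?D" using k K_cover by blast
      have segk: "closed_segment z w \<subseteq> k"
        using zw convex_K[OF k] by (rule closed_segment_subset)
      let ?l = "linepath z w"
      have imD: "path_image ?l \<subseteq> ?D" using segk kD by simp
      have D: "z \<in> ?D" "w \<in> ?D" using zw kD by auto
      have ul: "c (q \<circ> ?l) = u w / u z" using u[OF path_linepath imD] by simp
      have u'l: "c (twist 1 \<circ> (q \<circ> ?l)) = u' w / u' z" using u'[OF path_linepath imD] by simp
      have pq: "path (q \<circ> ?l)" "path_image (q \<circ> ?l) \<subseteq> S" using path_q[OF path_linepath imD] by auto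
      have ptq: "path (twist 1 \<circ> (q \<circ> ?l))" "path_image (twist 1 \<circ> (q \<circ> ?l)) \<subseteq> S"
        using pq continuous_on_subset[OF continuous_twist pq(2)] twist_in
        by (auto intro!: path_continuous_image simp: path_image_compose[of "twist 1"])
      have lk: "?l t \<in> k" if "t \<in> {0..1}" for t using linepath_in_path[OF that] segk by blast
      from K_NM[OF k] have "u' w / u' z = (u w / u z) * (\<theta> w / \<theta> z)"
      proof
        assume kN: "k \<subseteq> N"
        have lN: "?l ` {0..1} \<subseteq> N" using lk kN by auto
        have cont: "continuous_on {0..1} (\<lambda>t. X (?l t))" "continuous_on {0..1} (\<lambda>t. Y (?l t))"
          by (rule continuous_on_compose2[OF X_cont_N continuous_on_linepath lN]
              continuous_on_compose2[OF Y_cont continuous_on_linepath lN])+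
        \<comment> \<open>Lifts to the covering strip of the image of the segment and of its twisted
          image, so that \<open>v\<close> computes \<open>c\<close> on both.\<close>
        let ?\<pi> = "\<lambda>t. (X (?l t), Y (?l t))"
        let ?\<pi>' = "\<lambda>t. (X (?l t), Y (?l t) + X (?l t))"
        have p: "path ?\<pi>" "path ?\<pi>'"
          unfolding path_def by (intro continuous_intros cont)+
        have "X (?l t) \<in> {0..1}" if "t \<in> {0..1}" for t
          using lk[OF that] kN X_range by blast
        then have im: "path_image ?\<pi> \<subseteq> ?A" "path_image ?\<pi>' \<subseteq> ?A"
          unfolding path_image_def by blast+
        have "c (q \<circ> ?l) = c (P \<circ> ?\<pi>)"
        proof (rule cong[OF pq])
          fix t :: real assume "t \<in> {0..1}"
          from lk[OF this] kN have "?l t \<in> N" by blast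
          from P_N[OF this] show "(q \<circ> ?l) t = (P \<circ> ?\<pi>) t" by simp
        qed
        then have 1: "u w / u z = v (X w, Y w) / v (X z, Y z)"
          using ul v[OF p(1) im(1)] by (simp add: pathstart_def pathfinish_def linepath_0' linepath_1')
        have "c (twist 1 \<circ> (q \<circ> ?l)) = c (P \<circ> ?\<pi>')"
        proof (rule cong[OF ptq])
          fix t :: real assume "t \<in> {0..1}"
          from lk[OF this] kN kD have "?l t \<in> N" "?l t \<in> ?D" by blast+
          then show "(twist 1 \<circ> (q \<circ> ?l)) t = (P \<circ> ?\<pi>') t"
            using twist_q[of 1 "?l t"] by (simp add: shift_def del: mem_cball)
        qed
        then have 2: "u' w / u' z = v (X w, Y w + X w) / v (X z, Y z + X z)"
          using u'l v[OF p(2) im(2)] by (simp add: pathstart_def pathfinish_def linepath_0' linepath_1')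
        have "v (X w, Y w) \<noteq> 0" "v (X z, Y z) \<noteq> 0" "v (X w, Y w + X w) \<noteq> 0" "v (X z, Y z + X z) \<noteq> 0"
          using zw kN X_range by (auto intro!: v0)
        then show ?thesis unfolding 1 2 using zw kN by (auto simp: \<theta>_def)
      next
        assume kM: "k \<subseteq> M \<and> X constant_on k"
        then have "X z = X w" "X z = 0 \<or> X z = 1"
          using zw X_M by (auto simp: constant_on_def)
        then have "\<theta> w = \<theta> z" using \<theta>_M0 \<theta>_M1 by metis
        moreover have "c (twist 1 \<circ> (q \<circ> ?l)) = c (q \<circ> ?l)"
        proof (rule cong[OF ptq])
          fix t :: real assume "t \<in> {0..1}"
          from lk[OF this] kM kD have "?l t \<in> M" "?l t \<in> ?D" by blast+
          then show "(twist 1 \<circ> (q \<circ> ?l)) t = (q \<circ> ?l) t"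
            using twist_q[of 1 "?l t"] by (simp add: shift_M del: mem_cball)
        qed
        ultimately show ?thesis using ul u'l \<theta>0 by simp
      qed
      then show ?thesis
        unfolding \<psi>_def using u0[OF D(1)] u0[OF D(2)] \<theta>0[of z] \<theta>0[of w]
        by (simp add: field_simps)
    qed
    then show ?thesis unfolding constant_on_def by blast
  qed
  have \<psi>: "\<psi> z = \<psi> w" if "z \<in> ?D" "w \<in> ?D" for z w
    by (rule constant_on_closed_pieces[OF _ finite_K K_cover closed_K \<psi>_const that]) auto
  show ?thesis
  proof (rule that[of \<tau> \<theta>])
    fix x :: real assume x: "x \<in> {0..1}"
    show "\<tau> = c (P \<circ> linepath (x, 0) (x, 1))"
      using vline[of "(x, 0)" "(x, 1)"] \<tau>[OF x, of 0] v0[of "(x, 0)"] x by simp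
  next
    fix z w assume *: "z \<in> N" "w \<in> N" "X z = X w" "Y z - Y w \<in> \<int>"
    show "\<theta> z = \<theta> w"
      using \<tau>_int[OF X_range[OF *(2)] *(4), of "Y w + X w" "Y w"] * by (simp add: \<theta>_def algebra_simps)
  next
    fix j
    let ?z = "side j (1/2)" and ?w = "side (j + 2) (1/2)"
    let ?l = "linepath ?w ?z"
    have imD: "path_image ?l \<subseteq> ?D" using chord_in_disc by simp
    have D: "?z \<in> ?D" "?w \<in> ?D" by simp_all
    have e1: "holonomy (\<lambda>p. c (twist 1 \<circ> p)) j = u' ?z / u' ?w"
      unfolding holonomy_def using u'[OF path_linepath imD] by simp
    have e2: "holonomy c j = u ?z / u ?w"
      unfolding holonomy_def using u[OF path_linepath imD] by simp
    have e3: "u' ?z * (u ?w * \<theta> ?w) = (u ?z * \<theta> ?z) * u' ?w"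
      using \<psi>[OF D] u0[OF D(1)] u0[OF D(2)] \<theta>0[of ?z] \<theta>0[of ?w] unfolding \<psi>_def
      by (simp add: frac_eq_eq)
    have "u' ?z / u' ?w = (u ?z * \<theta> ?z) / (u ?w * \<theta> ?w)"
      using e3 u0[OF D(2)] \<theta>0[of ?w] by (simp only: frac_eq_eq mult_eq_0_iff simp_thms)
    then show "holonomy (\<lambda>p. c (twist 1 \<circ> p)) j = holonomy c j * \<theta> ?z / \<theta> ?w"
      unfolding e1 e2 by simp
  qed (use \<theta>_M0 \<theta>_M1 \<theta>0 in auto)
qed


text \<open>Two glued midpoints either have equal coordinates up to a period, and then \<theta>
  agrees on them, or both lie in \<open>M\<close>, where \<theta> is determined by
  \<open>X\<close>.\<close>

lemma holonomy_twist_pair: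
  assumes c: "path_character S c"
  obtains \<tau> where "\<And>x. x \<in> {0..1} \<Longrightarrow> \<tau> = c (P \<circ> linepath (x, 0) (x, 1))"
    and "\<And>i j. i < g \<Longrightarrow> j = 4 * i \<or> j = 4 * i + 1 \<Longrightarrow>
      holonomy (\<lambda>p. c (twist 1 \<circ> p)) j = holonomy c j *
        (if X (side j (1/2)) = X (side (j + 2) (1/2)) then 1
         else if X (side j (1/2)) = 1 then \<tau> else inverse \<tau>)"
proof -
  obtain \<tau> \<theta> where \<tau>: "\<And>x. x \<in> {0..1} \<Longrightarrow> \<tau> = c (P \<circ> linepath (x, 0) (x, 1))"
    and \<theta>0: "\<And>z. z \<in> M \<Longrightarrow> X z = 0 \<Longrightarrow> \<theta> z = 1"
    and \<theta>1: "\<And>z. z \<in> M \<Longrightarrow> X z = 1 \<Longrightarrow> \<theta> z = \<tau>"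
    and \<theta>N: "\<And>z w. z \<in> N \<Longrightarrow> w \<in> N \<Longrightarrow> X z = X w \<Longrightarrow> Y z - Y w \<in> \<int> \<Longrightarrow> \<theta> z = \<theta> w"
    and \<theta>pos: "\<And>z. \<theta> z \<noteq> 0"
    and holonomy: "\<And>j. holonomy (\<lambda>p. c (twist 1 \<circ> p)) j =
      holonomy c j * \<theta> (side j (1/2)) / \<theta> (side (j + 2) (1/2))"
    by (rule holonomy_twist[OF c]) (rule that)
  show ?thesis
  proof (rule that[OF \<tau>])
    fix i j assume ij: "i < g" "j = 4 * i \<or> j = 4 * i + 1"
    define z where "z = side j (1/2)"
    define w where "w = side (j + 2) (1/2)"
    have "z \<in> M \<and> w \<in> M \<or> z \<in> N \<and> w \<in> N \<and> X z = X w \<and> Y z - Y w \<in> \<int>"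
      using pairs[OF ij, of "1/2"] by (simp add: z_def w_def)
    then have "\<theta> z / \<theta> w =
        (if X z = X w then 1 else if X z = 1 then \<tau> else inverse \<tau>)"
    proof (elim disjE conjE)
      assume "z \<in> M" "w \<in> M"
      then show ?thesis
        using X_M[of z] X_M[of w] \<theta>0[of z] \<theta>0[of w] \<theta>1[of z] \<theta>1[of w] \<theta>pos[of z] \<theta>pos[of w]
        by (auto simp: field_simps)
    next
      assume "z \<in> N" "w \<in> N" "X z = X w" "Y z - Y w \<in> \<int>"
      then show ?thesis using \<theta>N[of z w] \<theta>pos[of w] by simp
    qed
    then show "holonomy (\<lambda>p. c (twist 1 \<circ> p)) j = holonomy c j *
        (if X (side j (1/2)) = X (side (j + 2) (1/2)) then 1
         else if X (side j (1/2)) = 1 then \<tau> else inverse \<tau>)"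
      unfolding holonomy z_def w_def by (simp only: times_divide_eq_right[symmetric])
  qed auto
qed

text \<open>
  Since \<open>X\<close> is an integer outside the annulus, \<open>X\<close> modulo 1 is a map from \<open>S\<close> to the circle; its degree on
  a loop counts how often the loop crosses the annulus.
\<close>

definition crossing_map :: "'a \<Rightarrow> complex" where
  "crossing_map y = exp (2 * of_real pi * \<i> * of_real (X (inv_into (cball 0 1) q y)))"

definition crossing_number :: "(real \<Rightarrow> 'a) \<Rightarrow> real" where
  "crossing_number p = Re (winding_number (crossing_map \<circ> p) 0)"

lemma crossing_map_q:
  assumes "z \<in> cball 0 1"
  shows "crossing_map (q z) = exp (2 * of_real pi * \<i> * of_real (X z))"
  unfolding crossing_map_def
proof (rule gluing_invariant[where f = "\<lambda>z. exp (2 * of_real pi * \<i> * of_real (X z))"])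
  fix i j :: nat and t :: real
  assume ij: "i < g" "j = 4 * i \<or> j = 4 * i + 1" and t: "t \<in> {0..1}"
  from pairs[OF ij t]
  show "exp (2 * of_real pi * \<i> * of_real (X (side j t))) =
      exp (2 * of_real pi * \<i> * of_real (X (side (j + 2) (1 - t))))"
    using X_M[of "side j t"] X_M[of "side (j + 2) (1 - t)"] by (auto simp: exp_two_pi_i)
next
  show "inv_into (cball 0 1) q (q z) \<in> cball 0 1" using assms by (intro inv_into_into imageI)
  show "q (inv_into (cball 0 1) q (q z)) = q z" using assms by (intro f_inv_into_f imageI)
qed (rule assms)

lemma continuous_crossing_map: "continuous_on S crossing_map"
proof -
  have "continuous_on (cball 0 1) (\<lambda>z. exp (2 * of_real pi * \<i> * of_real (X z)))"
    by (intro continuous_intros X_cont)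
  then have "continuous_map (top_of_set (cball 0 1)) euclidean
      (\<lambda>z. exp (2 * of_real pi * \<i> * of_real (X z)))"
    by simp
  then have "continuous_map (top_of_set (cball 0 1)) euclidean (crossing_map \<circ> q)"
    by (rule continuous_map_eq) (simp add: crossing_map_q)
  then have "continuous_map (top_of_set S) euclidean crossing_map"
    by (rule continuous_compose_quotient_map[OF quotient])
  then show ?thesis by simp
qed

lemma crossing_map_path:
  assumes "path p" "path_image p \<subseteq> S"
  shows "path (crossing_map \<circ> p)" "0 \<notin> path_image (crossing_map \<circ> p)"
  using assms continuous_on_subset[OF continuous_crossing_map assms(2)]
  by (auto intro!: path_continuous_image simp: path_image_compose crossing_map_def)

lemma crossing_number_loop:
  assumes "path p" "path_image p \<subseteq> S" "pathfinish p = pathstart p"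
  shows "crossing_number p \<in> \<int>"
proof -
  have "winding_number (crossing_map \<circ> p) 0 \<in> \<int>"
    using crossing_map_path[OF assms(1,2)] assms(3)
    by (intro integer_winding_number) (simp_all add: pathstart_compose pathfinish_compose)
  then show ?thesis unfolding crossing_number_def by (auto elim!: Ints_cases)
qed

text \<open>Winding numbers add under concatenation and are invariant under homotopy in the
  punctured plane. The real parameter \<open>s\<close> makes it possible to prescribe any holonomy
  on the unit circle.\<close>

lemma crossing_number_character: "path_character S (\<lambda>p. cis (s * crossing_number p))"
proof
  fix p r assume p: "path p" "path_image p \<subseteq> S" and r: "path r" "path_image r \<subseteq> S"
    and "pathfinish p = pathstart r"
  then have "crossing_number (p +++ r) = crossing_number p + crossing_number r"
    unfolding crossing_number_def path_compose_join using crossing_map_path[OF p] crossing_map_path[OF r]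
    by (subst winding_number_join) (auto simp: pathstart_compose pathfinish_compose)
  then show "cis (s * crossing_number (p +++ r)) = cis (s * crossing_number p) * cis (s * crossing_number r)"
    by (simp add: cis_mult distrib_left)
next
  fix p r assume "homotopic_paths S p r"
  then have "homotopic_paths (- {0}) (crossing_map \<circ> p) (crossing_map \<circ> r)"
    by (rule homotopic_paths_continuous_image[OF _ continuous_crossing_map])
      (auto simp: crossing_map_def)
  then show "cis (s * crossing_number p) = cis (s * crossing_number r)"
    unfolding crossing_number_def by (simp add: winding_number_homotopic_paths)
qed simp

text \<open>Along the chord \<open>X\<close> is a real lift of the crossing map, so the winding
  number is the difference of its end values.\<close>

lemma holonomy_crossing_number:
  "holonomy (\<lambda>p. cis (s * crossing_number p)) j = cis (s * (X (side j (1/2)) - X (side (j + 2) (1/2))))"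
proof -
  let ?l = "linepath (side (j + 2) (1/2)) (side j (1/2))"
  let ?e = "\<lambda>t. 2 * of_real pi * \<i> * complex_of_real (X (?l t))"
  have im: "?l ` {0..1} \<subseteq> cball 0 1"
    using chord_in_disc linepath_in_path by blast
  have "path ?e"
    unfolding path_def
    by (intro continuous_intros continuous_on_compose2[OF X_cont continuous_on_linepath im])
  then have "winding_number (exp \<circ> ?e) 0 = (pathfinish ?e - pathstart ?e) / (2 * of_real pi * \<i>)"
    by (rule winding_number_compose_exp)
  also have "\<dots> = of_real (X (side j (1/2)) - X (side (j + 2) (1/2)))"
    by (simp add: pathfinish_def pathstart_def linepath_0' linepath_1' field_simps)
  finally have 1: "winding_number (exp \<circ> ?e) 0 = of_real (X (side j (1/2)) - X (side (j + 2) (1/2)))" .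
  have "winding_number (crossing_map \<circ> (q \<circ> ?l)) 0 = winding_number (exp \<circ> ?e) 0"
  proof (rule winding_number_cong)
    fix t :: real assume "0 \<le> t" "t \<le> 1"
    then have "?l t \<in> ?l ` {0..1}" by (intro imageI) simp
    then have "?l t \<in> cball 0 1" using im by blast
    then show "(crossing_map \<circ> (q \<circ> ?l)) t = (exp \<circ> ?e) t"
      by (simp add: crossing_map_q del: mem_cball)
  qed
  then show ?thesis unfolding holonomy_def crossing_number_def 1 by simp
qed

end

section \<open>Annuli that cross one pair of sides\<close>

text \<open>
  Coordinates of the disc with respect to an axis through the boundary point \<open>m\<close>: \<open>angle m z\<close> is the
  angle between the axis and the ends of the chord through \<open>z\<close> perpendicular to the axis, and
  \<open>offset m z \<in> [-1, 1]\<close> is the position of \<open>z\<close> on this chord.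
\<close>

definition height :: "complex \<Rightarrow> complex \<Rightarrow> real" where
  "height m z = Re (z * cnj m)"

definition angle :: "complex \<Rightarrow> complex \<Rightarrow> real" where
  "angle m z = arccos (height m z)"

definition offset :: "complex \<Rightarrow> complex \<Rightarrow> real" where
  "offset m z = Im (z * cnj m) / sqrt (1 - (height m z)\<^sup>2)"

text \<open>The inverse of the coordinates \<open>angle\<close> and \<open>offset\<close>; the
  factor \<open>sin \<phi>\<close> is half the length of the chord.\<close>

definition chord :: "complex \<Rightarrow> real \<Rightarrow> real \<Rightarrow> complex" where
  "chord m \<phi> \<sigma> = m * Complex (cos \<phi>) (\<sigma> * sin \<phi>)"

definition band :: "complex \<Rightarrow> real \<Rightarrow> real \<Rightarrow> complex set" where
  "band m l h = {z \<in> cball 0 1. l \<le> angle m z \<and> angle m z \<le> h}"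

lemma height_width_norm:
  assumes "cmod m = 1"
  shows "(height m z)\<^sup>2 + (Im (z * cnj m))\<^sup>2 = (cmod z)\<^sup>2"
proof -
  have "(cmod (z * cnj m))\<^sup>2 = (height m z)\<^sup>2 + (Im (z * cnj m))\<^sup>2"
    by (simp only: cmod_power2 height_def)
  then show ?thesis using assms by (simp add: norm_mult)
qed

lemma height_bounds:
  assumes "cmod m = 1" "z \<in> cball 0 1"
  shows "height m z \<in> {-1..1}"
proof -
  have "\<bar>height m z\<bar> \<le> cmod (z * cnj m)" unfolding height_def by (rule abs_Re_le_cmod)
  then show ?thesis using assms by (simp add: norm_mult abs_le_iff)
qed

lemma cos_angle: "cmod m = 1 \<Longrightarrow> z \<in> cball 0 1 \<Longrightarrow> cos (angle m z) = height m z"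
  using height_bounds[of m z] by (simp add: angle_def cos_arccos)

lemma angle_bounds: "cmod m = 1 \<Longrightarrow> z \<in> cball 0 1 \<Longrightarrow> angle m z \<in> {0..pi}"
  using height_bounds[of m z] by (simp add: angle_def arccos_lbound arccos_ubound)

lemma sin_angle: "cmod m = 1 \<Longrightarrow> z \<in> cball 0 1 \<Longrightarrow> sin (angle m z) = sqrt (1 - (height m z)\<^sup>2)"
  using height_bounds[of m z] by (simp add: angle_def sin_arccos)

lemma chord_angle_offset:
  assumes "cmod m = 1" "z \<in> cball 0 1" "sin (angle m z) \<noteq> 0"
  shows "chord m (angle m z) (offset m z) = z"
proof -
  have "Complex (height m z) (Im (z * cnj m)) = z * cnj m"
    by (simp add: height_def complex_eq_iff)
  then have "chord m (angle m z) (offset m z) = z * (m * cnj m)"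
    using assms by (simp add: chord_def offset_def cos_angle sin_angle mult_ac)
  then show ?thesis using assms(1) by (simp add: complex_norm_square[symmetric])
qed

lemma offset_bounds:
  assumes "cmod m = 1" "z \<in> cball 0 1"
  shows "offset m z \<in> {-1..1}"
proof -
  have "(Im (z * cnj m))\<^sup>2 \<le> 1 - (height m z)\<^sup>2"
    using height_width_norm[OF assms(1), of z] power_le_one[of "cmod z" 2] assms(2)
    unfolding mem_cball_0 by (smt (verit) norm_ge_zero)
  then have "\<bar>Im (z * cnj m)\<bar> \<le> sqrt (1 - (height m z)\<^sup>2)"
    by (simp add: real_le_rsqrt)
  \<comment> \<open>This includes \<open>r = 0\<close>, where the quotient is 0. That case occurs at
    the two ends of the axis.\<close>
  moreover have "\<bar>w / r\<bar> \<le> 1" if "\<bar>w\<bar> \<le> r" for w r :: real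
    using that by (auto simp: abs_divide divide_le_eq_1)
  ultimately have "\<bar>offset m z\<bar> \<le> 1"
    unfolding offset_def by blast
  then show ?thesis by (simp add: abs_le_iff)
qed

lemma
  assumes m: "cmod m = 1"
  shows height_chord: "height m (chord m \<phi> \<sigma>) = cos \<phi>"
    and width_chord: "Im (chord m \<phi> \<sigma> * cnj m) = \<sigma> * sin \<phi>"
proof -
  have "chord m \<phi> \<sigma> * cnj m = (m * cnj m) * Complex (cos \<phi>) (\<sigma> * sin \<phi>)"
    by (simp add: chord_def)
  then have "chord m \<phi> \<sigma> * cnj m = Complex (cos \<phi>) (\<sigma> * sin \<phi>)"
    using m by (simp add: complex_norm_square[symmetric])
  then show "height m (chord m \<phi> \<sigma>) = cos \<phi>" "Im (chord m \<phi> \<sigma> * cnj m) = \<sigma> * sin \<phi>"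
    by (simp_all add: height_def)
qed

lemma angle_chord: "cmod m = 1 \<Longrightarrow> \<phi> \<in> {0..pi} \<Longrightarrow> angle m (chord m \<phi> \<sigma>) = \<phi>"
  by (simp add: angle_def height_chord arccos_cos)

lemma offset_chord:
  assumes "cmod m = 1" "0 < \<phi>" "\<phi> < pi"
  shows "offset m (chord m \<phi> \<sigma>) = \<sigma>"
proof -
  have "0 < sin \<phi>" using assms by (intro sin_gt_zero) auto
  moreover have "sqrt (1 - (cos \<phi>)\<^sup>2) = \<bar>sin \<phi>\<bar>" by (simp flip: sin_squared_eq)
  ultimately show ?thesis
    unfolding offset_def width_chord[OF assms(1)] height_chord[OF assms(1)] by simp
qed

lemma chord_in_ball:
  assumes "cmod m = 1" "\<sigma> \<in> {-1..1}"
  shows "chord m \<phi> \<sigma> \<in> cball 0 1"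
proof -
  have "\<sigma>\<^sup>2 \<le> 1" using assms by (simp add: abs_square_le_1 abs_le_iff)
  then have "\<sigma>\<^sup>2 * (sin \<phi>)\<^sup>2 \<le> 1 * (sin \<phi>)\<^sup>2" by (intro mult_right_mono) auto
  then have "(cmod (Complex (cos \<phi>) (\<sigma> * sin \<phi>)))\<^sup>2 \<le> 1"
    unfolding cmod_power2 by (simp add: power_mult_distrib sin_squared_eq)
  then have "cmod (Complex (cos \<phi>) (\<sigma> * sin \<phi>)) \<le> 1"
    by (metis abs_norm_cancel abs_square_le_1)
  then show ?thesis using assms by (simp add: chord_def norm_mult)
qed

lemma chord_1: "chord m \<phi> 1 = m * cis \<phi>" and chord_minus_1: "chord m \<phi> (- 1) = m * cis (- \<phi>)"
  by (simp_all add: chord_def complex_eq_iff)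

lemma chord_linepath: "chord m \<phi> (linepath a b t) = linepath (chord m \<phi> a) (chord m \<phi> b) t"
  by (simp add: chord_def linepath_def complex_eq_iff algebra_simps)

lemma continuous_on_chord [continuous_intros]:
  fixes f h :: "'b::t2_space \<Rightarrow> real"
  shows "continuous_on A f \<Longrightarrow> continuous_on A h \<Longrightarrow> continuous_on A (\<lambda>x. chord m (f x) (h x))"
  unfolding chord_def Complex_eq
  by (intro continuous_intros continuous_on_cos continuous_on_sin)

lemma continuous_on_height: "continuous_on A (height m)"
  unfolding height_def by (intro continuous_intros)

lemma continuous_on_angle: "cmod m = 1 \<Longrightarrow> continuous_on (cball 0 1) (angle m)"
  unfolding angle_def
  by (intro continuous_on_arccos continuous_on_height) (use height_bounds in auto)

lemma continuous_on_offset: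
  assumes "cmod m = 1" "A \<subseteq> cball 0 1" "\<And>z. z \<in> A \<Longrightarrow> sin (angle m z) \<noteq> 0"
  shows "continuous_on A (offset m)"
proof -
  have "sqrt (1 - (height m z)\<^sup>2) \<noteq> 0" if "z \<in> A" for z
    using assms that sin_angle[of m z] by auto
  then show ?thesis
    unfolding offset_def by (intro continuous_intros continuous_on_height) auto
qed

text \<open>The cosine is decreasing on \<open>[0, pi]\<close>, so bounds on the angle are bounds on
  a linear function. Closedness and convexity of bands follow.\<close>

lemma band_halfspaces:
  assumes m: "cmod m = 1" and "0 \<le> l" "l \<le> pi" "0 \<le> h" "h \<le> pi"
  shows "band m l h = cball 0 1 \<inter> {z. m \<bullet> z \<le> cos l} \<inter> {z. m \<bullet> z \<ge> cos h}"
proof -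
  have inner: "m \<bullet> z = height m z" for z
    by (simp add: height_def inner_complex_def mult_ac)
  have "l \<le> angle m z \<longleftrightarrow> m \<bullet> z \<le> cos l" "angle m z \<le> h \<longleftrightarrow> cos h \<le> m \<bullet> z" if "z \<in> cball 0 1" for z
    using that assms angle_bounds[OF m that] cos_angle[OF m that, symmetric]
    by (auto simp: inner cos_mono_le_eq)
  then show ?thesis unfolding band_def by blast
qed

lemma
  assumes "cmod m = 1" "0 \<le> l" "l \<le> pi" "0 \<le> h" "h \<le> pi"
  shows closed_band: "closed (band m l h)" and convex_band: "convex (band m l h)"
  unfolding band_halfspaces[OF assms]
  by (auto intro!: closed_Int convex_Int closed_halfspace_le closed_halfspace_ge convex_halfspace_le
      convex_halfspace_ge)

definition clamp01 :: "real \<Rightarrow> real" where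
  "clamp01 x = max 0 (min 1 x)"

lemma clamp01_simps:
  "x \<le> 0 \<Longrightarrow> clamp01 x = 0" "1 \<le> x \<Longrightarrow> clamp01 x = 1" "x \<in> {0..1} \<Longrightarrow> clamp01 x = x"
  by (auto simp: clamp01_def)

lemma clamp01_range: "clamp01 x \<in> {0..1}"
  by (auto simp: clamp01_def)

lemma continuous_on_clamp01 [continuous_intros]:
  "continuous_on A f \<Longrightarrow> continuous_on A (\<lambda>x. clamp01 (f x))"
  unfolding clamp01_def by (intro continuous_intros)

lemma periodic_extension_eq:
  assumes "s \<in> {0..1}" "Q (x, 0) = Q (x, 1)"
  shows "Q (x, frac s) = Q (x, s)"
  using assms by (cases "s = 1") (auto simp: frac_eq_id)

context glued_surface
begin

text \<open>
  \<open>\<eta>\<close> is half the angle of a side of the polygon, and \<open>axis k\<close> is the midpoint of side \<open>k\<close>.  The chords at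
  angles between \<open>\<eta>\<close> and \<open>3 * \<eta>\<close> join the two neighbours of side \<open>k\<close>.  If these are glued to each other,
  they are glued by the reflection in the axis, so the chords are closed curves in \<open>S\<close>.
\<close>

definition \<eta> :: real where "\<eta> = pi / (4 * real g)"

definition axis :: "nat \<Rightarrow> complex" where
  "axis k = cis (\<eta> * (2 * real k + 1))"

lemma \<eta>_pos: "0 < \<eta>"
  using genus by (simp add: \<eta>_def)

lemma \<eta>_pi: "4 * real g * \<eta> = pi"
  using genus by (simp add: \<eta>_def)

lemma \<eta>_le_pi: "x \<le> 4 * real g \<Longrightarrow> x * \<eta> \<le> pi"
  using mult_right_mono[of x "4 * real g" \<eta>] \<eta>_pos \<eta>_pi by simp

lemma \<eta>_less_pi: "x < 4 * real g \<Longrightarrow> x * \<eta> < pi"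
  using mult_strict_right_mono[of x "4 * real g" \<eta>] \<eta>_pos \<eta>_pi by simp

lemma norm_axis [simp]: "cmod (axis k) = 1"
  by (simp add: axis_def)

text \<open>Each side spans the angle \<open>2 * \<eta>\<close> and the axis meets side
  \<open>k\<close> at parameter 1/2, which accounts for the \<open>- 1\<close>.\<close>

lemma side_axis: "side j t = axis k * cis ((2 * (real j + t - real k) - 1) * \<eta>)"
proof -
  have "2 * pi * (real j + t) / real (4 * g) =
      \<eta> * (2 * real k + 1) + (2 * (real j + t - real k) - 1) * \<eta>"
    using genus by (simp add: \<eta>_def field_simps)
  then show ?thesis by (simp only: polygon_side_def axis_def cis_mult)
qed

text \<open>Here \<delta> is the signed angle from the axis in units of \<eta>. A half turn is
  \<open>4 * real g\<close> units; beyond it the angle folds back to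
  \<open>8 * real g - \<bar>\<delta>\<bar>\<close>, whence the upper limit in the last
  claim.\<close>

lemma angle_side:
  assumes "\<delta> = 2 * (real j + t - real k) - 1"
  shows "\<bar>\<delta>\<bar> \<le> 4 * real g \<Longrightarrow> angle (axis k) (side j t) = \<bar>\<delta>\<bar> * \<eta>"
    and "\<bar>\<delta>\<bar> \<le> L \<Longrightarrow> L \<le> 4 * real g \<Longrightarrow> angle (axis k) (side j t) \<le> L * \<eta>"
    and "0 \<le> L \<Longrightarrow> L \<le> \<bar>\<delta>\<bar> \<Longrightarrow> \<bar>\<delta>\<bar> \<le> 8 * real g - L \<Longrightarrow> L * \<eta> \<le> angle (axis k) (side j t)"
proof -
  have "height (axis k) (side j t) = cos (\<delta> * \<eta>)"
    using height_chord[of "axis k" "\<delta> * \<eta>" 1] by (simp add: chord_1 side_axis[of j t k] assms)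
  moreover have "\<bar>\<delta> * \<eta>\<bar> = \<bar>\<delta>\<bar> * \<eta>" using \<eta>_pos by (simp add: abs_mult)
  ultimately have h: "angle (axis k) (side j t) = arccos (cos (\<bar>\<delta>\<bar> * \<eta>))"
    unfolding angle_def by (metis cos_abs_real)
  show 1: "angle (axis k) (side j t) = \<bar>\<delta>\<bar> * \<eta>" if "\<bar>\<delta>\<bar> \<le> 4 * real g"
    unfolding h using that \<eta>_le_pi \<eta>_pos by (intro arccos_cos) auto
  show "angle (axis k) (side j t) \<le> L * \<eta>" if "\<bar>\<delta>\<bar> \<le> L" "L \<le> 4 * real g"
    using that \<eta>_pos by (subst 1) auto
  show "L * \<eta> \<le> angle (axis k) (side j t)" if L: "0 \<le> L" "L \<le> \<bar>\<delta>\<bar>" "\<bar>\<delta>\<bar> \<le> 8 * real g - L"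
  proof (cases "\<bar>\<delta>\<bar> \<le> 4 * real g")
    case True
    then show ?thesis using L \<eta>_pos by (subst 1) auto
  next
    case False
    have "cos (\<bar>\<delta>\<bar> * \<eta>) = cos (2 * pi - \<bar>\<delta>\<bar> * \<eta>)" by simp
    also have "2 * pi - \<bar>\<delta>\<bar> * \<eta> = (8 * real g - \<bar>\<delta>\<bar>) * \<eta>"
      using \<eta>_pi by (simp add: algebra_simps)
    finally have "angle (axis k) (side j t) = (8 * real g - \<bar>\<delta>\<bar>) * \<eta>"
      unfolding h using False L \<eta>_pos \<eta>_le_pi[of "8 * real g - \<bar>\<delta>\<bar>"] by (simp add: arccos_cos)
    then show ?thesis using L \<eta>_pos by simp
  qed
qed

lemma offset_side:
  assumes "\<delta> = 2 * (real j + t - real k) - 1"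
  shows "0 < \<delta> \<Longrightarrow> \<delta> < 4 * real g \<Longrightarrow> offset (axis k) (side j t) = 1"
    and "\<delta> < 0 \<Longrightarrow> - 4 * real g < \<delta> \<Longrightarrow> offset (axis k) (side j t) = - 1"
proof -
  have side: "side j t = axis k * cis (\<delta> * \<eta>)" by (simp add: side_axis[of j t k] assms)
  show "offset (axis k) (side j t) = 1" if "0 < \<delta>" "\<delta> < 4 * real g"
    unfolding side chord_1[symmetric] using that \<eta>_pos \<eta>_less_pi by (intro offset_chord) auto
  show "offset (axis k) (side j t) = - 1" if "\<delta> < 0" "- 4 * real g < \<delta>"
  proof -
    have "side j t = chord (axis k) (- \<delta> * \<eta>) (- 1)" by (simp add: side chord_minus_1)
    then show ?thesis
      using that \<eta>_pos \<eta>_less_pi[of "- \<delta>"] by (simp only:) (intro offset_chord, auto simp: mult_less_0_iff)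
  qed
qed

lemma side_in_band:
  "side j t \<in> band (axis k) l h \<longleftrightarrow> l \<le> angle (axis k) (side j t) \<and> angle (axis k) (side j t) \<le> h"
  by (simp add: band_def)

section \<open>The strip of chords around one side\<close>

text \<open>Clamping continues the transverse coordinate by 1 over the cap at side \<open>k\<close>
  and by 0 over the part of the disc beyond the strip.\<close>

definition strip_X :: "nat \<Rightarrow> complex \<Rightarrow> real" where
  "strip_X k z = clamp01 ((3 - angle (axis k) z / \<eta>) / 2)"

definition strip_Y :: "nat \<Rightarrow> complex \<Rightarrow> real" where
  "strip_Y k z = (1 + offset (axis k) z) / 2"

definition strip_Q :: "nat \<Rightarrow> real \<times> real \<Rightarrow> 'a" where
  "strip_Q k = (\<lambda>(x, s). q (chord (axis k) ((3 - 2 * x) * \<eta>) (2 * s - 1)))"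

definition strip_P :: "nat \<Rightarrow> real \<times> real \<Rightarrow> 'a" where
  "strip_P k = (\<lambda>(x, s). strip_Q k (x, frac s))"

lemma strip_Q_closed:
  assumes k: "i < g" "k = 4 * i + 1 \<or> k = 4 * i + 2" and x: "x \<in> {0..1}"
  shows "strip_Q k (x, 0) = strip_Q k (x, 1)"
proof -
  have "chord (axis k) ((3 - 2 * x) * \<eta>) (- 1) = side (k - 1) x"
    using k by (auto simp: chord_minus_1 side_axis[of _ _ k] algebra_simps)
  moreover have "chord (axis k) ((3 - 2 * x) * \<eta>) 1 = side (k - 1 + 2) (1 - x)"
    using k by (auto simp: chord_1 side_axis[of _ _ k] algebra_simps)
  moreover have "q (side (k - 1) x) = q (side (k - 1 + 2) (1 - x))"
    using k x by (intro glue[of i]) auto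
  ultimately show ?thesis by (simp add: strip_Q_def)
qed

lemma strip_angles:
  assumes "x \<in> {0..1}"
  shows "0 < (3 - 2 * x) * \<eta>" "(3 - 2 * x) * \<eta> < pi" "(3 - 2 * x) * \<eta> \<in> {\<eta>..3 * \<eta>}"
  using assms \<eta>_pos \<eta>_less_pi[of "3 - 2 * x"] genus
  by (auto intro: mult_right_mono[of 1 "3 - 2 * x" \<eta>, simplified] mult_right_mono)

lemma strip_X_M:
  "angle (axis k) z \<le> \<eta> \<Longrightarrow> strip_X k z = 1" "3 * \<eta> \<le> angle (axis k) z \<Longrightarrow> strip_X k z = 0"
  using \<eta>_pos by (auto simp: strip_X_def clamp01_simps field_simps)

lemma strip_X_N:
  assumes "\<eta> \<le> angle (axis k) z" "angle (axis k) z \<le> 3 * \<eta>"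
  shows "angle (axis k) z = (3 - 2 * strip_X k z) * \<eta>"
proof -
  have "strip_X k z = (3 - angle (axis k) z / \<eta>) / 2"
    unfolding strip_X_def using assms \<eta>_pos by (intro clamp01_simps) (auto simp: field_simps)
  then show ?thesis using \<eta>_pos by (simp add: field_simps)
qed

text \<open>In units of \<eta> from the axis, side \<open>k + n\<close> occupies
  \<open>[2n - 1, 2n + 1]\<close>: the neighbours of side \<open>k\<close> bound the strip, side
  \<open>k\<close> bounds the cap, and all other sides lie beyond. This serves both the condition
  \<open>pairs\<close> of the annulus and the jumps of \<open>strip_X\<close> at midpoints.\<close>

lemma strip_pairs:
  assumes k: "i < g" "k = 4 * i + 1 \<or> k = 4 * i + 2"
    and j: "i' < g" "j = 4 * i' \<or> j = 4 * i' + 1" and t: "t \<in> {0..1}"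
  shows "j = k - 1 \<and> angle (axis k) (side j t) = (3 - 2 * t) * \<eta> \<and>
      angle (axis k) (side (j + 2) (1 - t)) = (3 - 2 * t) * \<eta> \<and>
      offset (axis k) (side j t) = - 1 \<and> offset (axis k) (side (j + 2) (1 - t)) = 1 \<or>
    j = k \<and> k = 4 * i + 1 \<and>
      angle (axis k) (side j t) \<le> \<eta> \<and> 3 * \<eta> \<le> angle (axis k) (side (j + 2) (1 - t)) \<or>
    j + 2 = k \<and> k = 4 * i + 2 \<and>
      3 * \<eta> \<le> angle (axis k) (side j t) \<and> angle (axis k) (side (j + 2) (1 - t)) \<le> \<eta> \<or>
    j \<noteq> k - 1 \<and> j \<noteq> k \<and> j + 2 \<noteq> k \<and>
      3 * \<eta> \<le> angle (axis k) (side j t) \<and> 3 * \<eta> \<le> angle (axis k) (side (j + 2) (1 - t))"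
proof -
  define \<delta> where "\<delta> = 2 * (real j + t - real k) - 1"
  define \<delta>' where "\<delta>' = 2 * (real (j + 2) + (1 - t) - real k) - 1"
  have g1: "1 \<le> real g" using genus by simp
  note ang = angle_side[OF \<delta>_def] angle_side[OF \<delta>'_def]
  note off = offset_side[OF \<delta>_def] offset_side[OF \<delta>'_def]
  consider (same) "j = k - 1" | (top) "j = k" "k = 4 * i + 1" | (bot) "j + 2 = k" "k = 4 * i + 2"
    | (later) "j \<ge> k + 2" | (before) "j + 3 \<le> k"
  proof -
    have "j = k - 1 \<or> j = k \<and> k = 4 * i + 1 \<or> j + 2 = k \<and> k = 4 * i + 2 \<or> j \<ge> k + 2 \<or> j + 3 \<le> k"
      using k(2) j(2) by (cases i' i rule: linorder_cases) auto
    then show thesis using that by blast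
  qed
  then show ?thesis
  proof cases
    case same
    then have "real k = real j + 1" using k by auto
    then have d: "\<delta> = 2 * t - 3" "\<delta>' = 3 - 2 * t" by (simp_all add: \<delta>_def \<delta>'_def)
    have b: "\<bar>\<delta>\<bar> \<le> 4 * real g" "\<bar>\<delta>'\<bar> \<le> 4 * real g" "\<delta> < 0" "- 4 * real g < \<delta>" "0 < \<delta>'"
      "\<delta>' < 4 * real g" and e: "\<bar>\<delta>\<bar> = 3 - 2 * t" "\<bar>\<delta>'\<bar> = 3 - 2 * t"
      using d t g1 by auto
    show ?thesis
      using same ang(1)[OF b(1)] ang(4)[OF b(2)] off(2)[OF b(3,4)] off(3)[OF b(5,6)] unfolding e by simp
  next
    case top
    then have b: "\<bar>\<delta>\<bar> \<le> 1" "3 \<le> \<bar>\<delta>'\<bar>" "\<bar>\<delta>'\<bar> \<le> 8 * real g - 3" "1 \<le> 4 * real g"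
      using t g1 by (auto simp: \<delta>_def \<delta>'_def)
    show ?thesis using ang(2)[OF b(1,4)] ang(6)[OF _ b(2,3)] top by simp
  next
    case bot
    then have "real k = real j + 2" by auto
    then have b: "\<bar>\<delta>'\<bar> \<le> 1" "3 \<le> \<bar>\<delta>\<bar>" "\<bar>\<delta>\<bar> \<le> 8 * real g - 3" "1 \<le> 4 * real g"
      using t g1 by (auto simp: \<delta>_def \<delta>'_def)
    show ?thesis using ang(3)[OF _ b(2,3)] ang(5)[OF b(1,4)] bot by simp
  next
    case later
    have "j + 3 \<le> 4 * g" using j by linarith
    then have "real j + 3 \<le> 4 * real g" by linarith
    moreover have "real k + 2 \<le> real j" "1 \<le> real k"
      using later k by linarith+
    ultimately have b: "3 \<le> \<bar>\<delta>\<bar>" "\<bar>\<delta>\<bar> \<le> 8 * real g - 3" "3 \<le> \<bar>\<delta>'\<bar>" "\<bar>\<delta>'\<bar> \<le> 8 * real g - 3"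
      using t by (auto simp: \<delta>_def \<delta>'_def)
    have "j \<noteq> k - 1" "j \<noteq> k" "j + 2 \<noteq> k" using later k by linarith+
    then show ?thesis using ang(3)[OF _ b(1,2)] ang(6)[OF _ b(3,4)] by simp
  next
    case before
    have "k + 2 \<le> 4 * g" using k by linarith
    \<comment> \<open>Residues modulo 4 exclude \<open>j + 3 = k\<close>, in which case side
      \<open>j + 2\<close> would be a neighbour of side \<open>k\<close>.\<close>
    moreover have "j + 4 \<le> k"
      using before k(2) j(2) by (cases i' i rule: linorder_cases) auto
    ultimately have "real j + 4 \<le> real k" "real k + 2 \<le> 4 * real g"
      by linarith+
    then have b: "3 \<le> \<bar>\<delta>\<bar>" "\<bar>\<delta>\<bar> \<le> 8 * real g - 3" "3 \<le> \<bar>\<delta>'\<bar>" "\<bar>\<delta>'\<bar> \<le> 8 * real g - 3"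
      using t by (auto simp: \<delta>_def \<delta>'_def)
    have "j \<noteq> k - 1" "j \<noteq> k" "j + 2 \<noteq> k" using before k by linarith+
    then show ?thesis using ang(3)[OF _ b(1,2)] ang(6)[OF _ b(3,4)] by simp
  qed
qed

lemma annulus_strip:
  assumes k: "i < g" "k = 4 * i + 1 \<or> k = 4 * i + 2"
  shows "annulus g S q (band (axis k) \<eta> (3 * \<eta>)) (band (axis k) 0 \<eta> \<union> band (axis k) (3 * \<eta>) pi)
    (strip_X k) (strip_Y k) (strip_P k)
    {band (axis k) 0 \<eta>, band (axis k) \<eta> (3 * \<eta>), band (axis k) (3 * \<eta>) pi}"
proof -
  let ?m = "axis k"
  let ?N = "band ?m \<eta> (3 * \<eta>)"
  let ?M = "band ?m 0 \<eta> \<union> band ?m (3 * \<eta>) pi"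
  have pi3: "3 * \<eta> < pi" using \<eta>_less_pi[of 3] genus by simp
  have N_sin: "sin (angle ?m z) \<noteq> 0" if "z \<in> ?N" for z
    using that \<eta>_pos pi3 sin_gt_zero[of "angle ?m z"] by (auto simp: band_def)
  have ND: "?N \<subseteq> cball 0 1" by (auto simp: band_def)
  have cover: "band ?m 0 \<eta> \<union> band ?m \<eta> (3 * \<eta>) \<union> band ?m (3 * \<eta>) pi = cball 0 1"
    using angle_bounds[of ?m] by (auto simp: band_def)
  \<comment> \<open>The chords invert the strip coordinates; this yields the range of
    \<open>strip_P\<close> and the condition \<open>P_surj\<close>.\<close>
  have chordN: "chord ?m ((3 - 2 * x) * \<eta>) (2 * s - 1) \<in> ?N"
    and chordX: "strip_X k (chord ?m ((3 - 2 * x) * \<eta>) (2 * s - 1)) = x"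
    and chordY: "strip_Y k (chord ?m ((3 - 2 * x) * \<eta>) (2 * s - 1)) = s"
    if "x \<in> {0..1}" "s \<in> {0..1}" for x s
  proof -
    note a = strip_angles[OF that(1)]
    have ang: "angle ?m (chord ?m ((3 - 2 * x) * \<eta>) (2 * s - 1)) = (3 - 2 * x) * \<eta>"
      using a by (intro angle_chord) auto
    show N: "chord ?m ((3 - 2 * x) * \<eta>) (2 * s - 1) \<in> ?N"
      using chord_in_ball[of ?m "2 * s - 1"] a that ang by (auto simp: band_def)
    show "strip_X k (chord ?m ((3 - 2 * x) * \<eta>) (2 * s - 1)) = x"
      using \<eta>_pos that by (simp add: strip_X_def ang clamp01_simps)
    show "strip_Y k (chord ?m ((3 - 2 * x) * \<eta>) (2 * s - 1)) = s"
      using a by (simp add: strip_Y_def offset_chord)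
  qed
  show ?thesis
  proof unfold_locales
    show "?N \<union> ?M = cball 0 1" using cover by blast
    show "closed ?N" "closed ?M"
      using \<eta>_pos pi3 by (auto intro!: closed_band)
    show "continuous_on (cball 0 1) (strip_X k)"
      unfolding strip_X_def using \<eta>_pos by (intro continuous_intros continuous_on_angle) auto
    show "continuous_on ?N (strip_Y k)"
      unfolding strip_Y_def
      by (intro continuous_intros continuous_on_offset ND N_sin) auto
    show "strip_X k z \<in> {0..1}" for z unfolding strip_X_def by (rule clamp01_range)
    show "strip_X k z = 0 \<or> strip_X k z = 1" if "z \<in> ?M" for z
      using that strip_X_M[of k z] by (auto simp: band_def)
    have "continuous_on ({0..1} \<times> {0..1}) (strip_Q k)"
      unfolding strip_Q_def case_prod_beta
      by (rule continuous_on_compose2[OF q_continuous])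
        (use chordN ND in \<open>auto intro!: continuous_intros simp del: mem_cball\<close>)
    then show "continuous_on ({0..1} \<times> UNIV) (strip_P k)"
      unfolding strip_P_def using strip_Q_closed[OF k]
      by (intro continuous_on_periodic_extension) auto
    show "strip_P k ` ({0..1} \<times> UNIV) \<subseteq> S"
    proof clarify
      fix x s :: real assume "x \<in> {0..1}"
      moreover have "frac s \<in> {0..1}" using frac_lt_1[of s] by (simp add: less_imp_le)
      ultimately have "chord ?m ((3 - 2 * x) * \<eta>) (2 * frac s - 1) \<in> cball 0 1"
        using chordN ND by blast
      then show "strip_P k (x, s) \<in> S" by (simp add: strip_P_def strip_Q_def q_in del: mem_cball)
    qed
    show "strip_P k (x, s + 1) = strip_P k (x, s)" for x s
      by (simp add: strip_P_def frac_1_eq)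
    show "strip_P k (strip_X k z, strip_Y k z) = q z" if z: "z \<in> ?N" for z
    proof -
      have zD: "z \<in> cball 0 1" using z ND by blast
      have Y: "strip_Y k z \<in> {0..1}"
        using offset_bounds[of ?m z] zD by (auto simp: strip_Y_def)
      have X: "strip_X k z \<in> {0..1}" unfolding strip_X_def by (rule clamp01_range)
      have "strip_P k (strip_X k z, strip_Y k z) = strip_Q k (strip_X k z, strip_Y k z)"
        unfolding strip_P_def prod.case
        by (rule periodic_extension_eq[OF Y strip_Q_closed[OF k X]])
      also have "\<dots> = q (chord ?m (angle ?m z) (offset ?m z))"
      proof -
        have "2 * strip_Y k z - 1 = offset ?m z" by (simp add: strip_Y_def field_simps)
        then show ?thesis using strip_X_N[of k z] z by (simp add: strip_Q_def band_def)
      qed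
      finally show ?thesis using chord_angle_offset[of ?m z] zD N_sin[OF z] by simp
    qed
    show "\<exists>z\<in>?N. strip_X k z = x \<and> strip_Y k z - s \<in> \<int>" if x: "x \<in> {0..1}" for x s
    proof -
      have s: "frac s \<in> {0..1}" using frac_lt_1[of s] by (simp add: less_imp_le)
      show ?thesis
        by (rule bexI[OF _ chordN[OF x s]]) (unfold chordX[OF x s] chordY[OF x s], simp add: frac_def)
    qed
    show "side j t \<in> ?M \<and> side (j + 2) (1 - t) \<in> ?M \<or>
       side j t \<in> ?N \<and> side (j + 2) (1 - t) \<in> ?N \<and>
       strip_X k (side j t) = strip_X k (side (j + 2) (1 - t)) \<and>
       strip_Y k (side j t) - strip_Y k (side (j + 2) (1 - t)) \<in> \<int>"
      if j: "i' < g" "j = 4 * i' \<or> j = 4 * i' + 1" "t \<in> {0..1}" for i' j t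
    proof -
      have b: "0 \<le> angle ?m (side j t)" "angle ?m (side j t) \<le> pi" for j t
        using angle_bounds[of ?m "side j t"] by auto
      have t: "\<eta> \<le> (3 - 2 * t) * \<eta>" "(3 - 2 * t) * \<eta> \<le> 3 * \<eta>"
        using strip_angles[OF j(3)] by auto
      from strip_pairs[OF k j] t b show ?thesis
        unfolding Un_iff side_in_band
        by (elim disjE conjE) (auto simp: strip_X_def strip_Y_def)
    qed
    show "finite {band ?m 0 \<eta>, ?N, band ?m (3 * \<eta>) pi}" by simp
    show "\<Union>{band ?m 0 \<eta>, ?N, band ?m (3 * \<eta>) pi} = cball 0 1" using cover by auto
    fix b assume b: "b \<in> {band ?m 0 \<eta>, ?N, band ?m (3 * \<eta>) pi}"
    then show "closed b" "convex b" using \<eta>_pos pi3 by (auto intro!: closed_band convex_band)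
    have "strip_X k constant_on band ?m 0 \<eta>" "strip_X k constant_on band ?m (3 * \<eta>) pi"
      using strip_X_M[of k] by (auto simp: constant_on_def band_def)
    then show "b \<subseteq> ?N \<or> b \<subseteq> ?M \<and> strip_X k constant_on b"
      using b by auto
  qed
qed

end

section \<open>Annuli that cross two pairs of sides\<close>

context glued_surface
begin

text \<open>
  Here \<open>k = 4 * i + 4\<close>.  The chords at angle \<open>\<phi>\<close> between \<open>\<eta>\<close> and \<open>3 * \<eta>\<close> and the chords at angle
  \<open>8 * \<eta> - \<phi>\<close> have glued ends.  Together they form closed curves which connect two neighbouring handles.
\<close>

definition belt_X :: "nat \<Rightarrow> complex \<Rightarrow> real" where
  "belt_X k z = max (clamp01 ((3 - angle (axis k) z / \<eta>) / 2)) (clamp01 ((angle (axis k) z / \<eta> - 5) / 2))"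

text \<open>One turn runs up the chord nearer to the midpoint of side \<open>k\<close> during the
  first half and down the other chord during the second. The case distinction at
  \<open>4 * \<eta>\<close> falls between the two bands, so it does not break continuity on the
  annulus.\<close>

definition belt_Y :: "nat \<Rightarrow> complex \<Rightarrow> real" where
  "belt_Y k z = (if angle (axis k) z \<le> 4 * \<eta> then (1 + offset (axis k) z) / 4
     else (3 - offset (axis k) z) / 4)"

definition belt_Q :: "nat \<Rightarrow> real \<times> real \<Rightarrow> 'a" where
  "belt_Q k = (\<lambda>(x, s). if s \<le> 1/2 then q (chord (axis k) ((3 - 2 * x) * \<eta>) (4 * s - 1))
     else q (chord (axis k) ((5 + 2 * x) * \<eta>) (3 - 4 * s)))"

definition belt_P :: "nat \<Rightarrow> real \<times> real \<Rightarrow> 'a" where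
  "belt_P k = (\<lambda>(x, s). belt_Q k (x, frac s))"

text \<open>The upper ends lie on sides \<open>k + 1\<close> and \<open>k + 3\<close>, the lower
  ones on \<open>k - 1\<close> and \<open>k - 3\<close>. These are the second pairs of sides of the
  handles \<open>Suc i\<close> and \<open>i\<close>.\<close>

lemma belt_glue:
  assumes k: "Suc i < g" "k = 4 * i + 4" and x: "x \<in> {0..1}"
  shows "q (chord (axis k) ((3 - 2 * x) * \<eta>) 1) = q (chord (axis k) ((5 + 2 * x) * \<eta>) 1)"
    and "q (chord (axis k) ((3 - 2 * x) * \<eta>) (- 1)) = q (chord (axis k) ((5 + 2 * x) * \<eta>) (- 1))"
proof -
  have "chord (axis k) ((3 - 2 * x) * \<eta>) 1 = side (k + 1) (1 - x)"
    "chord (axis k) ((5 + 2 * x) * \<eta>) 1 = side (k + 1 + 2) (1 - (1 - x))"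
    by (simp_all add: chord_1 side_axis[of _ _ k] algebra_simps)
  moreover have "q (side (k + 1) (1 - x)) = q (side (k + 1 + 2) (1 - (1 - x)))"
    using k x by (intro glue[of "Suc i"]) auto
  ultimately show "q (chord (axis k) ((3 - 2 * x) * \<eta>) 1) = q (chord (axis k) ((5 + 2 * x) * \<eta>) 1)"
    by simp
  have "(2 * (real (4 * i + 1 + 2) + (1 - (1 - x)) - real k) - 1) * \<eta> = - ((3 - 2 * x) * \<eta>)"
    "(2 * (real (4 * i + 1) + (1 - x) - real k) - 1) * \<eta> = - ((5 + 2 * x) * \<eta>)"
    using k by (simp_all add: algebra_simps)
  then have "chord (axis k) ((3 - 2 * x) * \<eta>) (- 1) = side (4 * i + 1 + 2) (1 - (1 - x))"
    "chord (axis k) ((5 + 2 * x) * \<eta>) (- 1) = side (4 * i + 1) (1 - x)"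
    by (simp_all only: chord_minus_1 side_axis[of _ _ k])
  moreover have "q (side (4 * i + 1) (1 - x)) = q (side (4 * i + 1 + 2) (1 - (1 - x)))"
    using k x by (intro glue[of i]) auto
  ultimately show "q (chord (axis k) ((3 - 2 * x) * \<eta>) (- 1)) = q (chord (axis k) ((5 + 2 * x) * \<eta>) (- 1))"
    by simp
qed

lemma belt_Q_closed:
  assumes "Suc i < g" "k = 4 * i + 4" "x \<in> {0..1}"
  shows "belt_Q k (x, 0) = belt_Q k (x, 1)"
  using belt_glue(2)[OF assms] by (simp add: belt_Q_def)

lemma belt_X_low:
  assumes "angle (axis k) z \<le> 5 * \<eta>"
  shows "belt_X k z = clamp01 ((3 - angle (axis k) z / \<eta>) / 2)"
proof -
  have "clamp01 ((angle (axis k) z / \<eta> - 5) / 2) = 0"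
    using assms \<eta>_pos by (intro clamp01_simps) (simp add: field_simps)
  moreover have "0 \<le> clamp01 ((3 - angle (axis k) z / \<eta>) / 2)" by (simp add: clamp01_def)
  ultimately show ?thesis by (simp only: belt_X_def max.absorb1)
qed

lemma belt_X_high:
  assumes "3 * \<eta> \<le> angle (axis k) z"
  shows "belt_X k z = clamp01 ((angle (axis k) z / \<eta> - 5) / 2)"
proof -
  have "clamp01 ((3 - angle (axis k) z / \<eta>) / 2) = 0"
    using assms \<eta>_pos by (intro clamp01_simps) (simp add: field_simps)
  moreover have "0 \<le> clamp01 ((angle (axis k) z / \<eta> - 5) / 2)" by (simp add: clamp01_def)
  ultimately show ?thesis by (simp only: belt_X_def max.absorb2)
qed

lemma belt_X_M:
  "angle (axis k) z \<le> \<eta> \<Longrightarrow> belt_X k z = 1"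
  "3 * \<eta> \<le> angle (axis k) z \<Longrightarrow> angle (axis k) z \<le> 5 * \<eta> \<Longrightarrow> belt_X k z = 0"
  "7 * \<eta> \<le> angle (axis k) z \<Longrightarrow> belt_X k z = 1"
proof -
  show "belt_X k z = 1" if "angle (axis k) z \<le> \<eta>"
    using that \<eta>_pos by (subst belt_X_low) (auto simp: clamp01_simps field_simps)
  show "belt_X k z = 0" if "3 * \<eta> \<le> angle (axis k) z" "angle (axis k) z \<le> 5 * \<eta>"
    using that \<eta>_pos by (subst belt_X_low) (auto simp: clamp01_simps field_simps)
  show "belt_X k z = 1" if "7 * \<eta> \<le> angle (axis k) z"
    using that \<eta>_pos by (subst belt_X_high) (auto simp: clamp01_simps field_simps)
qed

lemma belt_X_N1:
  assumes "\<eta> \<le> angle (axis k) z" "angle (axis k) z \<le> 3 * \<eta>"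
  shows "angle (axis k) z = (3 - 2 * belt_X k z) * \<eta>"
proof -
  have "clamp01 ((3 - angle (axis k) z / \<eta>) / 2) = (3 - angle (axis k) z / \<eta>) / 2"
    using assms \<eta>_pos by (intro clamp01_simps) (auto simp: field_simps)
  then have "belt_X k z = (3 - angle (axis k) z / \<eta>) / 2"
    using assms \<eta>_pos by (subst belt_X_low) auto
  then show ?thesis using \<eta>_pos by (simp add: field_simps)
qed

lemma belt_X_N2:
  assumes "5 * \<eta> \<le> angle (axis k) z" "angle (axis k) z \<le> 7 * \<eta>"
  shows "angle (axis k) z = (5 + 2 * belt_X k z) * \<eta>"
proof -
  have "clamp01 ((angle (axis k) z / \<eta> - 5) / 2) = (angle (axis k) z / \<eta> - 5) / 2"
    using assms \<eta>_pos by (intro clamp01_simps) (auto simp: field_simps)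
  then have "belt_X k z = (angle (axis k) z / \<eta> - 5) / 2"
    using assms \<eta>_pos by (subst belt_X_high) auto
  then show ?thesis using \<eta>_pos by (simp add: field_simps)
qed

lemma belt_X_angle:
  assumes "t \<in> {0..1}"
  shows "angle (axis k) z = (1 + 2 * t) * \<eta> \<Longrightarrow> belt_X k z = 1 - t"
    and "angle (axis k) z = (7 - 2 * t) * \<eta> \<Longrightarrow> belt_X k z = 1 - t"
proof -
  have b: "\<eta> \<le> (1 + 2 * t) * \<eta>" "(1 + 2 * t) * \<eta> \<le> 3 * \<eta>" "5 * \<eta> \<le> (7 - 2 * t) * \<eta>" "(7 - 2 * t) * \<eta> \<le> 7 * \<eta>"
    using assms \<eta>_pos by auto
  show "belt_X k z = 1 - t" if a: "angle (axis k) z = (1 + 2 * t) * \<eta>"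
  proof -
    have "(1 + 2 * t) * \<eta> = (3 - 2 * belt_X k z) * \<eta>"
      using belt_X_N1[of k z] b unfolding a by blast
    then show ?thesis using \<eta>_pos by simp
  qed
  show "belt_X k z = 1 - t" if a: "angle (axis k) z = (7 - 2 * t) * \<eta>"
  proof -
    have "(7 - 2 * t) * \<eta> = (5 + 2 * belt_X k z) * \<eta>"
      using belt_X_N2[of k z] b unfolding a by blast
    then show ?thesis using \<eta>_pos by simp
  qed
qed

text \<open>In units of \<eta> from the axis, handle \<open>Suc i\<close> occupies
  \<open>[-1, 7]\<close> and handle \<open>i\<close> occupies \<open>[-9, -1]\<close>; the remaining
  sides have angle at least \<open>7 * \<eta>\<close>. Thus the belt crosses the second pair of each
  of the two handles and separates the first pair of each.\<close>

lemma belt_pairs: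
  assumes k: "Suc i < g" "k = 4 * i + 4"
    and j: "i' < g" "j = 4 * i' \<or> j = 4 * i' + 1" and t: "t \<in> {0..1}"
  shows "j = k + 1 \<and> angle (axis k) (side j t) = (1 + 2 * t) * \<eta> \<and>
      angle (axis k) (side (j + 2) (1 - t)) = (7 - 2 * t) * \<eta> \<and>
      offset (axis k) (side j t) = 1 \<and> offset (axis k) (side (j + 2) (1 - t)) = 1 \<or>
    j + 3 = k \<and> angle (axis k) (side j t) = (7 - 2 * t) * \<eta> \<and>
      angle (axis k) (side (j + 2) (1 - t)) = (1 + 2 * t) * \<eta> \<and>
      offset (axis k) (side j t) = - 1 \<and> offset (axis k) (side (j + 2) (1 - t)) = - 1 \<or>
    j = k \<and> angle (axis k) (side j t) \<le> \<eta> \<and>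
      3 * \<eta> \<le> angle (axis k) (side (j + 2) (1 - t)) \<and> angle (axis k) (side (j + 2) (1 - t)) \<le> 5 * \<eta> \<or>
    j + 4 = k \<and> 7 * \<eta> \<le> angle (axis k) (side j t) \<and>
      3 * \<eta> \<le> angle (axis k) (side (j + 2) (1 - t)) \<and> angle (axis k) (side (j + 2) (1 - t)) \<le> 5 * \<eta> \<or>
    j \<noteq> k + 1 \<and> j + 3 \<noteq> k \<and> j \<noteq> k \<and> j + 4 \<noteq> k \<and>
      7 * \<eta> \<le> angle (axis k) (side j t) \<and> 7 * \<eta> \<le> angle (axis k) (side (j + 2) (1 - t))"
proof -
  define \<delta> where "\<delta> = 2 * (real j + t - real k) - 1"
  define \<delta>' where "\<delta>' = 2 * (real (j + 2) + (1 - t) - real k) - 1"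
  have g2: "2 \<le> real g" using k by simp
  note ang = angle_side[OF \<delta>_def] angle_side[OF \<delta>'_def]
  note off = offset_side[OF \<delta>_def] offset_side[OF \<delta>'_def]
  consider (A) "j = k + 1" | (B) "j + 3 = k" | (C) "j = k" | (D) "j + 4 = k"
    | (later) "j \<ge> k + 4" | (before) "j + 7 \<le> k"
  proof -
    have "j = k + 1 \<or> j + 3 = k \<or> j = k \<or> j + 4 = k \<or> j \<ge> k + 4 \<or> j + 7 \<le> k"
    proof (cases "i' \<le> i")
      case True
      then show ?thesis using k(2) j(2) by (cases "i' = i") auto
    next
      case False
      then have "i' = Suc i \<or> i + 2 \<le> i'" by linarith
      then show ?thesis using k(2) j(2) by (elim disjE) auto
    qed
    then show thesis using that by blast
  qed
  then show ?thesis
  proof cases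
    case A
    then have "real j = real k + 1" by simp
    then have d: "\<delta> = 1 + 2 * t" "\<delta>' = 7 - 2 * t" by (simp_all add: \<delta>_def \<delta>'_def)
    have b: "\<bar>\<delta>\<bar> \<le> 4 * real g" "\<bar>\<delta>'\<bar> \<le> 4 * real g" "0 < \<delta>" "\<delta> < 4 * real g" "0 < \<delta>'"
      "\<delta>' < 4 * real g" and e: "\<bar>\<delta>\<bar> = 1 + 2 * t" "\<bar>\<delta>'\<bar> = 7 - 2 * t"
      using d t g2 by auto
    show ?thesis
      using A ang(1)[OF b(1)] ang(4)[OF b(2)] off(1)[OF b(3,4)] off(3)[OF b(5,6)] unfolding e by simp
  next
    case B
    then have "real k = real j + 3" by simp
    then have d: "\<delta> = 2 * t - 7" "\<delta>' = - 1 - 2 * t" by (simp_all add: \<delta>_def \<delta>'_def)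
    have b: "\<bar>\<delta>\<bar> \<le> 4 * real g" "\<bar>\<delta>'\<bar> \<le> 4 * real g" "\<delta> < 0" "- 4 * real g < \<delta>" "\<delta>' < 0"
      "- 4 * real g < \<delta>'" and e: "\<bar>\<delta>\<bar> = 7 - 2 * t" "\<bar>\<delta>'\<bar> = 1 + 2 * t"
      using d t g2 by auto
    show ?thesis
      using B ang(1)[OF b(1)] ang(4)[OF b(2)] off(2)[OF b(3,4)] off(4)[OF b(5,6)] unfolding e by simp
  next
    case C
    then have b: "\<bar>\<delta>\<bar> \<le> 1" "1 \<le> 4 * real g" "3 \<le> \<bar>\<delta>'\<bar>" "\<bar>\<delta>'\<bar> \<le> 8 * real g - 3"
      "\<bar>\<delta>'\<bar> \<le> 5" "5 \<le> 4 * real g"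
      using t g2 by (auto simp: \<delta>_def \<delta>'_def)
    show ?thesis using ang(2)[OF b(1,2)] ang(6)[OF _ b(3,4)] ang(5)[OF b(5,6)] C by simp
  next
    case D
    then have "real k = real j + 4" by auto
    then have b: "7 \<le> \<bar>\<delta>\<bar>" "\<bar>\<delta>\<bar> \<le> 8 * real g - 7" "3 \<le> \<bar>\<delta>'\<bar>" "\<bar>\<delta>'\<bar> \<le> 8 * real g - 3"
      "\<bar>\<delta>'\<bar> \<le> 5" "5 \<le> 4 * real g"
      using t g2 by (auto simp: \<delta>_def \<delta>'_def)
    show ?thesis using ang(3)[OF _ b(1,2)] ang(6)[OF _ b(3,4)] ang(5)[OF b(5,6)] D by simp
  next
    case later
    have "j + 3 \<le> 4 * g" using j by linarith
    then have "real j + 3 \<le> 4 * real g" by linarith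
    moreover have "real k + 4 \<le> real j" "4 \<le> real k"
      using later k by linarith+
    ultimately have b: "7 \<le> \<bar>\<delta>\<bar>" "\<bar>\<delta>\<bar> \<le> 8 * real g - 7" "7 \<le> \<bar>\<delta>'\<bar>" "\<bar>\<delta>'\<bar> \<le> 8 * real g - 7"
      using t by (auto simp: \<delta>_def \<delta>'_def)
    have "j \<noteq> k + 1" "j + 3 \<noteq> k" "j \<noteq> k" "j + 4 \<noteq> k" using later by linarith+
    then show ?thesis using ang(3)[OF _ b(1,2)] ang(6)[OF _ b(3,4)] by simp
  next
    case before
    have "k + 4 \<le> 4 * g" using k by linarith
    then have "real j + 7 \<le> real k" "real k + 4 \<le> 4 * real g"
      using before by linarith+
    then have b: "7 \<le> \<bar>\<delta>\<bar>" "\<bar>\<delta>\<bar> \<le> 8 * real g - 7" "7 \<le> \<bar>\<delta>'\<bar>" "\<bar>\<delta>'\<bar> \<le> 8 * real g - 7"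
      using t by (auto simp: \<delta>_def \<delta>'_def)
    have "j \<noteq> k + 1" "j + 3 \<noteq> k" "j \<noteq> k" "j + 4 \<noteq> k" using before by linarith+
    then show ?thesis using ang(3)[OF _ b(1,2)] ang(6)[OF _ b(3,4)] by simp
  qed
qed

lemma annulus_belt:
  assumes k: "Suc i < g" "k = 4 * i + 4"
  defines "B \<equiv> \<lambda>l h. band (axis k) (l * \<eta>) (h * \<eta>)"
  shows "annulus g S q (B 1 3 \<union> B 5 7) (B 0 1 \<union> B 3 5 \<union> B 7 (4 * real g))
    (belt_X k) (belt_Y k) (belt_P k) {B 0 1, B 1 3, B 3 5, B 5 7, B 7 (4 * real g)}"
proof -
  let ?m = "axis k"
  let ?N = "B 1 3 \<union> B 5 7"
  let ?M = "B 0 1 \<union> B 3 5 \<union> B 7 (4 * real g)"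
  have g2: "2 \<le> real g" using k by simp
  have pi7: "7 * \<eta> < pi" using \<eta>_less_pi[of 7] g2 by simp
  have BD: "B l h \<subseteq> cball 0 1" for l h by (auto simp: B_def band_def)
  have inB: "z \<in> B l h \<longleftrightarrow> z \<in> cball 0 1 \<and> l * \<eta> \<le> angle ?m z \<and> angle ?m z \<le> h * \<eta>" for z l h
    by (auto simp: B_def band_def)
  have closedB: "closed (B l h)" and convexB: "convex (B l h)"
    if "0 \<le> l" "l \<le> 4 * real g" "0 \<le> h" "h \<le> 4 * real g" for l h
    using that \<eta>_pos \<eta>_le_pi by (auto simp: B_def intro!: closed_band convex_band)
  have ang0: "0 * \<eta> \<le> angle ?m z" "angle ?m z \<le> 4 * real g * \<eta>" if "z \<in> cball 0 1" for z
    using angle_bounds[of ?m, OF norm_axis that] unfolding \<eta>_pi by auto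
  have ND: "?N \<subseteq> cball 0 1" using BD by blast
  have N_sin: "sin (angle ?m z) \<noteq> 0" if "z \<in> ?N" for z
  proof -
    have "0 < angle ?m z" "angle ?m z < pi" using that \<eta>_pos pi7 by (auto simp: inB)
    then show ?thesis using sin_gt_zero by force
  qed
  have cover: "B 0 1 \<union> B 1 3 \<union> B 3 5 \<union> B 5 7 \<union> B 7 (4 * real g) = cball 0 1"
    using ang0 BD by (auto simp: inB)
  have a1: "0 < (3 - 2 * x) * \<eta>" "(3 - 2 * x) * \<eta> < pi" "1 * \<eta> \<le> (3 - 2 * x) * \<eta>" "(3 - 2 * x) * \<eta> \<le> 3 * \<eta>"
    "(3 - 2 * x) * \<eta> \<le> 4 * \<eta>"
    and a2: "0 < (5 + 2 * x) * \<eta>" "(5 + 2 * x) * \<eta> < pi" "5 * \<eta> \<le> (5 + 2 * x) * \<eta>" "(5 + 2 * x) * \<eta> \<le> 7 * \<eta>"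
    "4 * \<eta> < (5 + 2 * x) * \<eta>"
    if "x \<in> {0..1}" for x
    using that \<eta>_pos \<eta>_less_pi[of "3 - 2 * x"] \<eta>_less_pi[of "5 + 2 * x"] g2
    by (auto simp: mult_less_cancel_right)
  have chord1: "chord ?m ((3 - 2 * x) * \<eta>) \<sigma> \<in> B 1 3 \<and> belt_X k (chord ?m ((3 - 2 * x) * \<eta>) \<sigma>) = x \<and>
      belt_Y k (chord ?m ((3 - 2 * x) * \<eta>) \<sigma>) = (1 + \<sigma>) / 4"
    if x: "x \<in> {0..1}" and \<sigma>: "\<sigma> \<in> {-1..1}" for x \<sigma>
  proof -
    let ?z = "chord ?m ((3 - 2 * x) * \<eta>) \<sigma>"
    have ang: "angle ?m ?z = (3 - 2 * x) * \<eta>"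
      using a1[OF x] by (intro angle_chord) auto
    have N: "?z \<in> B 1 3"
      using chord_in_ball[of ?m \<sigma>] a1[OF x] \<sigma> by (auto simp: inB ang)
    have "(3 - 2 * x) * \<eta> = (3 - 2 * belt_X k ?z) * \<eta>"
      using belt_X_N1[of k ?z] a1[OF x] unfolding ang by simp
    then have "belt_X k ?z = x" using \<eta>_pos by simp
    moreover have "belt_Y k ?z = (1 + \<sigma>) / 4"
      unfolding belt_Y_def ang using a1[OF x] by (simp add: offset_chord)
    ultimately show ?thesis using N by blast
  qed
  have chord2: "chord ?m ((5 + 2 * x) * \<eta>) \<sigma> \<in> B 5 7 \<and> belt_X k (chord ?m ((5 + 2 * x) * \<eta>) \<sigma>) = x \<and>
      belt_Y k (chord ?m ((5 + 2 * x) * \<eta>) \<sigma>) = (3 - \<sigma>) / 4"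
    if x: "x \<in> {0..1}" and \<sigma>: "\<sigma> \<in> {-1..1}" for x \<sigma>
  proof -
    let ?z = "chord ?m ((5 + 2 * x) * \<eta>) \<sigma>"
    have ang: "angle ?m ?z = (5 + 2 * x) * \<eta>"
      using a2[OF x] by (intro angle_chord) auto
    have N: "?z \<in> B 5 7"
      using chord_in_ball[of ?m \<sigma>] a2[OF x] \<sigma> by (auto simp: inB ang)
    have "(5 + 2 * x) * \<eta> = (5 + 2 * belt_X k ?z) * \<eta>"
      using belt_X_N2[of k ?z] a2[OF x] unfolding ang by simp
    then have "belt_X k ?z = x" using \<eta>_pos by simp
    moreover have "belt_Y k ?z = (3 - \<sigma>) / 4"
      unfolding belt_Y_def ang using a2[OF x] by (simp add: offset_chord)
    ultimately show ?thesis using N by blast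
  qed
  have inter: "\<exists>z\<in>?N. belt_X k z = x \<and> belt_Y k z = s \<and> belt_Q k (x, s) = q z"
    if x: "x \<in> {0..1}" and s: "s \<in> {0..1}" for x s
  proof (cases "s \<le> 1/2")
    case True
    then have "4 * s - 1 \<in> {-1..1}" using s by auto
    from chord1[OF x this] show ?thesis
      using True by (intro bexI[of _ "chord ?m ((3 - 2 * x) * \<eta>) (4 * s - 1)"]) (auto simp: belt_Q_def)
  next
    case False
    then have "3 - 4 * s \<in> {-1..1}" using s by auto
    from chord2[OF x this] show ?thesis
      using False by (intro bexI[of _ "chord ?m ((5 + 2 * x) * \<eta>) (3 - 4 * s)"]) (auto simp: belt_Q_def)
  qed
  have frac01: "frac s \<in> {0..1}" for s :: real using frac_lt_1[of s] by (simp add: less_imp_le)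
  show ?thesis
  proof unfold_locales
    show "?N \<union> ?M = cball 0 1" using cover by blast
    show "closed ?N" "closed ?M"
      by (intro closed_Un closedB; use g2 in simp)+
    show "continuous_on (cball 0 1) (belt_X k)"
      unfolding belt_X_def using \<eta>_pos by (intro continuous_intros continuous_on_angle) auto
    show "continuous_on ?N (belt_Y k)"
    proof (rule continuous_on_closed_Un)
      show "closed (B 1 3)" "closed (B 5 7)" using g2 by (auto intro!: closedB)
      have "continuous_on (B 1 3) (\<lambda>z. (1 + offset ?m z) / 4)"
        by (intro continuous_intros continuous_on_offset BD N_sin) auto
      then show "continuous_on (B 1 3) (belt_Y k)"
        by (rule continuous_on_cong[THEN iffD1, rotated 2]) (use \<eta>_pos in \<open>auto simp: belt_Y_def inB\<close>)
      have "continuous_on (B 5 7) (\<lambda>z. (3 - offset ?m z) / 4)"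
        by (intro continuous_intros continuous_on_offset BD N_sin) auto
      then show "continuous_on (B 5 7) (belt_Y k)"
        by (rule continuous_on_cong[THEN iffD1, rotated 2]) (use \<eta>_pos in \<open>auto simp: belt_Y_def inB\<close>)
    qed
    show "belt_X k z \<in> {0..1}" for z
      unfolding belt_X_def using clamp01_range by (auto simp: max_def)
    show "belt_X k z = 0 \<or> belt_X k z = 1" if "z \<in> ?M" for z
      using that belt_X_M[of k z] by (auto simp: inB)
    have "continuous_on ({0..1} \<times> {0..1}) (\<lambda>y. if snd y \<le> 1/2
        then q (chord ?m ((3 - 2 * fst y) * \<eta>) (4 * snd y - 1))
        else q (chord ?m ((5 + 2 * fst y) * \<eta>) (3 - 4 * snd y)))"
    proof (rule continuous_on_cases_le)
      show "continuous_on {t \<in> {0..1} \<times> {0..1}. snd t \<le> 1/2}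
          (\<lambda>y. q (chord ?m ((3 - 2 * fst y) * \<eta>) (4 * snd y - 1)))"
      proof (rule continuous_on_compose2[OF q_continuous])
        show "(\<lambda>y. chord ?m ((3 - 2 * fst y) * \<eta>) (4 * snd y - 1)) ` {t \<in> {0..1} \<times> {0..1}. snd t \<le> 1/2}
          \<subseteq> cball 0 1"
          by (intro image_subsetI chord_in_ball) auto
      qed (auto intro!: continuous_intros)
      show "continuous_on {t \<in> {0..1} \<times> {0..1}. 1/2 \<le> snd t}
          (\<lambda>y. q (chord ?m ((5 + 2 * fst y) * \<eta>) (3 - 4 * snd y)))"
      proof (rule continuous_on_compose2[OF q_continuous])
        show "(\<lambda>y. chord ?m ((5 + 2 * fst y) * \<eta>) (3 - 4 * snd y)) ` {t \<in> {0..1} \<times> {0..1}. 1/2 \<le> snd t}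
          \<subseteq> cball 0 1"
          by (intro image_subsetI chord_in_ball) auto
      qed (auto intro!: continuous_intros)
      show "continuous_on ({0..1} \<times> {0..1}) (snd :: real \<times> real \<Rightarrow> real)"
        by (intro continuous_intros)
      fix y :: "real \<times> real" assume y: "y \<in> {0..1} \<times> {0..1}" "snd y = 1/2"
      then have x: "fst y \<in> {0..1}" and s: "4 * snd y - 1 = 1" "3 - 4 * snd y = 1" by auto
      show "q (chord ?m ((3 - 2 * fst y) * \<eta>) (4 * snd y - 1)) =
          q (chord ?m ((5 + 2 * fst y) * \<eta>) (3 - 4 * snd y))"
        unfolding s by (rule belt_glue(1)[OF k x])
    qed
    then have "continuous_on ({0..1} \<times> {0..1}) (belt_Q k)"
      by (simp add: belt_Q_def case_prod_beta)
    then show "continuous_on ({0..1} \<times> UNIV) (belt_P k)"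
      unfolding belt_P_def using belt_Q_closed[OF k]
      by (intro continuous_on_periodic_extension) auto
    show "belt_P k ` ({0..1} \<times> UNIV) \<subseteq> S"
    proof clarify
      fix x s :: real assume "x \<in> {0..1}"
      from inter[OF this frac01] obtain z where "z \<in> ?N" "belt_Q k (x, frac s) = q z" by blast
      then show "belt_P k (x, s) \<in> S" using ND q_in by (auto simp: belt_P_def)
    qed
    show "belt_P k (x, s + 1) = belt_P k (x, s)" for x s
      by (simp add: belt_P_def frac_1_eq)
    show "belt_P k (belt_X k z, belt_Y k z) = q z" if z: "z \<in> ?N" for z
    proof -
      have zD: "z \<in> cball 0 1" using z ND by blast
      have off: "offset ?m z \<in> {-1..1}" using zD by (intro offset_bounds) auto
      have Y: "belt_Y k z \<in> {0..1}" using off by (auto simp: belt_Y_def)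
      have X: "belt_X k z \<in> {0..1}"
        unfolding belt_X_def using clamp01_range by (auto simp: max_def)
      have zz: "chord ?m (angle ?m z) (offset ?m z) = z"
        using zD N_sin[OF z] by (intro chord_angle_offset) auto
      have "belt_P k (belt_X k z, belt_Y k z) = belt_Q k (belt_X k z, belt_Y k z)"
        unfolding belt_P_def prod.case
        by (rule periodic_extension_eq[OF Y belt_Q_closed[OF k X]])
      also have "\<dots> = q (chord ?m (angle ?m z) (offset ?m z))"
        using z
      proof
        assume "z \<in> B 1 3"
        then have a: "\<eta> \<le> angle ?m z" "angle ?m z \<le> 3 * \<eta>" by (auto simp: inB)
        then have y: "belt_Y k z = (1 + offset ?m z) / 4" using \<eta>_pos by (simp add: belt_Y_def)
        then have "belt_Y k z \<le> 1/2" "4 * belt_Y k z - 1 = offset ?m z" using off by auto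
        then show ?thesis using belt_X_N1[OF a] by (simp add: belt_Q_def)
      next
        assume "z \<in> B 5 7"
        then have a: "5 * \<eta> \<le> angle ?m z" "angle ?m z \<le> 7 * \<eta>" by (auto simp: inB)
        then have y: "belt_Y k z = (3 - offset ?m z) / 4" using \<eta>_pos by (simp add: belt_Y_def)
        then have y': "3 - 4 * belt_Y k z = offset ?m z" by simp
        show ?thesis
        proof (cases "offset ?m z = 1")
          case True
          \<comment> \<open>At offset 1 the longitudinal coordinate is exactly 1/2, where
            \<open>belt_Q\<close> uses the other chord; the ends of the two chords are
            glued.\<close>
          then have Y2: "belt_Y k z \<le> 1/2" "4 * belt_Y k z - 1 = 1" using y by auto
          have "belt_Q k (belt_X k z, belt_Y k z) =
              q (chord ?m ((3 - 2 * belt_X k z) * \<eta>) (4 * belt_Y k z - 1))"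
            using Y2(1) by (simp add: belt_Q_def)
          also have "\<dots> = q (chord ?m ((5 + 2 * belt_X k z) * \<eta>) 1)"
            unfolding Y2(2) by (rule belt_glue(1)[OF k X])
          finally show ?thesis using belt_X_N2[OF a] True by simp
        next
          case False
          then have "\<not> belt_Y k z \<le> 1/2" using y off by auto
          then show ?thesis using belt_X_N2[OF a] y' by (simp add: belt_Q_def)
        qed
      qed
      finally show ?thesis unfolding zz .
    qed
    show "\<exists>z\<in>?N. belt_X k z = x \<and> belt_Y k z - s \<in> \<int>" if x: "x \<in> {0..1}" for x s
    proof -
      from inter[OF x frac01[of s]] obtain z where "z \<in> ?N" "belt_X k z = x" "belt_Y k z = frac s"
        by blast
      then show ?thesis by (auto simp: frac_def)
    qed
    show "side j t \<in> ?M \<and> side (j + 2) (1 - t) \<in> ?M \<or>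
       side j t \<in> ?N \<and> side (j + 2) (1 - t) \<in> ?N \<and>
       belt_X k (side j t) = belt_X k (side (j + 2) (1 - t)) \<and>
       belt_Y k (side j t) - belt_Y k (side (j + 2) (1 - t)) \<in> \<int>"
      if j: "i' < g" "j = 4 * i' \<or> j = 4 * i' + 1" "t \<in> {0..1}" for i' j t
    proof -
      let ?z = "side j t" and ?w = "side (j + 2) (1 - t)"
      have b: "0 * \<eta> \<le> angle ?m (side j t)" "angle ?m (side j t) \<le> 4 * real g * \<eta>" for j t
        using ang0 side_in_disc by blast+
      have c: "1 * \<eta> \<le> (1 + 2 * t) * \<eta>" "(1 + 2 * t) * \<eta> \<le> 3 * \<eta>" "5 * \<eta> \<le> (7 - 2 * t) * \<eta>"
        "(7 - 2 * t) * \<eta> \<le> 7 * \<eta>" "(1 + 2 * t) * \<eta> \<le> 4 * \<eta>" "\<not> (7 - 2 * t) * \<eta> \<le> 4 * \<eta>"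
        using j(3) \<eta>_pos by (auto simp: mult_le_cancel_right)
      from belt_pairs[OF k j] show ?thesis
      proof (elim disjE conjE)
        assume *: "angle ?m ?z = (1 + 2 * t) * \<eta>" "angle ?m ?w = (7 - 2 * t) * \<eta>"
          "offset ?m ?z = 1" "offset ?m ?w = 1"
        have "?z \<in> B 1 3" "?w \<in> B 5 7" using * c side_in_disc by (auto simp: inB)
        moreover have Y: "belt_Y k ?z = 1/2" "belt_Y k ?w = 1/2" using * c by (simp_all add: belt_Y_def)
        have "belt_Y k ?z - belt_Y k ?w \<in> \<int>" unfolding Y by simp
        moreover have "belt_X k ?z = belt_X k ?w"
          using belt_X_angle(1)[OF j(3) *(1)] belt_X_angle(2)[OF j(3) *(2)] by simp
        ultimately show ?thesis by blast
      next
        assume *: "angle ?m ?z = (7 - 2 * t) * \<eta>" "angle ?m ?w = (1 + 2 * t) * \<eta>"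
          "offset ?m ?z = - 1" "offset ?m ?w = - 1"
        have "?z \<in> B 5 7" "?w \<in> B 1 3" using * c side_in_disc by (auto simp: inB)
        \<comment> \<open>At the lower ends the curve closes up, so the coordinates differ by a full
          period instead of being equal.\<close>
        moreover have Y: "belt_Y k ?z = 1" "belt_Y k ?w = 0" using * c by (simp_all add: belt_Y_def)
        have "belt_Y k ?z - belt_Y k ?w \<in> \<int>" unfolding Y by simp
        moreover have "belt_X k ?z = belt_X k ?w"
          using belt_X_angle(2)[OF j(3) *(1)] belt_X_angle(1)[OF j(3) *(2)] by simp
        ultimately show ?thesis by blast
      next
        assume "angle ?m ?z \<le> \<eta>" "3 * \<eta> \<le> angle ?m ?w" "angle ?m ?w \<le> 5 * \<eta>"
        then have "?z \<in> B 0 1" "?w \<in> B 3 5" using b side_in_disc by (auto simp: inB)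
        then show ?thesis by blast
      next
        assume "7 * \<eta> \<le> angle ?m ?z" "3 * \<eta> \<le> angle ?m ?w" "angle ?m ?w \<le> 5 * \<eta>"
        then have "?z \<in> B 7 (4 * real g)" "?w \<in> B 3 5" using b side_in_disc by (auto simp: inB)
        then show ?thesis by blast
      next
        assume "7 * \<eta> \<le> angle ?m ?z" "7 * \<eta> \<le> angle ?m ?w"
        then have "?z \<in> B 7 (4 * real g)" "?w \<in> B 7 (4 * real g)" using b side_in_disc by (auto simp: inB)
        then show ?thesis by blast
      qed
    qed
    show "finite {B 0 1, B 1 3, B 3 5, B 5 7, B 7 (4 * real g)}" by simp
    show "\<Union>{B 0 1, B 1 3, B 3 5, B 5 7, B 7 (4 * real g)} = cball 0 1" using cover by auto
    fix b assume b: "b \<in> {B 0 1, B 1 3, B 3 5, B 5 7, B 7 (4 * real g)}"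
    then show "closed b" "convex b" using g2 by (auto intro!: closedB convexB)
    have "belt_X k constant_on B 0 1" "belt_X k constant_on B 3 5" "belt_X k constant_on B 7 (4 * real g)"
      using belt_X_M[of k] by (auto simp: constant_on_def inB)
    then show "b \<subseteq> ?N \<or> b \<subseteq> ?M \<and> belt_X k constant_on b"
      using b by auto
  qed
qed

section \<open>Effect of the twists on holonomies, and dual characters\<close>

lemma strip_X_midpoint:
  assumes k: "i < g" "k = 4 * i + 1 \<or> k = 4 * i + 2"
    and j: "i' < g" "j = 4 * i' \<or> j = 4 * i' + 1"
  shows "j = k \<Longrightarrow> strip_X k (side j (1/2)) = 1 \<and> strip_X k (side (j + 2) (1/2)) = 0"
    and "j + 2 = k \<Longrightarrow> strip_X k (side j (1/2)) = 0 \<and> strip_X k (side (j + 2) (1/2)) = 1"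
    and "j \<noteq> k \<Longrightarrow> j + 2 \<noteq> k \<Longrightarrow> strip_X k (side j (1/2)) = strip_X k (side (j + 2) (1/2))"
proof -
  have t: "(1/2 :: real) \<in> {0..1}" and h: "1 - 1/2 = (1/2 :: real)" by simp_all
  note p = strip_pairs[OF k j t, unfolded h]
  show "strip_X k (side j (1/2)) = 1 \<and> strip_X k (side (j + 2) (1/2)) = 0" if "j = k"
    using p that k by (elim disjE conjE) (auto simp: strip_X_M simp del: One_nat_def)
  show "strip_X k (side j (1/2)) = 0 \<and> strip_X k (side (j + 2) (1/2)) = 1" if "j + 2 = k"
    using p that k by (elim disjE conjE) (auto simp: strip_X_M simp del: One_nat_def)
  show "strip_X k (side j (1/2)) = strip_X k (side (j + 2) (1/2))" if "j \<noteq> k" "j + 2 \<noteq> k"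
    using p that
  proof (elim disjE conjE)
    assume "angle (axis k) (side j (1/2)) = (3 - 2 * (1/2)) * \<eta>"
      "angle (axis k) (side (j + 2) (1/2)) = (3 - 2 * (1/2)) * \<eta>"
    then show ?thesis unfolding strip_X_def by simp
  qed (simp_all add: strip_X_M)
qed

lemma belt_X_midpoint:
  assumes k: "Suc i < g" "k = 4 * i + 4"
    and j: "i' < g" "j = 4 * i' \<or> j = 4 * i' + 1"
  shows "j = k \<or> j + 4 = k \<Longrightarrow> belt_X k (side j (1/2)) = 1 \<and> belt_X k (side (j + 2) (1/2)) = 0"
    and "j \<noteq> k \<Longrightarrow> j + 4 \<noteq> k \<Longrightarrow> belt_X k (side j (1/2)) = belt_X k (side (j + 2) (1/2))"
proof -
  have t: "(1/2 :: real) \<in> {0..1}" and h: "1 - 1/2 = (1/2 :: real)" by simp_all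
  note p = belt_pairs[OF k j t, unfolded h]
  show "belt_X k (side j (1/2)) = 1 \<and> belt_X k (side (j + 2) (1/2)) = 0" if "j = k \<or> j + 4 = k"
    using p that by (elim disjE conjE) (auto simp: belt_X_M)
  show "belt_X k (side j (1/2)) = belt_X k (side (j + 2) (1/2))" if "j \<noteq> k" "j + 4 \<noteq> k"
    using p that
  proof (elim disjE conjE)
    assume "angle (axis k) (side j (1/2)) = (1 + 2 * (1/2)) * \<eta>"
      "angle (axis k) (side (j + 2) (1/2)) = (7 - 2 * (1/2)) * \<eta>"
    then show ?thesis using belt_X_angle[OF t] by metis
  next
    assume "angle (axis k) (side j (1/2)) = (7 - 2 * (1/2)) * \<eta>"
      "angle (axis k) (side (j + 2) (1/2)) = (1 + 2 * (1/2)) * \<eta>"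
    then show ?thesis using belt_X_angle[OF t] by metis
  qed (simp_all add: belt_X_M)
qed

lemma disc_chord_path:
  assumes "z \<in> cball 0 1" "w \<in> cball 0 1"
  shows "path (q \<circ> linepath z w)" "path_image (q \<circ> linepath z w) \<subseteq> S"
  using assms by (intro path_q path_linepath; simp add: closed_segment_subset)+

text \<open>The curve at \<open>x = 1/2\<close> is the chord between the midpoints of sides
  \<open>k - 1\<close> and \<open>k + 1\<close>, run through in the direction opposite to the one
  used in \<open>holonomy\<close>.\<close>

lemma strip_core:
  assumes k: "i < g" "k = 4 * i + 1 \<or> k = 4 * i + 2" and c: "path_character S c"
  shows "c (strip_P k \<circ> linepath (1/2, 0) (1/2, 1)) = inverse (holonomy c (k - 1))"
proof -
  interpret path_character S c by (rule c)
  let ?z = "side (k - 1) (1/2)" and ?w = "side (k - 1 + 2) (1/2)"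
  have ends: "chord (axis k) (2 * \<eta>) (- 1) = ?z" "chord (axis k) (2 * \<eta>) 1 = ?w"
    using k by (auto simp: chord_1 chord_minus_1 side_axis[of _ _ k])
  have "c (q \<circ> linepath ?z ?w) = c (strip_P k \<circ> linepath (1/2, 0) (1/2, 1))"
  proof (rule cong)
    fix t :: real assume t: "t \<in> {0..1}"
    have "strip_P k (1/2, t) = strip_Q k (1/2, t)"
      unfolding strip_P_def prod.case
      by (rule periodic_extension_eq[OF t strip_Q_closed[OF k]]) simp
    also have "\<dots> = q (chord (axis k) (2 * \<eta>) (linepath (- 1) 1 t))"
      by (simp add: strip_Q_def linepath_def algebra_simps)
    also have "\<dots> = q (linepath ?z ?w t)" by (simp only: chord_linepath ends)
    finally show "(q \<circ> linepath ?z ?w) t = (strip_P k \<circ> linepath (1/2, 0) (1/2, 1)) t"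
      by (simp add: linepath_def field_simps)
  qed (intro disc_chord_path side_in_disc)+
  moreover have "c (q \<circ> linepath ?z ?w) = inverse (holonomy c (k - 1))"
    using reverse[OF disc_chord_path[OF side_in_disc side_in_disc], of "k - 1 + 2" "1/2" "k - 1" "1/2"]
    by (simp add: holonomy_def path_compose_reversepath[symmetric])
  ultimately show ?thesis by simp
qed

text \<open>The curve consists of two chords, from \<open>?a\<close> to \<open>?b\<close> and from
  \<open>?b'\<close> to \<open>?a'\<close>. Written with a potential on the disc, the product of
  their values regroups into the jumps across the two pairs of sides.\<close>

lemma belt_core:
  assumes k: "Suc i < g" "k = 4 * i + 4" and c: "path_character S c"
  shows "c (belt_P k \<circ> linepath (1/2, 0) (1/2, 1)) = holonomy c (4 * i + 1) * holonomy c (4 * i + 5)"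
proof -
  interpret path_character S c by (rule c)
  let ?a = "side (4 * i + 1 + 2) (1/2)" and ?b = "side (4 * i + 5) (1/2)"
  let ?b' = "side (4 * i + 5 + 2) (1/2)" and ?a' = "side (4 * i + 1) (1/2)"
  have ends: "chord (axis k) (2 * \<eta>) (- 1) = ?a" "chord (axis k) (2 * \<eta>) 1 = ?b"
    "chord (axis k) (6 * \<eta>) (- 1) = ?a'" "chord (axis k) (6 * \<eta>) 1 = ?b'"
    using k by (simp_all add: chord_1 chord_minus_1 side_axis[of _ _ k])
  have qb: "q ?b = q ?b'" using glue[of "Suc i" "4 * i + 5" "1/2"] k by simp
  have paths: "path (q \<circ> linepath ?a ?b)" "path_image (q \<circ> linepath ?a ?b) \<subseteq> S"
    "path (q \<circ> linepath ?b' ?a')" "path_image (q \<circ> linepath ?b' ?a') \<subseteq> S"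
    by (intro disc_chord_path side_in_disc)+
  have j: "pathfinish (q \<circ> linepath ?a ?b) = pathstart (q \<circ> linepath ?b' ?a')"
    using qb by (simp add: pathfinish_compose pathstart_compose)
  have "c ((q \<circ> linepath ?a ?b) +++ (q \<circ> linepath ?b' ?a')) =
      c (belt_P k \<circ> linepath (1/2, 0) (1/2, 1))"
  proof (rule cong)
    show "path ((q \<circ> linepath ?a ?b) +++ (q \<circ> linepath ?b' ?a'))"
      using paths j by (intro path_join_imp)
    show "path_image ((q \<circ> linepath ?a ?b) +++ (q \<circ> linepath ?b' ?a')) \<subseteq> S"
      using paths j by (simp add: path_image_join)
    fix t :: real assume t: "t \<in> {0..1}"
    have "belt_P k (1/2, t) = belt_Q k (1/2, t)"
      unfolding belt_P_def prod.case
      by (rule periodic_extension_eq[OF t belt_Q_closed[OF k]]) simp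
    also have "\<dots> = ((q \<circ> linepath ?a ?b) +++ (q \<circ> linepath ?b' ?a')) t"
    proof (cases "t \<le> 1/2")
      case True
      have "4 * t - 1 = linepath (- 1) 1 (2 * t)" by (simp add: linepath_def)
      then show ?thesis using True
        by (simp add: belt_Q_def joinpaths_def chord_linepath ends del: add_2_eq_Suc')
    next
      case False
      have "3 - 4 * t = linepath 1 (- 1) (2 * t - 1)" by (simp add: linepath_def)
      then show ?thesis using False
        by (simp add: belt_Q_def joinpaths_def chord_linepath ends del: add_2_eq_Suc')
    qed
    finally show "((q \<circ> linepath ?a ?b) +++ (q \<circ> linepath ?b' ?a')) t =
        (belt_P k \<circ> linepath (1/2, 0) (1/2, 1)) t"
      by (simp add: linepath_def field_simps)
  qed
  moreover have "c ((q \<circ> linepath ?a ?b) +++ (q \<circ> linepath ?b' ?a')) =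
      c (q \<circ> linepath ?a ?b) * c (q \<circ> linepath ?b' ?a')"
    by (rule join[OF paths j])
  moreover obtain u where u1: "\<And>z. z \<in> cball 0 1 \<Longrightarrow> cmod (u z) = 1"
    and u: "\<And>\<pi>. path \<pi> \<Longrightarrow> path_image \<pi> \<subseteq> cball 0 1 \<Longrightarrow> c (q \<circ> \<pi>) = u (pathfinish \<pi>) / u (pathstart \<pi>)"
    by (rule disc_potential[OF c]) (rule that)
  moreover have "c (q \<circ> linepath (side j s) (side j' s')) = u (side j' s') / u (side j s)" for j s j' s'
    using u[of "linepath (side j s) (side j' s')"] chord_in_disc by simp
  moreover have "u (side j s) \<noteq> 0" for j s using u1[OF side_in_disc, of j s] by auto
  ultimately show ?thesis by (simp add: holonomy_def del: add_2_eq_Suc')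
qed

text \<open>The two choices of \<open>k\<close> give the two transvections of a handle: the first
  separated pair is \<open>4 * i + 1\<close>, with core \<open>4 * i\<close>, the second is
  \<open>4 * i\<close>, with core \<open>4 * i + 1\<close>. The sides enter with opposite
  orientations, hence the opposite exponents.\<close>

theorem handle_twist:
  assumes k: "i < g" "k = 4 * i + 1 \<or> k = 4 * i + 2"
  obtains f f' where "homeomorphism S S f f'"
    and "\<And>c i' j. path_character S c \<Longrightarrow> i' < g \<Longrightarrow> j = 4 * i' \<or> j = 4 * i' + 1 \<Longrightarrow>
      holonomy (\<lambda>p. c (f \<circ> p)) j = holonomy c j *
        (if j = k then inverse (holonomy c (k - 1)) else if j + 2 = k then holonomy c (k - 1) else 1)"
proof -
  interpret T: annulus g S q "band (axis k) \<eta> (3 * \<eta>)" "band (axis k) 0 \<eta> \<union> band (axis k) (3 * \<eta>) pi"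
    "strip_X k" "strip_Y k" "strip_P k"
    "{band (axis k) 0 \<eta>, band (axis k) \<eta> (3 * \<eta>), band (axis k) (3 * \<eta>) pi}"
    by (rule annulus_strip[OF k])
  show ?thesis
  proof (rule that[OF T.homeomorphism_twist])
    fix c i' j assume c: "path_character S c" and j: "i' < g" "j = 4 * i' \<or> j = 4 * i' + 1"
    obtain \<tau> where \<tau>: "\<And>x. x \<in> {0..1} \<Longrightarrow> \<tau> = c (strip_P k \<circ> linepath (x, 0) (x, 1))"
      and holonomy: "\<And>i j. i < g \<Longrightarrow> j = 4 * i \<or> j = 4 * i + 1 \<Longrightarrow>
        holonomy (\<lambda>p. c (T.twist 1 \<circ> p)) j = holonomy c j *
          (if strip_X k (side j (1/2)) = strip_X k (side (j + 2) (1/2)) then 1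
           else if strip_X k (side j (1/2)) = 1 then \<tau> else inverse \<tau>)"
      by (rule T.holonomy_twist_pair[OF c]) (rule that)
    have \<tau>': "\<tau> = inverse (holonomy c (k - 1))"
      using \<tau>[of "1/2"] strip_core[OF k c] by simp
    note X = strip_X_midpoint[OF k j]
    show "holonomy (\<lambda>p. c (T.twist 1 \<circ> p)) j = holonomy c j *
        (if j = k then inverse (holonomy c (k - 1)) else if j + 2 = k then holonomy c (k - 1) else 1)"
      unfolding holonomy[OF j] \<tau>' using X by (cases "j = k"; cases "j + 2 = k") auto
  qed
qed

text \<open>The transvection along the sum of the second generators of two neighbouring
  handles.\<close>

theorem belt_twist:
  assumes k: "Suc i < g"
  obtains f f' where "homeomorphism S S f f'"
    and "\<And>c i' j. path_character S c \<Longrightarrow> i' < g \<Longrightarrow> j = 4 * i' \<or> j = 4 * i' + 1 \<Longrightarrow>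
      holonomy (\<lambda>p. c (f \<circ> p)) j = holonomy c j *
        (if j = 4 * i \<or> j = 4 * i + 4 then holonomy c (4 * i + 1) * holonomy c (4 * i + 5) else 1)"
proof -
  define k where "k = 4 * i + 4"
  note k = assms k_def
  define B where "B l h = band (axis k) (l * \<eta>) (h * \<eta>)" for l h
  interpret T: annulus g S q "B 1 3 \<union> B 5 7" "B 0 1 \<union> B 3 5 \<union> B 7 (4 * real g)"
    "belt_X k" "belt_Y k" "belt_P k" "{B 0 1, B 1 3, B 3 5, B 5 7, B 7 (4 * real g)}"
    unfolding B_def by (rule annulus_belt[OF k])
  show ?thesis
  proof (rule that[OF T.homeomorphism_twist])
    fix c i' j assume c: "path_character S c" and j: "i' < g" "j = 4 * i' \<or> j = 4 * i' + 1"
    obtain \<tau> where \<tau>: "\<And>x. x \<in> {0..1} \<Longrightarrow> \<tau> = c (belt_P k \<circ> linepath (x, 0) (x, 1))"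
      and holonomy: "\<And>i j. i < g \<Longrightarrow> j = 4 * i \<or> j = 4 * i + 1 \<Longrightarrow>
        holonomy (\<lambda>p. c (T.twist 1 \<circ> p)) j = holonomy c j *
          (if belt_X k (side j (1/2)) = belt_X k (side (j + 2) (1/2)) then 1
           else if belt_X k (side j (1/2)) = 1 then \<tau> else inverse \<tau>)"
      by (rule T.holonomy_twist_pair[OF c]) (rule that)
    have \<tau>': "\<tau> = holonomy c (4 * i + 1) * holonomy c (4 * i + 5)"
      using \<tau>[of "1/2"] belt_core[OF k c] by simp
    note X = belt_X_midpoint[OF k j]
    show "holonomy (\<lambda>p. c (T.twist 1 \<circ> p)) j = holonomy c j *
        (if j = 4 * i \<or> j = 4 * i + 4 then holonomy c (4 * i + 1) * holonomy c (4 * i + 5) else 1)"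
      unfolding holonomy[OF j] \<tau>' using X unfolding k_def by (cases "j = 4 * i \<or> j = 4 * i + 4") auto
  qed
qed

text \<open>A strip separates a single pair of sides, so the crossing number with it is dual to one
  generator. Its integrality on loops later allows it to serve as an exponent.\<close>

theorem dual_crossing_number:
  assumes j0: "i < g" "j0 = 4 * i \<or> j0 = 4 * i + 1"
  obtains w :: "(real \<Rightarrow> 'a) \<Rightarrow> real"
  where "\<And>s. path_character S (\<lambda>p. cis (s * w p))"
    and "\<And>p. path p \<Longrightarrow> path_image p \<subseteq> S \<Longrightarrow> pathfinish p = pathstart p \<Longrightarrow> w p \<in> \<int>"
    and "\<And>s i' j. i' < g \<Longrightarrow> j = 4 * i' \<or> j = 4 * i' + 1 \<Longrightarrow>
      holonomy (\<lambda>p. cis (s * w p)) j = (if j = j0 then cis s else 1)"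
proof -
  \<comment> \<open>The strip must separate side \<open>j0\<close> from side \<open>j0 + 2\<close>,
    so its cap contains one of the two: side \<open>j0 + 2\<close> for the first pair of a handle,
    side \<open>j0\<close> for the second.\<close>
  define k where "k = (if j0 = 4 * i then 4 * i + 2 else 4 * i + 1)"
  have k: "i < g" "k = 4 * i + 1 \<or> k = 4 * i + 2" using j0 by (auto simp: k_def)
  interpret T: annulus g S q "band (axis k) \<eta> (3 * \<eta>)" "band (axis k) 0 \<eta> \<union> band (axis k) (3 * \<eta>) pi"
    "strip_X k" "strip_Y k" "strip_P k"
    "{band (axis k) 0 \<eta>, band (axis k) \<eta> (3 * \<eta>), band (axis k) (3 * \<eta>) pi}"
    by (rule annulus_strip[OF k])
  \<comment> \<open>If the cap is at side \<open>j0 + 2\<close>, the coordinate rises from side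
    \<open>j0\<close> to side \<open>j0 + 2\<close>; the sign compensates for this.\<close>
  define e :: real where "e = (if j0 = 4 * i then - 1 else 1)"
  have e: "s * (e * x) = (s * e) * x" for s x :: real by simp
  show ?thesis
  proof (rule that[of "\<lambda>p. e * T.crossing_number p"])
    show "path_character S (\<lambda>p. cis (s * (e * T.crossing_number p)))" for s
      unfolding e by (rule T.crossing_number_character)
    show "e * T.crossing_number p \<in> \<int>"
      if "path p" "path_image p \<subseteq> S" "pathfinish p = pathstart p" for p
      using T.crossing_number_loop[OF that] by (simp add: e_def)
    fix s i' j assume j: "i' < g" "j = 4 * i' \<or> j = 4 * i' + 1"
    show "holonomy (\<lambda>p. cis (s * (e * T.crossing_number p))) j = (if j = j0 then cis s else 1)"
    proof (cases "j0 = 4 * i")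
      case True
      then have k2: "k = 4 * i + 2" "e = - 1" by (simp_all add: k_def e_def)
      have "j \<noteq> k" using j(2) k2(1) by presburger
      then show ?thesis
        unfolding e T.holonomy_crossing_number using strip_X_midpoint(2,3)[OF k j] k2 True
        by (cases "j + 2 = k") auto
    next
      case False
      then have k1: "k = 4 * i + 1" "e = 1" "j0 = k" using j0 by (simp_all add: k_def e_def)
      have "j + 2 \<noteq> k" using j(2) k1(1) by presburger
      then show ?thesis
        unfolding e T.holonomy_crossing_number using strip_X_midpoint(1,3)[OF k j] k1
        by (cases "j = k") auto
    qed
  qed
qed

end

section \<open>Representations and the mapping class group orbit\<close>

lemma homotopic_paths_cancel:
  fixes p e r :: "real \<Rightarrow> 'a::topological_space"
  assumes p: "path p" "path_image p \<subseteq> S" and e: "path e" "path_image e \<subseteq> S"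
    and r: "path r" "path_image r \<subseteq> S"
    and ends: "pathfinish p = pathstart r" "pathfinish e = pathstart r"
  shows "homotopic_paths S ((p +++ reversepath e) +++ (e +++ r)) (p +++ r)"
proof -
  let ?e = "reversepath e"
  have e': "path ?e" "path_image ?e \<subseteq> S" using e by auto
  have er: "path (e +++ r)" "path_image (e +++ r) \<subseteq> S"
    using e r ends by (auto simp: path_image_join)
  have "homotopic_paths S ((p +++ ?e) +++ (e +++ r)) (p +++ (?e +++ (e +++ r)))"
    by (rule homotopic_paths_sym, rule homotopic_paths_assoc) (use p e' er ends in auto)
  also have "homotopic_paths S \<dots> (p +++ ((?e +++ e) +++ r))"
    by (intro homotopic_paths_join homotopic_paths_assoc) (use p e e' r ends in auto)
  also have "homotopic_paths S \<dots> (p +++ ((\<lambda>_. pathstart r) +++ r))"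
    by (intro homotopic_paths_join homotopic_paths_left_inv) (use p e r ends in auto)
  also have "homotopic_paths S \<dots> (p +++ r)"
    by (intro homotopic_paths_join homotopic_paths_left_id) (use p r ends in auto)
  finally show ?thesis .
qed

text \<open>The return path of the first factor cancels against the outgoing path of the second.
  This is the multiplicativity of closing up paths by fixed connections to the base point.\<close>

lemma homotopic_paths_conjugate_join:
  fixes d p e r h :: "real \<Rightarrow> 'a::topological_space"
  assumes d: "path d" "path_image d \<subseteq> S" and p: "path p" "path_image p \<subseteq> S"
    and e: "path e" "path_image e \<subseteq> S" and r: "path r" "path_image r \<subseteq> S"
    and h: "path h" "path_image h \<subseteq> S"
    and ends: "pathfinish d = pathstart p" "pathfinish p = pathstart r" "pathfinish e = pathstart r"
      "pathfinish r = pathstart h"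
  shows "homotopic_paths S ((d +++ p +++ reversepath e) +++ (e +++ r +++ h)) (d +++ (p +++ r) +++ h)"
proof -
  let ?e = "reversepath e"
  have e': "path ?e" "path_image ?e \<subseteq> S" using e by auto
  have pe: "path (p +++ ?e)" "path_image (p +++ ?e) \<subseteq> S"
    and rh: "path (r +++ h)" "path_image (r +++ h) \<subseteq> S"
    using p e r h ends by (auto simp: path_image_join)
  have erh: "path (e +++ r +++ h)" "path_image (e +++ r +++ h) \<subseteq> S"
    using e rh ends by (auto simp: path_image_join)
  have "homotopic_paths S ((d +++ p +++ ?e) +++ (e +++ r +++ h)) (d +++ ((p +++ ?e) +++ (e +++ r +++ h)))"
    by (rule homotopic_paths_sym, rule homotopic_paths_assoc) (use d pe erh ends in auto)
  also have "homotopic_paths S \<dots> (d +++ (p +++ (r +++ h)))"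
    by (intro homotopic_paths_join homotopic_paths_cancel) (use d p e rh ends in auto)
  also have "homotopic_paths S \<dots> (d +++ ((p +++ r) +++ h))"
    by (intro homotopic_paths_join homotopic_paths_assoc) (use d p r h ends in auto)
  finally show ?thesis .
qed

lemma homotopic_paths_conjugate_twice:
  fixes e p :: "real \<Rightarrow> 'a::topological_space"
  assumes e: "path e" "path_image e \<subseteq> S" and p: "path p" "path_image p \<subseteq> S"
    and ends: "pathfinish e = pathstart p" "pathfinish p = pathstart p"
  shows "homotopic_paths S (reversepath e +++ (e +++ p +++ reversepath e) +++ e) p"
proof -
  let ?e = "reversepath e" and ?x = "\<lambda>_::real. pathstart p"
  have e': "path ?e" "path_image ?e \<subseteq> S" using e by auto
  have pe: "path (p +++ ?e)" "path_image (p +++ ?e) \<subseteq> S"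
    using p e ends by (auto simp: path_image_join)
  have "homotopic_paths S (?e +++ (e +++ p +++ ?e) +++ e) (?e +++ (e +++ ((p +++ ?e) +++ e)))"
    by (intro homotopic_paths_join homotopic_paths_assoc[THEN homotopic_paths_sym])
      (use e e' pe ends in auto)
  also have "homotopic_paths S \<dots> (?e +++ (e +++ (p +++ (?e +++ e))))"
    by (intro homotopic_paths_join homotopic_paths_assoc[THEN homotopic_paths_sym])
      (use e e' p ends in auto)
  also have "homotopic_paths S \<dots> (?e +++ (e +++ (p +++ ?x)))"
    by (intro homotopic_paths_join homotopic_paths_left_inv) (use e e' p ends in auto)
  also have "homotopic_paths S \<dots> (?e +++ (e +++ p))"
    by (intro homotopic_paths_join homotopic_paths_right_id) (use e e' p ends in auto)
  also have "homotopic_paths S \<dots> ((?e +++ e) +++ p)"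
    by (rule homotopic_paths_assoc) (use e e' p ends in auto)
  also have "homotopic_paths S \<dots> (?x +++ p)"
    by (intro homotopic_paths_join homotopic_paths_left_inv) (use e p ends in auto)
  also have "homotopic_paths S \<dots> p"
    by (rule homotopic_paths_left_id) (use p in auto)
  finally show ?thesis .
qed

context path_character
begin

text \<open>The contributions of \<open>d\<close> and its reverse cancel because complex numbers
  commute. Hence neither the base point nor the connecting path affects the value on a loop.\<close>

lemma conjugate:
  assumes "path d" "path_image d \<subseteq> S" "path p" "path_image p \<subseteq> S"
    "pathfinish d = pathstart p" "pathfinish p = pathstart p"
  shows "c (d +++ p +++ reversepath d) = c p"
proof -
  have "c (d +++ p +++ reversepath d) = c d * (c p * c (reversepath d))"
    using assms by (subst join; (subst join)?) (auto simp: path_image_join)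
  then show ?thesis using reverse[OF assms(1,2)] nonzero[OF assms(1,2)] by simp
qed

end

lemma path_character_mult:
  assumes "path_character S c" "path_character S d"
  shows "path_character S (\<lambda>p. c p * d p)"
proof -
  interpret c: path_character S c by (rule assms)
  interpret d: path_character S d by (rule assms)
  show ?thesis
  proof
    fix p r assume h: "homotopic_paths S p r"
    show "c p * d p = c r * d r" unfolding c.homotopic[OF h] d.homotopic[OF h] ..
  qed (simp_all add: c.join d.join norm_mult c.norm_1 d.norm_1)
qed

lemma path_character_one: "path_character S (\<lambda>_. 1)"
  by standard simp_all

lemma path_character_prod:
  assumes "finite I" "\<And>i. i \<in> I \<Longrightarrow> path_character S (c i)"
  shows "path_character S (\<lambda>p. \<Prod>i\<in>I. c i p)"
  using assms
  by (induction I rule: finite_induct) (simp_all add: path_character_one path_character_mult)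

lemma path_character_power: "path_character S c \<Longrightarrow> path_character S (\<lambda>p. c p ^ n)"
  by (induction n) (simp_all add: path_character_one path_character_mult)

lemma path_character_powi:
  assumes "path_character S c"
  shows "path_character S (\<lambda>p. c p powi n)"
proof -
  interpret path_character S c by (rule assms)
  show ?thesis
  proof
    fix p r assume "homotopic_paths S p r"
    from homotopic[OF this] show "c p powi n = c r powi n" by simp
  qed (simp_all add: join norm_1 power_int_mult_distrib norm_power_int)
qed

section \<open>Loop classes and representations\<close>

lemma based_loopsD:
  assumes "p \<in> based_loops S x"
  shows "path p" "path_image p \<subseteq> S" "pathstart p = x" "pathfinish p = x" "pathfinish p = pathstart p"
  using assms by (auto simp: based_loops_def)

lemma equiv_loop_homotopy: "equiv (based_loops S x) (loop_homotopy S x)"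
proof (rule equivI)
  show "loop_homotopy S x \<subseteq> based_loops S x \<times> based_loops S x"
    by (auto simp: loop_homotopy_def)
  show "refl_on (based_loops S x) (loop_homotopy S x)"
    by (auto simp: loop_homotopy_def refl_on_def based_loops_def)
  show "sym (loop_homotopy S x)"
    unfolding sym_def loop_homotopy_def using homotopic_paths_sym by blast
  show "trans (loop_homotopy S x)"
    unfolding trans_def loop_homotopy_def using homotopic_paths_trans by blast
qed

abbreviation loop_class :: "'a::topological_space set \<Rightarrow> 'a \<Rightarrow> (real \<Rightarrow> 'a) \<Rightarrow> (real \<Rightarrow> 'a) set" where
  "loop_class S x p \<equiv> loop_homotopy S x `` {p}"

lemma in_loop_class: "r \<in> loop_class S x p \<longleftrightarrow> p \<in> based_loops S x \<and> r \<in> based_loops S x \<and> homotopic_paths S p r"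
  by (auto simp: loop_homotopy_def)

lemma loop_class_eqI:
  assumes "homotopic_paths S p r" "p \<in> based_loops S x"
  shows "loop_class S x p = loop_class S x r"
proof -
  have "r \<in> based_loops S x"
    using assms homotopic_paths_imp_path[OF assms(1)] homotopic_paths_imp_subset[OF assms(1)]
      homotopic_paths_imp_pathstart[OF assms(1)] homotopic_paths_imp_pathfinish[OF assms(1)]
    by (auto simp: based_loops_def)
  then show ?thesis
    using assms by (intro equiv_class_eq[OF equiv_loop_homotopy]) (auto simp: loop_homotopy_def)
qed

lemma carrier_fundamental_group:
  "carrier (fundamental_group S x) = loop_class S x ` based_loops S x"
  by (auto simp: fundamental_group_def quotient_def)

lemma loop_class_in_carrier:
  "p \<in> based_loops S x \<Longrightarrow> loop_class S x p \<in> carrier (fundamental_group S x)"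
  by (auto simp: carrier_fundamental_group)

lemma based_loops_join:
  "p \<in> based_loops S x \<Longrightarrow> r \<in> based_loops S x \<Longrightarrow> p +++ r \<in> based_loops S x"
  by (auto simp: based_loops_def path_image_join)

lemma mult_fundamental_group:
  assumes p: "p \<in> based_loops S x" and r: "r \<in> based_loops S x"
  shows "loop_class S x p \<otimes>\<^bsub>fundamental_group S x\<^esub> loop_class S x r = loop_class S x (p +++ r)"
proof -
  let ?A = "loop_class S x p" and ?B = "loop_class S x r" and ?C = "loop_class S x (p +++ r)"
  have key: "loop_class S x (p' +++ r') = loop_class S x (p +++ r)"
    if "p' \<in> loop_class S x p" "r' \<in> loop_class S x r" for p' r'
  proof (rule loop_class_eqI)
    show "homotopic_paths S (p' +++ r') (p +++ r)"
      using that by (intro homotopic_paths_join homotopic_paths_sym[of S p] homotopic_paths_sym[of S r])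
        (auto simp: loop_homotopy_def based_loops_def)
    show "p' +++ r' \<in> based_loops S x"
      using that by (intro based_loops_join) (auto simp: loop_homotopy_def)
  qed
  have "p \<in> ?A" "r \<in> ?B"
    using p r by (auto simp: loop_homotopy_def based_loops_def)
  have "(\<Union>p'\<in>?A. \<Union>r'\<in>?B. loop_class S x (p' +++ r')) = (\<Union>p'\<in>?A. \<Union>r'\<in>?B. ?C)"
    by (intro SUP_cong refl key)
  also have "\<dots> = ?C" using \<open>p \<in> ?A\<close> \<open>r \<in> ?B\<close> by blast
  finally show ?thesis unfolding fundamental_group_def by simp
qed

lemma conjugate_in_based_loops:
  assumes "path d" "path_image d \<subseteq> S" "pathstart d = x"
    and "path p" "path_image p \<subseteq> S" "pathstart p = pathfinish d" "pathfinish p = pathfinish e"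
    and "path e" "path_image e \<subseteq> S" "pathstart e = x"
  shows "d +++ p +++ reversepath e \<in> based_loops S x"
  using assms by (auto simp: based_loops_def path_image_join)

text \<open>The chosen loop in a class is immaterial because path characters are homotopy invariant;
  \<open>restrict\<close> makes the result extensional as \<open>representations\<close>
  demands.\<close>

definition character_rep ::
    "'a::topological_space set \<Rightarrow> 'a \<Rightarrow> ('n \<Rightarrow> (real \<Rightarrow> 'a) \<Rightarrow> complex) \<Rightarrow>
      (real \<Rightarrow> 'a) set \<Rightarrow> complex ^ 'n::finite" where
  "character_rep S x c = restrict (\<lambda>A. \<chi> i. c i (SOME p. p \<in> A)) (carrier (fundamental_group S x))"

lemma character_rep_apply:
  assumes c: "\<And>i. path_character S (c i)" and p: "p \<in> based_loops S x"
  shows "character_rep S x c (loop_class S x p) = (\<chi> i. c i p)"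
proof -
  have "p \<in> loop_class S x p" using p by (auto simp: loop_homotopy_def based_loops_def)
  then have "(SOME r. r \<in> loop_class S x p) \<in> loop_class S x p"
    by (rule someI[where P = "\<lambda>r. r \<in> loop_class S x p"])
  then have "homotopic_paths S p (SOME r. r \<in> loop_class S x p)"
    unfolding in_loop_class by blast
  then have "c i (SOME r. r \<in> loop_class S x p) = c i p" for i
    using path_character.homotopic[OF c] by metis
  then show ?thesis using loop_class_in_carrier[OF p] by (simp add: character_rep_def)
qed

lemma character_rep_in_representations:
  assumes c: "\<And>i. path_character S (c i)"
  shows "character_rep S x c \<in> representations S x"
proof -
  have "character_rep S x c \<in> hom (fundamental_group S x) torus"
  proof (rule homI)
    fix A assume "A \<in> carrier (fundamental_group S x)"
    then obtain p where p: "p \<in> based_loops S x" "A = loop_class S x p"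
      by (auto simp: carrier_fundamental_group)
    then show "character_rep S x c A \<in> carrier torus"
      using path_character.norm_1[OF c] based_loopsD[OF p(1)]
      by (simp add: character_rep_apply[OF c] torus_def)
  next
    fix A B assume "A \<in> carrier (fundamental_group S x)" "B \<in> carrier (fundamental_group S x)"
    then obtain p r where p: "p \<in> based_loops S x" "A = loop_class S x p"
      and r: "r \<in> based_loops S x" "B = loop_class S x r"
      by (auto simp: carrier_fundamental_group)
    have "c i (p +++ r) = c i p * c i r" for i
      using path_character.join[OF c] based_loopsD[OF p(1)] based_loopsD[OF r(1)] by simp
    then show "character_rep S x c (A \<otimes>\<^bsub>fundamental_group S x\<^esub> B) =
        character_rep S x c A \<otimes>\<^bsub>torus\<^esub> character_rep S x c B"
      using p r by (simp add: mult_fundamental_group character_rep_apply[OF c] based_loops_join torus_def)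
  qed
  then show ?thesis by (simp add: representations_def character_rep_def)
qed

text \<open>Close up each path by fixed connections from \<open>x\<close> to its two ends and take
  the coordinates of \<rho> on the resulting loop. In a concatenation the connections to the middle
  point cancel.\<close>

lemma representation_eq_character_rep:
  fixes \<rho> :: "(real \<Rightarrow> 'a::topological_space) set \<Rightarrow> complex ^ 'n::finite"
  assumes \<rho>: "\<rho> \<in> representations S x" and S: "path_connected S" and x: "x \<in> S"
  obtains c where "\<And>i. path_character S (c i)" "\<rho> = character_rep S x c"
proof -
  let ?G = "fundamental_group S x"
  have "\<exists>d. path d \<and> path_image d \<subseteq> S \<and> pathstart d = x \<and> pathfinish d = y" if "y \<in> S" for y
    using S x that unfolding path_connected_def by blast
  then obtain d0 where d0: "\<And>y. y \<in> S \<Longrightarrow>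
      path (d0 y) \<and> path_image (d0 y) \<subseteq> S \<and> pathstart (d0 y) = x \<and> pathfinish (d0 y) = y"
    by metis
  \<comment> \<open>The connection to \<open>x\<close> itself is constant, so that closing up a loop
    at \<open>x\<close> does not change its class.\<close>
  define d where "d y = (if y = x then (\<lambda>_. x) else d0 y)" for y
  have d: "path (d y)" "path_image (d y) \<subseteq> S" "pathstart (d y) = x" "pathfinish (d y) = y" if "y \<in> S" for y
    using d0[OF that] x by (auto simp: d_def path_const)
  define conj where "conj p = d (pathstart p) +++ p +++ reversepath (d (pathfinish p))" for p
  have conj_loop: "conj p \<in> based_loops S x" if "path p" "path_image p \<subseteq> S" for p
  proof -
    have "pathstart p \<in> S" "pathfinish p \<in> S" using that by auto
    then show ?thesis
      unfolding conj_def using that d by (intro conjugate_in_based_loops) auto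
  qed
  have val: "\<rho> A \<in> carrier torus" if "A \<in> carrier ?G" for A
    using \<rho> that by (auto simp: representations_def hom_def)
  have mult: "\<rho> (A \<otimes>\<^bsub>?G\<^esub> B) = \<rho> A \<otimes>\<^bsub>torus\<^esub> \<rho> B" if "A \<in> carrier ?G" "B \<in> carrier ?G" for A B
    using \<rho> that by (auto simp: representations_def hom_def)
  define c where "c i p = \<rho> (loop_class S x (conj p)) $ i" for i p
  have c: "path_character S (c i)" for i
  proof
    fix p r assume p: "path p" "path_image p \<subseteq> S" and r: "path r" "path_image r \<subseteq> S"
      and e: "pathfinish p = pathstart r"
    have S': "pathstart p \<in> S" "pathstart r \<in> S" "pathfinish r \<in> S" using p r by auto
    have "homotopic_paths S (conj p +++ conj r) (conj (p +++ r))"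
      using homotopic_paths_conjugate_join[of "d (pathstart p)" S p "d (pathstart r)" r
          "reversepath (d (pathfinish r))"] p r e S' d
      by (simp add: conj_def)
    then have "loop_class S x (conj p +++ conj r) = loop_class S x (conj (p +++ r))"
      by (rule loop_class_eqI) (intro based_loops_join conj_loop p r)
    then show "c i (p +++ r) = c i p * c i r"
      using mult[OF loop_class_in_carrier loop_class_in_carrier, OF conj_loop[OF p] conj_loop[OF r]]
      by (simp add: c_def mult_fundamental_group conj_loop p r torus_def)
  next
    fix p r assume h: "homotopic_paths S p r"
    have p: "path p" "path_image p \<subseteq> S"
      using homotopic_paths_imp_path[OF h] homotopic_paths_imp_subset[OF h] by auto
    then have S': "pathstart p \<in> S" "pathfinish p \<in> S" by auto
    have "homotopic_paths S (conj p) (conj r)"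
      unfolding conj_def homotopic_paths_imp_pathstart[OF h, symmetric]
        homotopic_paths_imp_pathfinish[OF h, symmetric]
      using h d S' homotopic_paths_imp_pathfinish[OF h]
      by (intro homotopic_paths_join) auto
    then have "loop_class S x (conj p) = loop_class S x (conj r)"
      by (rule loop_class_eqI) (rule conj_loop[OF p])
    then show "c i p = c i r" by (simp add: c_def)
  next
    fix p assume "path p" "path_image p \<subseteq> S"
    from val[OF loop_class_in_carrier[OF conj_loop[OF this]]]
    show "cmod (c i p) = 1" by (simp add: c_def torus_def)
  qed
  have "\<rho> A = character_rep S x c A" for A
  proof (cases "A \<in> carrier ?G")
    case True
    then obtain p where p: "p \<in> based_loops S x" "A = loop_class S x p"
      by (auto simp: carrier_fundamental_group)
    note pl = based_loopsD[OF p(1)]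
    have "conj p = (\<lambda>_. x) +++ p +++ (\<lambda>_. x)"
      using pl by (simp add: conj_def d_def reversepath_def)
    moreover have "homotopic_paths S ((\<lambda>_. x) +++ p +++ (\<lambda>_. x)) ((\<lambda>_. x) +++ p)"
      using pl x by (intro homotopic_paths_join homotopic_paths_right_id) (auto simp: path_const)
    moreover have "homotopic_paths S ((\<lambda>_. x) +++ p) p"
      using pl by (intro homotopic_paths_left_id) auto
    ultimately have "homotopic_paths S (conj p) p"
      using homotopic_paths_trans by metis
    then have "loop_class S x (conj p) = A"
      unfolding p(2) using conj_loop[OF pl(1,2)] by (rule loop_class_eqI)
    then show ?thesis
      using character_rep_apply[where c = c, OF c p(1)] p(2) by (simp add: c_def)
  next
    case False
    then show ?thesis
      using \<rho> by (simp add: representations_def character_rep_def extensional_def)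
  qed
  then have "\<rho> = character_rep S x c" by (rule ext)
  with c show ?thesis by (rule that)
qed

section \<open>The action of homeomorphisms on representations\<close>

lemma induced_automorphism_loop_class:
  assumes f: "continuous_on S f" "f ` S \<subseteq> S"
    and d: "path d" "path_image d \<subseteq> S" "pathstart d = x" "pathfinish d = f x"
    and p: "p \<in> based_loops S x"
  shows "d +++ (f \<circ> p) +++ reversepath d \<in> based_loops S x"
    and "induced_automorphism S x f d (loop_class S x p) = loop_class S x (d +++ (f \<circ> p) +++ reversepath d)"
proof -
  have pf: "path (f \<circ> r)" "path_image (f \<circ> r) \<subseteq> S" "pathstart (f \<circ> r) = f x" "pathfinish (f \<circ> r) = f x"
    if "r \<in> based_loops S x" for r
    using based_loopsD[OF that] f(2) continuous_on_subset[OF f(1)]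
    by (auto intro!: path_continuous_image simp: path_image_compose pathstart_compose pathfinish_compose)
  have loop: "d +++ (f \<circ> r) +++ reversepath d \<in> based_loops S x" if "r \<in> based_loops S x" for r
    using pf[OF that] d by (intro conjugate_in_based_loops) auto
  then show "d +++ (f \<circ> p) +++ reversepath d \<in> based_loops S x" using p .
  have "loop_class S x (d +++ (f \<circ> r) +++ reversepath d) = loop_class S x (d +++ (f \<circ> p) +++ reversepath d)"
    if r: "r \<in> loop_class S x p" for r
  proof (rule loop_class_eqI)
    have rl: "r \<in> based_loops S x" and h: "homotopic_paths S p r" using r by (auto simp: loop_homotopy_def)
    have "homotopic_paths S (f \<circ> r) (f \<circ> p)"
      using f by (intro homotopic_paths_continuous_image[OF homotopic_paths_sym[OF h]]) auto
    then show "homotopic_paths S (d +++ (f \<circ> r) +++ reversepath d) (d +++ (f \<circ> p) +++ reversepath d)"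
      using d pf[OF rl] by (intro homotopic_paths_join) auto
    show "d +++ (f \<circ> r) +++ reversepath d \<in> based_loops S x" by (rule loop[OF rl])
  qed
  moreover have "p \<in> loop_class S x p" using p by (auto simp: loop_homotopy_def based_loops_def)
  ultimately show "induced_automorphism S x f d (loop_class S x p) = loop_class S x (d +++ (f \<circ> p) +++ reversepath d)"
    unfolding induced_automorphism_def by blast
qed

text \<open>The image of \<open>d\<close> under \<open>f'\<close> runs from \<open>f' x\<close> to
  \<open>x\<close>, so its reverse is a connecting path for \<open>f'\<close>. The two conjugations
  cancel up to homotopy, which gives the injectivity required to evaluate
  \<open>inv_into\<close>.\<close>

lemma induced_automorphism_inverse:
  assumes f: "homeomorphism S S f f'" and x: "x \<in> S"
    and d: "path d" "path_image d \<subseteq> S" "pathstart d = x" "pathfinish d = f x"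
    and p: "p \<in> based_loops S x"
  shows "induced_automorphism S x f' (reversepath (f' \<circ> d)) (induced_automorphism S x f d (loop_class S x p)) =
    loop_class S x p"
proof -
  have fc: "continuous_on S f" "f ` S \<subseteq> S" "continuous_on S f'" "f' ` S \<subseteq> S"
    and inv: "\<And>y. y \<in> S \<Longrightarrow> f' (f y) = y"
    using f by (auto simp: homeomorphism_def)
  let ?e = "f' \<circ> d"
  have e: "path ?e" "path_image ?e \<subseteq> S" "pathstart ?e = f' x" "pathfinish ?e = x"
    using d fc(4) continuous_on_subset[OF fc(3) d(2)] inv[OF x]
    by (auto intro!: path_continuous_image simp: path_image_compose pathstart_compose pathfinish_compose)
  have e': "path (reversepath ?e)" "path_image (reversepath ?e) \<subseteq> S" "pathstart (reversepath ?e) = x"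
    "pathfinish (reversepath ?e) = f' x" using e by auto
  note pl = based_loopsD[OF p]
  note step1 = induced_automorphism_loop_class[OF fc(1,2) d p]
  note step2 = induced_automorphism_loop_class[OF fc(3,4) e' step1(1)]
  have eq: "f' \<circ> (d +++ (f \<circ> p) +++ reversepath d) = ?e +++ (f' \<circ> (f \<circ> p)) +++ reversepath ?e"
    by (simp add: path_compose_join path_compose_reversepath)
  have h: "homotopic_paths S p (f' \<circ> (f \<circ> p))"
  proof (rule homotopic_paths_eq[OF pl(1,2)])
    fix t :: real assume "t \<in> {0..1}"
    then have "p t \<in> S" using pl(2) by (auto simp: path_image_def)
    then show "p t = (f' \<circ> (f \<circ> p)) t" by (simp add: inv)
  qed
  then have h2: "homotopic_paths S (reversepath ?e +++ (?e +++ (f' \<circ> (f \<circ> p)) +++ reversepath ?e) +++ ?e)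
      (reversepath ?e +++ (?e +++ p +++ reversepath ?e) +++ ?e)"
    using e pl homotopic_paths_imp_pathstart[OF h] homotopic_paths_imp_pathfinish[OF h]
    by (intro homotopic_paths_join homotopic_paths_sym[OF h]) auto
  have h3: "homotopic_paths S (reversepath ?e +++ (?e +++ p +++ reversepath ?e) +++ ?e) p"
    by (rule homotopic_paths_conjugate_twice) (use e pl in auto)
  have h4: "homotopic_paths S (reversepath ?e +++ (f' \<circ> (d +++ (f \<circ> p) +++ reversepath d)) +++ ?e) p"
    unfolding eq by (rule homotopic_paths_trans[OF h2 h3])
  show ?thesis
    unfolding step1(2) step2(2) by (rule loop_class_eqI) (use h4 step2(1) in simp_all)
qed

text \<open>The preimage of the class of \<open>p\<close> is represented by a conjugate of
  \<open>f' \<circ> p\<close>, and path characters ignore the conjugation.\<close>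

lemma precompose_inverse_character_rep:
  assumes c: "\<And>i. path_character S (c i)" and f: "homeomorphism S S f f'" and x: "x \<in> S"
    and d: "path d" "path_image d \<subseteq> S" "pathstart d = x" "pathfinish d = f x"
  shows "precompose_inverse (fundamental_group S x) (induced_automorphism S x f d) (character_rep S x c) =
    character_rep S x (\<lambda>i p. c i (f' \<circ> p))"
proof
  let ?G = "fundamental_group S x" and ?\<phi> = "induced_automorphism S x f d"
  fix A
  have fc: "continuous_on S f" "f ` S \<subseteq> S" "continuous_on S f'" "f' ` S \<subseteq> S"
    and inv: "\<And>y. y \<in> S \<Longrightarrow> f' (f y) = y" "\<And>y. y \<in> S \<Longrightarrow> f (f' y) = y"
    using f by (auto simp: homeomorphism_def)
  have f': "homeomorphism S S f' f" using f by (rule homeomorphism_symD)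
  let ?e = "reversepath (f' \<circ> d)"
  have e: "path ?e" "path_image ?e \<subseteq> S" "pathstart ?e = x" "pathfinish ?e = f' x"
    using d fc(4) continuous_on_subset[OF fc(3) d(2)] inv(1)[OF x]
    by (auto intro!: path_continuous_image simp: path_image_compose pathstart_compose pathfinish_compose)
  show "precompose_inverse ?G ?\<phi> (character_rep S x c) A = character_rep S x (\<lambda>i p. c i (f' \<circ> p)) A"
  proof (cases "A \<in> carrier ?G")
    case True
    then obtain p where p: "p \<in> based_loops S x" "A = loop_class S x p"
      by (auto simp: carrier_fundamental_group)
    note pl = based_loopsD[OF p(1)]
    have inj: "inj_on ?\<phi> (carrier ?G)"
      by (rule inj_on_inverseI[of _ "induced_automorphism S x f' ?e"])
        (auto simp: carrier_fundamental_group induced_automorphism_inverse[OF f x d])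
    define r where "r = ?e +++ (f' \<circ> p) +++ reversepath ?e"
    note step = induced_automorphism_loop_class[OF fc(3,4) e p(1), folded r_def]
    have eq: "?\<phi> (loop_class S x r) = A"
    proof -
      \<comment> \<open>Since \<open>f \<circ> f'\<close> is the identity only on \<open>S\<close>,
        this path agrees with \<open>d\<close> on \<open>[0, 1]\<close> but possibly not as a
        function on the reals; hence the detour through a homotopy.\<close>
      let ?d = "reversepath (f \<circ> ?e)"
      have dd: "homotopic_paths S d ?d"
        by (rule homotopic_paths_eq)
          (use d inv in \<open>auto simp: reversepath_def path_image_def image_subset_iff\<close>)
      have d': "path ?d" "path_image ?d \<subseteq> S" "pathstart ?d = x" "pathfinish ?d = f x"
        using homotopic_paths_imp_path[OF dd] homotopic_paths_imp_subset[OF dd]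
          homotopic_paths_imp_pathstart[OF dd] homotopic_paths_imp_pathfinish[OF dd] d by auto
      have fr: "path (f \<circ> r)" "path_image (f \<circ> r) \<subseteq> S" "pathstart (f \<circ> r) = f x" "pathfinish (f \<circ> r) = f x"
        using based_loopsD[OF step(1)] fc(2) continuous_on_subset[OF fc(1)]
        by (auto intro!: path_continuous_image simp: path_image_compose pathstart_compose pathfinish_compose)
      have "?\<phi> (loop_class S x r) = loop_class S x (d +++ (f \<circ> r) +++ reversepath d)"
        by (rule induced_automorphism_loop_class[OF fc(1,2) d step(1)])
      also have "\<dots> = loop_class S x (?d +++ (f \<circ> r) +++ reversepath ?d)"
      proof (rule loop_class_eqI)
        show "homotopic_paths S (d +++ (f \<circ> r) +++ reversepath d) (?d +++ (f \<circ> r) +++ reversepath ?d)"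
          using dd fr d
          by (intro homotopic_paths_join homotopic_paths_reversepath_D) auto
        show "d +++ (f \<circ> r) +++ reversepath d \<in> based_loops S x"
          by (rule induced_automorphism_loop_class[OF fc(1,2) d step(1)])
      qed
      also have "\<dots> = induced_automorphism S x f ?d (loop_class S x r)"
        by (rule induced_automorphism_loop_class(2)[OF fc(1,2) d' step(1), symmetric])
      also have "\<dots> = A"
        using induced_automorphism_inverse[OF f' x e p(1)] step(2) p(2) by simp
      finally show ?thesis .
    qed
    have "inv_into (carrier ?G) ?\<phi> A = loop_class S x r"
      by (rule inv_into_f_eq[OF inj loop_class_in_carrier[OF step(1)] eq])
    then have "precompose_inverse ?G ?\<phi> (character_rep S x c) A = (\<chi> i. c i r)"
      using True by (simp add: precompose_inverse_def character_rep_apply[OF c step(1)])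
    moreover have "c i r = c i (f' \<circ> p)" for i
      unfolding r_def
      by (rule path_character.conjugate[OF c])
        (use e pl fc(4) continuous_on_subset[OF fc(3) pl(2)] in
          \<open>auto intro!: path_continuous_image simp: path_image_compose pathstart_compose pathfinish_compose\<close>)
    moreover have "path_character S (\<lambda>p. c i (f' \<circ> p))" for i
      by (rule path_character_compose[OF c fc(3,4)])
    ultimately show ?thesis
      using character_rep_apply[OF _ p(1), of "\<lambda>i p. c i (f' \<circ> p)"] p(2) by simp
  next
    case False
    then show ?thesis by (simp add: precompose_inverse_def character_rep_def)
  qed
qed

text \<open>Homeomorphisms are closed under inverses, so the inverse in the action disappears when
  the whole orbit is described.\<close>

lemma mapping_class_orbit_character_rep:
  assumes c: "\<And>i. path_character S (c i)" and x: "x \<in> S" and S: "path_connected S"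
  shows "mapping_class_orbit S x (character_rep S x c) =
    {character_rep S x (\<lambda>i p. c i (f \<circ> p)) | f f'. homeomorphism S S f f'}"
proof (intro equalityI subsetI)
  fix \<sigma> assume "\<sigma> \<in> mapping_class_orbit S x (character_rep S x c)"
  then obtain C f d where C: "C \<in> carrier (mapping_class_group S)" "f \<in> C"
    and d: "path d" "path_image d \<subseteq> S" "pathstart d = x" "pathfinish d = f x"
    and \<sigma>: "\<sigma> = precompose_inverse (fundamental_group S x) (induced_automorphism S x f d) (character_rep S x c)"
    unfolding mapping_class_orbit_def by blast
  from C have "f \<in> homeos S"
    by (auto simp: mapping_class_group_def quotient_def isotopy_def dest: homotopic_with_imp_property)
  then obtain f' where f: "homeomorphism S S f f'" by (auto simp: homeos_def)
  have "\<sigma> = character_rep S x (\<lambda>i p. c i (f' \<circ> p))"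
    unfolding \<sigma> by (rule precompose_inverse_character_rep[OF c f x d])
  then show "\<sigma> \<in> {character_rep S x (\<lambda>i p. c i (f \<circ> p)) | f f'. homeomorphism S S f f'}"
    using homeomorphism_symD[OF f] by blast
next
  fix \<sigma> assume "\<sigma> \<in> {character_rep S x (\<lambda>i p. c i (f \<circ> p)) | f f'. homeomorphism S S f f'}"
  then obtain f f' where f: "homeomorphism S S f f'"
    and \<sigma>: "\<sigma> = character_rep S x (\<lambda>i p. c i (f \<circ> p))" by blast
  have f': "homeomorphism S S f' f" using f by (rule homeomorphism_symD)
  then have "f' x \<in> S" using x by (auto simp: homeomorphism_def)
  then obtain d where d: "path d" "path_image d \<subseteq> S" "pathstart d = x" "pathfinish d = f' x"
    using S x unfolding path_connected_def by blast
  have "f' \<in> homeos S" using f' by (auto simp: homeos_def)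
  moreover have "(f', f') \<in> isotopy S"
    using f' by (auto simp: isotopy_def homotopic_with_refl homeos_def homeomorphism_def)
  ultimately have "isotopy S `` {f'} \<in> carrier (mapping_class_group S)" "f' \<in> isotopy S `` {f'}"
    by (auto simp: mapping_class_group_def quotientI)
  moreover have "\<sigma> = precompose_inverse (fundamental_group S x) (induced_automorphism S x f' d) (character_rep S x c)"
    unfolding \<sigma> by (rule precompose_inverse_character_rep[OF c f' x d, symmetric])
  ultimately show "\<sigma> \<in> mapping_class_orbit S x (character_rep S x c)"
    unfolding mapping_class_orbit_def using d by blast
qed

section \<open>The topology of the representation space\<close>

lemma topspace_representation_space:
  "topspace (representation_space S x :: ((real \<Rightarrow> 'a::topological_space) set \<Rightarrow> complex ^ 'n::finite) topology) =
    representations S x"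
proof -
  have "\<rho> \<in> topspace (compact_open_topology (discrete_topology (carrier (fundamental_group S x))) torus_topology)"
    if "\<rho> \<in> representations S x" for \<rho> :: "(real \<Rightarrow> 'a) set \<Rightarrow> complex ^ 'n"
  proof -
    have "continuous_map (discrete_topology (carrier (fundamental_group S x))) torus_topology \<rho>"
      "\<rho> \<in> extensional (carrier (fundamental_group S x))"
      using that by (auto simp: representations_def hom_def)
    \<comment> \<open>With \<open>K\<close> and \<open>U\<close> both empty, the subbasic set
      contains every continuous extensional map.\<close>
    then have mem: "\<rho> \<in> {f. continuous_map (discrete_topology (carrier (fundamental_group S x))) torus_topology f
        \<and> f \<in> extensional (topspace (discrete_topology (carrier (fundamental_group S x)))) \<and> f ` {} \<subseteq> {}}"
      by simp
    show ?thesis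
      unfolding compact_open_topology_def topology_generated_by_topspace
      by (rule UnionI[OF _ mem], rule CollectI, rule exI[of _ "{}"], rule exI[of _ "{}"])
        (intro conjI refl compactin_empty openin_empty)
  qed
  then show ?thesis by (auto simp: representation_space_def)
qed

lemma openin_representation_space_eval:
  assumes A: "A \<in> carrier (fundamental_group S x)" and U: "openin torus_topology U"
  shows "openin (representation_space S x) {\<rho> \<in> representations S x. \<rho> A \<in> U}"
proof -
  let ?X = "discrete_topology (carrier (fundamental_group S x))"
  let ?B = "{f. continuous_map ?X torus_topology f \<and> f \<in> extensional (topspace ?X) \<and> f ` {A} \<subseteq> U}"
  have "openin (compact_open_topology ?X torus_topology) ?B"
    unfolding compact_open_topology_def
    by (rule topology_generated_by_Basis, rule CollectI, rule exI[of _ "{A}"], rule exI[of _ U])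
      (use A U in \<open>simp add: compactin_discrete_topology\<close>)
  moreover have "{\<rho> \<in> representations S x. \<rho> A \<in> U} = ?B \<inter> representations S x"
    by (auto simp: representations_def hom_def)
  ultimately show ?thesis
    unfolding representation_space_def openin_subtopology by blast
qed

text \<open>Compact subsets of a discrete space are finite, so the compact-open topology is that of
  pointwise convergence.\<close>

lemma eventually_in_representation_space:
  assumes r: "\<And>m. r m \<in> representations S x" and \<sigma>: "\<sigma> \<in> representations S x"
    and lim: "\<And>A. A \<in> carrier (fundamental_group S x) \<Longrightarrow> (\<lambda>m. r m A) \<longlonglongrightarrow> \<sigma> A"
    and W: "openin (representation_space S x) W" "\<sigma> \<in> W"
  shows "\<forall>\<^sub>F m in sequentially. r m \<in> W"
proof -
  let ?X = "discrete_topology (carrier (fundamental_group S x))"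
  let ?B = "{{f. continuous_map ?X torus_topology f \<and> f \<in> extensional (topspace ?X) \<and> f ` K \<subseteq> U} | K U.
          compactin ?X K \<and> openin torus_topology U}"
  obtain V where V: "openin (compact_open_topology ?X torus_topology) V" "W = V \<inter> representations S x"
    using W(1) unfolding representation_space_def openin_subtopology by blast
  have "generate_topology_on ?B V"
    using V(1) unfolding compact_open_topology_def openin_topology_generated_by_iff .
  then have "\<sigma> \<in> V \<longrightarrow> (\<forall>\<^sub>F m in sequentially. r m \<in> V)"
  proof (induction rule: generate_topology_on.induct)
    case (Int a b)
    then show ?case by (auto intro: eventually_conj)
  next
    case (UN K)
    show ?case
    proof
      assume "\<sigma> \<in> \<Union>K"
      then obtain k where "k \<in> K" "\<sigma> \<in> k" by blast
      with UN.IH[OF this(1)] show "\<forall>\<^sub>F m in sequentially. r m \<in> \<Union>K"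
        by (auto elim: eventually_mono)
    qed
  next
    case (Basis s)
    then obtain K U where K: "compactin ?X K" and U: "openin torus_topology U"
      and s: "s = {f. continuous_map ?X torus_topology f \<and> f \<in> extensional (topspace ?X) \<and> f ` K \<subseteq> U}"
      by blast
    show ?case
    proof
      assume "\<sigma> \<in> s"
      then have \<sigma>U: "\<sigma> A \<in> U" if "A \<in> K" for A using s that by blast
      have finK: "finite K" and KG: "K \<subseteq> carrier (fundamental_group S x)"
        using K by (auto simp: compactin_discrete_topology)
      have rt: "r m A \<in> carrier torus" if "A \<in> carrier (fundamental_group S x)" for m A
        using r[of m] that by (auto simp: representations_def hom_def)
      obtain U' where U': "open U'" "U = U' \<inter> carrier torus"
        using U unfolding openin_open by blast
      have "\<forall>\<^sub>F m in sequentially. r m A \<in> U" if A: "A \<in> K" for A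
      proof -
        have "\<forall>\<^sub>F m in sequentially. r m A \<in> U'"
          using lim[of A] KG A U' \<sigma>U[OF A] by (intro topological_tendstoD) auto
        then show ?thesis
          by (rule eventually_mono) (use rt KG A U' in auto)
      qed
      then have "\<forall>\<^sub>F m in sequentially. \<forall>A\<in>K. r m A \<in> U"
        using finK by (simp add: eventually_ball_finite)
      then show "\<forall>\<^sub>F m in sequentially. r m \<in> s"
        by (rule eventually_mono) (use r in \<open>auto simp: s representations_def hom_def\<close>)
    qed
  qed simp
  then show ?thesis using V W r by (auto elim: eventually_mono)
qed

section \<open>Density\<close>

context glued_surface
begin

definition generator_sides :: "nat set" where
  "generator_sides = (\<Union>i<g. {4 * i, 4 * i + 1})"

lemma generator_sidesE:
  assumes "j \<in> generator_sides"
  obtains i where "i < g" "j = 4 * i \<or> j = 4 * i + 1"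
  using assms by (auto simp: generator_sides_def)

lemma generator_sidesI: "i < g \<Longrightarrow> j = 4 * i \<or> j = 4 * i + 1 \<Longrightarrow> j \<in> generator_sides"
  by (auto simp: generator_sides_def)

lemma finite_generator_sides: "finite generator_sides"
  by (simp add: generator_sides_def)

lemma path_connected_surface: "path_connected S"
  using path_connected_continuous_image[OF q_continuous] q_surj convex_imp_path_connected[OF convex_cball]
  by metis

lemma norm_holonomy:
  assumes "path_character S c"
  shows "cmod (holonomy c j) = 1"
  unfolding holonomy_def by (intro path_character.norm_1[OF assms] disc_chord_path side_in_disc)

section \<open>Characters on loops in terms of holonomies\<close>

text \<open>Dividing \<open>c\<close> by a product of dual characters with the same holonomies
  leaves a character that is trivial on loops. The exponents depend on the loop but not on
  \<open>c\<close>, so convergence of holonomies implies convergence on every loop.\<close>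

lemma character_eq_prod_holonomy:
  obtains w :: "nat \<Rightarrow> (real \<Rightarrow> 'a) \<Rightarrow> int"
  where "\<And>c p. path_character S c \<Longrightarrow> path p \<Longrightarrow> path_image p \<subseteq> S \<Longrightarrow> pathfinish p = pathstart p \<Longrightarrow>
    c p = (\<Prod>j\<in>generator_sides. holonomy c j powi w j p)"
proof -
  define Dual where "Dual j0 w \<longleftrightarrow> (\<forall>s. path_character S (\<lambda>p. cis (s * w p))) \<and>
      (\<forall>p. path p \<longrightarrow> path_image p \<subseteq> S \<longrightarrow> pathfinish p = pathstart p \<longrightarrow> w p \<in> \<int>) \<and>
      (\<forall>s. \<forall>j\<in>generator_sides. holonomy (\<lambda>p. cis (s * w p)) j = (if j = j0 then cis s else 1))"
    for j0 :: nat and w :: "(real \<Rightarrow> 'a) \<Rightarrow> real"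
  have "\<exists>w. Dual j0 w"
    if "j0 \<in> generator_sides" for j0
  proof -
    from that obtain i where i: "i < g" "j0 = 4 * i \<or> j0 = 4 * i + 1" by (rule generator_sidesE)
    obtain w where "\<And>s. path_character S (\<lambda>p. cis (s * w p))"
      and "\<And>p. path p \<Longrightarrow> path_image p \<subseteq> S \<Longrightarrow> pathfinish p = pathstart p \<Longrightarrow> w p \<in> \<int>"
      and w: "\<And>s i' j. i' < g \<Longrightarrow> j = 4 * i' \<or> j = 4 * i' + 1 \<Longrightarrow>
        holonomy (\<lambda>p. cis (s * w p)) j = (if j = j0 then cis s else 1)"
      by (rule dual_crossing_number[OF i]) (rule that)
    moreover have "holonomy (\<lambda>p. cis (s * w p)) j = (if j = j0 then cis s else 1)" if "j \<in> generator_sides" for s j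
      using that by (rule generator_sidesE) (rule w)
    ultimately have "Dual j0 w" unfolding Dual_def by (intro conjI allI impI ballI)
    then show ?thesis by (rule exI[where x = w])
  qed
  then obtain w where w: "\<And>j0. j0 \<in> generator_sides \<Longrightarrow> Dual j0 (w j0)"
    by metis
  have wc: "path_character S (\<lambda>p. cis (s * w j0 p))" if "j0 \<in> generator_sides" for j0 s
    using w[OF that] unfolding Dual_def by (elim conjE allE)
  have wi: "w j0 p \<in> \<int>"
    if "j0 \<in> generator_sides" "path p" "path_image p \<subseteq> S" "pathfinish p = pathstart p" for j0 p
    using w[OF that(1)] that(2-) unfolding Dual_def by simp
  have wh: "holonomy (\<lambda>p. cis (s * w j0 p)) j = (if j = j0 then cis s else 1)"
    if "j0 \<in> generator_sides" "j \<in> generator_sides" for j0 j s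
    using w[OF that(1)] that(2) unfolding Dual_def by simp
  show ?thesis
  proof (rule that[of "\<lambda>j p. \<lfloor>w j p\<rfloor>"])
    fix c p assume c: "path_character S c" and p: "path p" "path_image p \<subseteq> S" "pathfinish p = pathstart p"
    \<comment> \<open>Any logarithm would do on loops, where the crossing numbers are
      integers.\<close>
    define s where "s j = Arg (holonomy c j)" for j
    have s: "cis (s j) = holonomy c j" for j
    proof -
      have "holonomy c j \<noteq> 0" using norm_holonomy[OF c, of j] by auto
      then show ?thesis using cis_Arg[of "holonomy c j"] norm_holonomy[OF c, of j] by (simp add: s_def sgn_div_norm)
    qed
    let ?e = "\<lambda>p. c p * (\<Prod>j\<in>generator_sides. cis (- s j * w j p))"
    have "?e p = 1"
    proof (rule path_character_trivial[OF _ _ p])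
      show "path_character S ?e"
        by (intro path_character_mult path_character_prod c wc finite_generator_sides)
      fix i j assume ij: "i < g" "j = 4 * i \<or> j = 4 * i + 1"
      then have j: "j \<in> generator_sides" by (rule generator_sidesI)
      have "holonomy ?e j = holonomy c j * (\<Prod>j0\<in>generator_sides. holonomy (\<lambda>p. cis (- s j0 * w j0 p)) j)"
        by (simp add: holonomy_def)
      also have "(\<Prod>j0\<in>generator_sides. holonomy (\<lambda>p. cis (- s j0 * w j0 p)) j) =
          (\<Prod>j0\<in>generator_sides. if j = j0 then cis (- s j0) else 1)"
        by (intro prod.cong refl wh j)
      also have "\<dots> = cis (- s j)"
        using finite_generator_sides j by (simp add: prod.delta')
      finally show "holonomy ?e j = 1"
        unfolding s[symmetric] by (simp add: cis_mult)
    qed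
    moreover have "cis (- s j * w j p) = inverse (holonomy c j powi \<lfloor>w j p\<rfloor>)" if j: "j \<in> generator_sides" for j
    proof -
      obtain n :: int where n: "w j p = of_int n" using wi[OF j p] by (auto elim: Ints_cases)
      have "holonomy c j powi n = cis (of_int n * s j)"
        unfolding s[symmetric] by (simp add: cis_power_int)
      then show ?thesis using n by (simp add: mult.commute)
    qed
    ultimately have "c p * inverse (\<Prod>j\<in>generator_sides. holonomy c j powi \<lfloor>w j p\<rfloor>) = 1"
      by (simp add: prod_inversef[symmetric])
    then show "c p = (\<Prod>j\<in>generator_sides. holonomy c j powi \<lfloor>w j p\<rfloor>)"
      by (metis inverse_inverse_eq inverse_unique mult.commute)
  qed
qed

theorem handle_twist_inverse:
  assumes k: "i < g" "k = 4 * i + 1 \<or> k = 4 * i + 2"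
  obtains f f' where "homeomorphism S S f f'"
    and "\<And>c i' j. path_character S c \<Longrightarrow> i' < g \<Longrightarrow> j = 4 * i' \<or> j = 4 * i' + 1 \<Longrightarrow>
      holonomy (\<lambda>p. c (f \<circ> p)) j = holonomy c j *
        (if j = k then holonomy c (k - 1) else if j + 2 = k then inverse (holonomy c (k - 1)) else 1)"
proof -
  obtain f f' where f: "homeomorphism S S f f'"
    and holonomy: "\<And>c i' j. path_character S c \<Longrightarrow> i' < g \<Longrightarrow> j = 4 * i' \<or> j = 4 * i' + 1 \<Longrightarrow>
      holonomy (\<lambda>p. c (f \<circ> p)) j = holonomy c j *
        (if j = k then inverse (holonomy c (k - 1)) else if j + 2 = k then holonomy c (k - 1) else 1)"
    by (rule handle_twist[OF k]) (rule that)
  show ?thesis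
  proof (rule that[OF homeomorphism_symD[OF f]])
    fix c i' j assume c: "path_character S c" and j: "i' < g" "j = 4 * i' \<or> j = 4 * i' + 1"
    let ?c = "\<lambda>p. c (f' \<circ> p)"
    have c': "path_character S ?c"
      using f by (intro path_character_compose[OF c]) (auto simp: homeomorphism_def)
    have undo: "holonomy (\<lambda>p. ?c (f \<circ> p)) j = holonomy c j" for j
      unfolding holonomy_def
    proof (rule path_character.cong[OF c, symmetric])
      let ?p = "q \<circ> linepath (side (j + 2) (1/2)) (side j (1/2))"
      show p: "path ?p" "path_image ?p \<subseteq> S" by (intro disc_chord_path side_in_disc)+
      fix t :: real assume "t \<in> {0..1}"
      then have "?p t \<in> S" using p(2) unfolding path_image_def by blast
      then show "?p t = (f' \<circ> (f \<circ> ?p)) t" using f by (simp add: homeomorphism_def)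
    qed
    have nz: "holonomy ?c (k - 1) \<noteq> 0" using norm_holonomy[OF c', of "k - 1"] by auto
    \<comment> \<open>A twist does not change the holonomy along its own core, so undoing it just
      inverts the factor.\<close>
    have k1: "holonomy c (k - 1) = holonomy ?c (k - 1)"
    proof -
      have "k - 1 = 4 * i \<or> k - 1 = 4 * i + 1" "k - 1 \<noteq> k" "k - 1 + 2 \<noteq> k" using k by auto
      then show ?thesis using holonomy[OF c' k(1), of "k - 1"] undo[of "k - 1"] by simp
    qed
    show "holonomy ?c j = holonomy c j *
        (if j = k then holonomy c (k - 1) else if j + 2 = k then inverse (holonomy c (k - 1)) else 1)"
      unfolding k1 using holonomy[OF c' j] nz unfolding undo by simp
  qed
qed

end

section \<open>From a dense image to a dense orbit\<close>

text \<open>The equation defines a closed subset of the torus, and a proper one, because a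
  nontrivial character raised to a positive power is still nontrivial.\<close>

lemma not_dense_if_char_power_trivial:
  fixes A :: "(complex ^ 'n::finite) set"
  assumes A: "\<And>z. z \<in> A \<Longrightarrow> torus_char \<kappa> (\<lambda>l. z $ l) ^ N = 1" "A \<subseteq> carrier torus"
    and N: "N > 0" and \<kappa>: "\<kappa> \<noteq> (\<lambda>_. 0)"
  shows "\<not> dense_in torus_topology A"
proof
  assume "dense_in torus_topology A"
  then have cl: "torus_topology closure_of A = carrier torus" by (simp add: dense_in_def)
  let ?F = "\<lambda>z :: complex ^ 'n. torus_char \<kappa> (\<lambda>l. z $ l) ^ N"
  have "z $ l \<noteq> 0" if "z \<in> carrier torus" for z :: "complex ^ 'n" and l
  proof -
    have "cmod (z $ l) = 1" using that by (simp add: torus_def)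
    then show ?thesis by auto
  qed
  then have "continuous_on (carrier torus) (\<lambda>z :: complex ^ 'n. z $ l powi \<kappa> l)" for l
    by (intro continuous_on_power_int continuous_intros) auto
  then have "continuous_on (carrier torus) ?F"
    unfolding torus_char_def by (intro continuous_on_power continuous_on_prod)
  then have "closedin torus_topology {z \<in> carrier torus. ?F z = 1}"
    by (rule continuous_closedin_preimage_constant)
  then have "torus_topology closure_of A \<subseteq> {z \<in> carrier torus. ?F z = 1}"
    by (rule closure_of_minimal[rotated]) (use A in auto)
  then have all: "?F z = 1" if "z \<in> carrier torus" for z using that cl by auto
  obtain l0 where l0: "\<kappa> l0 \<noteq> 0" using \<kappa> by auto
  \<comment> \<open>Chosen so that the \<open>N\<close>-th power of the character takes the value
    \<open>cis pi = - 1\<close> at \<open>z\<close>.\<close>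
  define \<theta> where "\<theta> = pi / (of_int (\<kappa> l0) * of_nat N)"
  define z :: "complex ^ 'n" where "z = (\<chi> l. if l = l0 then cis \<theta> else 1)"
  have "torus_char \<kappa> (\<lambda>l. z $ l) = (\<Prod>l\<in>UNIV. if l = l0 then cis \<theta> powi \<kappa> l else 1)"
    unfolding torus_char_def z_def by (intro prod.cong) auto
  also have "\<dots> = cis (of_int (\<kappa> l0) * \<theta>)" by (simp add: prod.delta' cis_power_int)
  finally have "?F z = cis (of_nat N * (of_int (\<kappa> l0) * \<theta>))" by (simp add: Complex.DeMoivre)
  also have "of_nat N * (of_int (\<kappa> l0) * \<theta>) = pi" using N l0 by (simp add: \<theta>_def)
  finally have "?F z = - 1" by simp
  moreover have "z \<in> carrier torus" by (simp add: torus_def z_def)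
  ultimately show False using all[of z] by simp
qed

context glued_surface
begin

lemma dense_orbit_if_dense_image:
  fixes c :: "'n::finite \<Rightarrow> (real \<Rightarrow> 'a) \<Rightarrow> complex"
  assumes c: "\<And>l. path_character S (c l)" and x: "x \<in> S"
    and dense: "dense_in torus_topology (character_rep S x c ` carrier (fundamental_group S x))"
  shows "dense_in (representation_space S x) (mapping_class_orbit S x (character_rep S x c))"
proof -
  note orbit = mapping_class_orbit_character_rep[where c = c, OF c x path_connected_surface]
  have cf: "path_character S (\<lambda>p. c l (f \<circ> p))" if "homeomorphism S S f f'" for f f' l
    using that by (intro path_character_compose[OF c]) (auto simp: homeomorphism_def)
  have sub: "mapping_class_orbit S x (character_rep S x c) \<subseteq> representations S x"
    unfolding orbit using cf by (auto intro!: character_rep_in_representations)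
  \<comment> \<open>The states are the holonomies of all pullbacks of \<open>c\<close> by
    homeomorphisms, that is, of the points of the orbit.\<close>
  define R where "R a b \<longleftrightarrow> (\<exists>f f'. homeomorphism S S f f' \<and> (\<forall>i<g. \<forall>l.
      a i l = holonomy (\<lambda>p. c l (f \<circ> p)) (4 * i) \<and> b i l = holonomy (\<lambda>p. c l (f \<circ> p)) (4 * i + 1)))"
    for a b :: "nat \<Rightarrow> 'n \<Rightarrow> complex"
  have RI: "R a b" if "homeomorphism S S f f'"
    "\<And>i l. i < g \<Longrightarrow> a i l = holonomy (\<lambda>p. c l (f \<circ> p)) (4 * i)"
    "\<And>i l. i < g \<Longrightarrow> b i l = holonomy (\<lambda>p. c l (f \<circ> p)) (4 * i + 1)" for a b f f'
    using that unfolding R_def by blast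
  have RE: thesis if "R a b" "\<And>f f'. homeomorphism S S f f' \<Longrightarrow>
      (\<And>i l. i < g \<Longrightarrow> a i l = holonomy (\<lambda>p. c l (f \<circ> p)) (4 * i)) \<Longrightarrow>
      (\<And>i l. i < g \<Longrightarrow> b i l = holonomy (\<lambda>p. c l (f \<circ> p)) (4 * i + 1)) \<Longrightarrow> thesis" for a b thesis
    using that unfolding R_def by blast
  have unit: "unimodular (\<lambda>l. holonomy (d l) j)" if "\<And>l. path_character S (d l)" for d :: "'n \<Rightarrow> _" and j
    using norm_holonomy[OF that] by (simp add: unimodular_def)
  have uni: "unimodular (a i) \<and> unimodular (b i)" if R: "R a b" and i: "i < g" for a b i
  proof -
    from R obtain f f' where f: "homeomorphism S S f f'"
      and a: "\<And>i l. i < g \<Longrightarrow> a i l = holonomy (\<lambda>p. c l (f \<circ> p)) (4 * i)"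
      and b: "\<And>i l. i < g \<Longrightarrow> b i l = holonomy (\<lambda>p. c l (f \<circ> p)) (4 * i + 1)" by (rule RE) blast
    show ?thesis using norm_holonomy[OF cf[OF f]] by (simp add: unimodular_def a[OF i] b[OF i])
  qed
  \<comment> \<open>The twist for \<open>4 * i + 1\<close> divides \<open>b\<close> by
    \<open>a\<close>, so its inverse is used here; the twist for \<open>4 * i + 2\<close> already
    has the desired sign.\<close>
  have RA: "R a (b(i := \<lambda>l. b i l * a i l))" if R: "R a b" and i: "i < g" for a b i
  proof -
    from R obtain f f' where f: "homeomorphism S S f f'"
      and a: "\<And>i l. i < g \<Longrightarrow> a i l = holonomy (\<lambda>p. c l (f \<circ> p)) (4 * i)"
      and b: "\<And>i l. i < g \<Longrightarrow> b i l = holonomy (\<lambda>p. c l (f \<circ> p)) (4 * i + 1)" by (rule RE) blast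
    have k: "4 * i + 1 = 4 * i + 1 \<or> 4 * i + 1 = 4 * i + 2" by simp
    obtain h h' where h: "homeomorphism S S h h'"
      and holonomy: "\<And>c i' j. path_character S c \<Longrightarrow> i' < g \<Longrightarrow> j = 4 * i' \<or> j = 4 * i' + 1 \<Longrightarrow>
        holonomy (\<lambda>p. c (h \<circ> p)) j = holonomy c j * (if j = 4 * i + 1 then holonomy c (4 * i + 1 - 1)
          else if j + 2 = 4 * i + 1 then inverse (holonomy c (4 * i + 1 - 1)) else 1)"
      by (rule handle_twist_inverse[OF i k]) (rule that)
    have n: "4 * i' \<noteq> 4 * i + 1" "4 * i' + 2 \<noteq> 4 * i + 1" "4 * i' + 1 + 2 \<noteq> 4 * i + 1" for i' by presburger+
    \<comment> \<open>The twist formula is applied to the character already pulled back by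
      \<open>f\<close>; this is why the new homeomorphism is \<open>f \<circ> h\<close>.\<close>
    note holonomy' = holonomy[OF cf[OF f]]
    show ?thesis
    proof (rule RI[OF homeomorphism_compose[OF h f]])
      fix i' l assume i': "i' < g"
      show "a i' l = holonomy (\<lambda>p. c l (f \<circ> h \<circ> p)) (4 * i')"
        using holonomy'[OF i', of "4 * i'" l] a[OF i', of l] n[of i'] by (simp add: comp_assoc)
      show "(b(i := \<lambda>l. b i l * a i l)) i' l = holonomy (\<lambda>p. c l (f \<circ> h \<circ> p)) (4 * i' + 1)"
        using holonomy'[OF i', of "4 * i' + 1" l] a[OF i, of l] b[OF i', of l] n[of i']
        by (cases "i' = i") (simp_all add: comp_assoc)
    qed
  qed
  have RB: "R (a(i := \<lambda>l. a i l * b i l)) b" if R: "R a b" and i: "i < g" for a b i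
  proof -
    from R obtain f f' where f: "homeomorphism S S f f'"
      and a: "\<And>i l. i < g \<Longrightarrow> a i l = holonomy (\<lambda>p. c l (f \<circ> p)) (4 * i)"
      and b: "\<And>i l. i < g \<Longrightarrow> b i l = holonomy (\<lambda>p. c l (f \<circ> p)) (4 * i + 1)" by (rule RE) blast
    have k: "4 * i + 2 = 4 * i + 1 \<or> 4 * i + 2 = 4 * i + 2" by simp
    obtain h h' where h: "homeomorphism S S h h'"
      and holonomy: "\<And>c i' j. path_character S c \<Longrightarrow> i' < g \<Longrightarrow> j = 4 * i' \<or> j = 4 * i' + 1 \<Longrightarrow>
        holonomy (\<lambda>p. c (h \<circ> p)) j = holonomy c j * (if j = 4 * i + 2 then inverse (holonomy c (4 * i + 2 - 1))
          else if j + 2 = 4 * i + 2 then holonomy c (4 * i + 2 - 1) else 1)"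
      by (rule handle_twist[OF i k]) (rule that)
    have n: "4 * i' \<noteq> 4 * i + 2" "4 * i' + 1 \<noteq> 4 * i + 2" "4 * i' + 1 + 2 \<noteq> 4 * i + 2" for i' by presburger+
    have m: "4 * i + 2 - 1 = 4 * i + 1" by simp
    note holonomy' = holonomy[OF cf[OF f], unfolded m]
    show ?thesis
    proof (rule RI[OF homeomorphism_compose[OF h f]])
      fix i' l assume i': "i' < g"
      show "(a(i := \<lambda>l. a i l * b i l)) i' l = holonomy (\<lambda>p. c l (f \<circ> h \<circ> p)) (4 * i')"
        using holonomy'[OF i', of "4 * i'" l] a[OF i', of l] b[OF i, of l] n[of i']
        by (cases "i' = i") (simp_all add: comp_assoc)
      show "b i' l = holonomy (\<lambda>p. c l (f \<circ> h \<circ> p)) (4 * i' + 1)"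
        using holonomy'[OF i', of "4 * i' + 1" l] b[OF i', of l] n[of i'] by (simp add: comp_assoc)
    qed
  qed
  have RB': "R (a(i := \<lambda>l. a i l * inverse (b i l))) b" if R: "R a b" and i: "i < g" for a b i
  proof -
    from R obtain f f' where f: "homeomorphism S S f f'"
      and a: "\<And>i l. i < g \<Longrightarrow> a i l = holonomy (\<lambda>p. c l (f \<circ> p)) (4 * i)"
      and b: "\<And>i l. i < g \<Longrightarrow> b i l = holonomy (\<lambda>p. c l (f \<circ> p)) (4 * i + 1)" by (rule RE) blast
    have k: "4 * i + 2 = 4 * i + 1 \<or> 4 * i + 2 = 4 * i + 2" by simp
    obtain h h' where h: "homeomorphism S S h h'"
      and holonomy: "\<And>c i' j. path_character S c \<Longrightarrow> i' < g \<Longrightarrow> j = 4 * i' \<or> j = 4 * i' + 1 \<Longrightarrow>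
        holonomy (\<lambda>p. c (h \<circ> p)) j = holonomy c j * (if j = 4 * i + 2 then holonomy c (4 * i + 2 - 1)
          else if j + 2 = 4 * i + 2 then inverse (holonomy c (4 * i + 2 - 1)) else 1)"
      by (rule handle_twist_inverse[OF i k]) (rule that)
    have n: "4 * i' \<noteq> 4 * i + 2" "4 * i' + 1 \<noteq> 4 * i + 2" "4 * i' + 1 + 2 \<noteq> 4 * i + 2" for i' by presburger+
    have m: "4 * i + 2 - 1 = 4 * i + 1" by simp
    note holonomy' = holonomy[OF cf[OF f], unfolded m]
    show ?thesis
    proof (rule RI[OF homeomorphism_compose[OF h f]])
      fix i' l assume i': "i' < g"
      show "(a(i := \<lambda>l. a i l * inverse (b i l))) i' l = holonomy (\<lambda>p. c l (f \<circ> h \<circ> p)) (4 * i')"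
        using holonomy'[OF i', of "4 * i'" l] a[OF i', of l] b[OF i, of l] n[of i']
        by (cases "i' = i") (simp_all add: comp_assoc)
      show "b i' l = holonomy (\<lambda>p. c l (f \<circ> h \<circ> p)) (4 * i' + 1)"
        using holonomy'[OF i', of "4 * i' + 1" l] b[OF i', of l] n[of i'] by (simp add: comp_assoc)
    qed
  qed
  have RC: "R (a(i := \<lambda>l. a i l * (b i l * b (Suc i) l), Suc i := \<lambda>l. a (Suc i) l * (b i l * b (Suc i) l))) b"
    if R: "R a b" and i: "Suc i < g" for a b i
  proof -
    from R obtain f f' where f: "homeomorphism S S f f'"
      and a: "\<And>i l. i < g \<Longrightarrow> a i l = holonomy (\<lambda>p. c l (f \<circ> p)) (4 * i)"
      and b: "\<And>i l. i < g \<Longrightarrow> b i l = holonomy (\<lambda>p. c l (f \<circ> p)) (4 * i + 1)" by (rule RE) blast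
    obtain h h' where h: "homeomorphism S S h h'"
      and holonomy: "\<And>c i' j. path_character S c \<Longrightarrow> i' < g \<Longrightarrow> j = 4 * i' \<or> j = 4 * i' + 1 \<Longrightarrow>
        holonomy (\<lambda>p. c (h \<circ> p)) j = holonomy c j *
          (if j = 4 * i \<or> j = 4 * i + 4 then holonomy c (4 * i + 1) * holonomy c (4 * i + 5) else 1)"
      by (rule belt_twist[OF i]) (rule that)
    have n: "4 * i' + 1 \<noteq> 4 * i" "4 * i' + 1 \<noteq> 4 * i + 4" "4 * i' = 4 * i \<or> 4 * i' = 4 * i + 4 \<longleftrightarrow> i' = i \<or> i' = Suc i"
      for i' by presburger+
    have m: "4 * i + 5 = 4 * Suc i + 1" by simp
    have i0: "i < g" using i by simp
    note holonomy' = holonomy[OF cf[OF f], unfolded m]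
    show ?thesis
    proof (rule RI[OF homeomorphism_compose[OF h f]])
      fix i' l assume i': "i' < g"
      have "holonomy (\<lambda>p. c l (f \<circ> h \<circ> p)) (4 * i') =
          a i' l * (if i' = i \<or> i' = Suc i then b i l * b (Suc i) l else 1)"
        using holonomy'[OF i', of "4 * i'" l] unfolding n a[OF i'] b[OF i0] b[OF i] by (simp add: comp_assoc)
      then show "(a(i := \<lambda>l. a i l * (b i l * b (Suc i) l), Suc i := \<lambda>l. a (Suc i) l * (b i l * b (Suc i) l))) i' l =
          holonomy (\<lambda>p. c l (f \<circ> h \<circ> p)) (4 * i')"
        by auto
      show "b i' l = holonomy (\<lambda>p. c l (f \<circ> h \<circ> p)) (4 * i' + 1)"
        using holonomy'[OF i', of "4 * i' + 1" l] b[OF i', of l] n[of i'] by (simp add: comp_assoc)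
    qed
  qed
  \<comment> \<open>the twist about the belt, corrected by inverse twists about the two handles\<close>
  have RE': "R (a(i := \<lambda>l. a i l * b (Suc i) l, Suc i := \<lambda>l. a (Suc i) l * b i l)) b"
    if R: "R a b" and i: "Suc i < g" for a b i
  proof -
    have i0: "i < g" using i by simp
    have nz: "b i l \<noteq> 0" "b (Suc i) l \<noteq> 0" for l
      using uni[OF R i0] uni[OF R i] unimodular_nonzero[of "b i" l] unimodular_nonzero[of "b (Suc i)" l]
      by simp_all
    show ?thesis
      by (rule back_subst[of "\<lambda>a. R a b", OF RB'[OF RB'[OF RC[OF R i] i0] i]])
        (use nz in \<open>auto simp: fun_eq_iff\<close>)
  qed
  \<comment> \<open>If \<kappa> had finite order on all holonomies, one common exponent would make
    its power trivial on all loops and confine the image to a proper closed subset.\<close>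
  have nondeg: "\<exists>i<g. infinite_order (torus_char \<kappa> (a i)) \<or> infinite_order (torus_char \<kappa> (b i))"
    if R: "R a b" and \<kappa>: "\<kappa> \<noteq> (\<lambda>_. 0)" for a b \<kappa>
  proof (rule ccontr)
    assume "\<not> ?thesis"
    then have "\<exists>N>0. torus_char \<kappa> (a i) ^ N = 1" "\<exists>N>0. torus_char \<kappa> (b i) ^ N = 1" if "i < g" for i
      using that unfolding infinite_order_def by blast+
    then obtain Na Nb where Na: "\<And>i. i < g \<Longrightarrow> 0 < Na i \<and> torus_char \<kappa> (a i) ^ Na i = 1"
      and Nb: "\<And>i. i < g \<Longrightarrow> 0 < Nb i \<and> torus_char \<kappa> (b i) ^ Nb i = 1"
      by metis
    define N where "N = (\<Prod>i<g. Na i * Nb i)"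
    have N: "N > 0" unfolding N_def using Na Nb by (intro prod_pos) auto
    have aN: "torus_char \<kappa> (a i) ^ N = 1" and bN: "torus_char \<kappa> (b i) ^ N = 1" if i: "i < g" for i
    proof -
      have "Na i * Nb i dvd N" unfolding N_def using i by (intro dvd_prodI) auto
      then obtain m where m: "N = Na i * Nb i * m" by (auto elim: dvdE)
      have 1: "N = Na i * (Nb i * m)" and 2: "N = Nb i * (Na i * m)" by (simp_all add: m)
      show "torus_char \<kappa> (a i) ^ N = 1" unfolding 1 power_mult using Na[OF i] by simp
      show "torus_char \<kappa> (b i) ^ N = 1" unfolding 2 power_mult using Nb[OF i] by simp
    qed
    from R obtain f f' where f: "homeomorphism S S f f'"
      and a: "\<And>i l. i < g \<Longrightarrow> a i l = holonomy (\<lambda>p. c l (f \<circ> p)) (4 * i)"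
      and b: "\<And>i l. i < g \<Longrightarrow> b i l = holonomy (\<lambda>p. c l (f \<circ> p)) (4 * i + 1)" by (rule RE) blast
    let ?e = "\<lambda>p. torus_char \<kappa> (\<lambda>l. c l (f \<circ> p)) ^ N"
    have e: "path_character S ?e"
      unfolding torus_char_def
      by (intro path_character_power path_character_prod path_character_powi cf[OF f]) simp
    have e1: "holonomy ?e j = 1" if "i < g" "j = 4 * i \<or> j = 4 * i + 1" for i j
    proof -
      have "holonomy ?e j = torus_char \<kappa> (\<lambda>l. holonomy (\<lambda>p. c l (f \<circ> p)) j) ^ N"
        by (simp add: holonomy_def)
      moreover have "(\<lambda>l. holonomy (\<lambda>p. c l (f \<circ> p)) (4 * i)) = a i" "(\<lambda>l. holonomy (\<lambda>p. c l (f \<circ> p)) (4 * i + 1)) = b i"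
        using a[OF that(1)] b[OF that(1)] by auto
      ultimately show ?thesis using that aN[OF that(1)] bN[OF that(1)] by metis
    qed
    have fc: "continuous_on S f'" "f' ` S \<subseteq> S" and inv: "\<And>y. y \<in> S \<Longrightarrow> f (f' y) = y"
      using f by (auto simp: homeomorphism_def)
    have "torus_char \<kappa> (\<lambda>l. z $ l) ^ N = 1" if "z \<in> character_rep S x c ` carrier (fundamental_group S x)" for z
    proof -
      from that obtain r where r: "r \<in> based_loops S x" and z: "z = character_rep S x c (loop_class S x r)"
        by (auto simp: carrier_fundamental_group)
      note rl = based_loopsD[OF r]
      \<comment> \<open>The state \<open>R a b\<close> belongs to the pullback by \<open>f\<close>,
        so the loop \<open>r\<close> is carried back by \<open>f'\<close> before the criterion is
        applied.\<close>
      have "?e (f' \<circ> r) = 1"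
        by (rule path_character_trivial[OF e e1])
          (use rl fc continuous_on_subset[OF fc(1) rl(2)] in
            \<open>auto intro!: path_continuous_image simp: path_image_compose pathstart_compose pathfinish_compose\<close>)
      moreover have "c l (f \<circ> (f' \<circ> r)) = c l r" for l
      proof (rule path_character.cong[OF c, symmetric, OF rl(1,2)])
        fix t :: real assume "t \<in> {0..1}"
        then have "r t \<in> S" using rl(2) by (auto simp: path_image_def)
        then show "r t = (f \<circ> (f' \<circ> r)) t" by (simp add: inv)
      qed
      ultimately show ?thesis
        unfolding z character_rep_apply[where c = c, OF c r] by simp
    qed
    moreover have "character_rep S x c ` carrier (fundamental_group S x) \<subseteq> carrier torus"
      using dense by (simp add: dense_in_def)
    ultimately show False
      using not_dense_if_char_power_trivial[of _ \<kappa> N] N \<kappa> dense by blast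
  qed
  have R0: "R (\<lambda>i l. holonomy (c l) (4 * i)) (\<lambda>i l. holonomy (c l) (4 * i + 1))"
    by (rule RI[OF homeomorphism_ident]) (simp_all add: id_def[symmetric])
  have "\<sigma> \<in> representation_space S x closure_of (mapping_class_orbit S x (character_rep S x c))"
    if \<sigma>: "\<sigma> \<in> representations S x" for \<sigma>
  proof -
    obtain d where d: "\<And>l. path_character S (d l)" and \<sigma>d: "\<sigma> = character_rep S x d"
      by (rule representation_eq_character_rep[OF \<sigma> path_connected_surface x]) (rule that)
    have "\<exists>f f'. homeomorphism S S f f' \<and> (\<forall>j\<in>generator_sides. \<forall>l.
        cmod (holonomy (\<lambda>p. c l (f \<circ> p)) j - holonomy (d l) j) < 1 / real (Suc m))" for m
    proof -
      have "\<exists>a b. R a b \<and> (\<forall>i<g. \<forall>l. cmod (a i l - holonomy (d l) (4 * i)) < 1 / real (Suc m) \<and>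
          cmod (b i l - holonomy (d l) (4 * i + 1)) < 1 / real (Suc m))"
      proof (rule symplectic_moves_dense[where R = R and g = g and \<epsilon> = "1 / real (Suc m)" and
            ya = "\<lambda>i l. holonomy (d l) (4 * i)" and yb = "\<lambda>i l. holonomy (d l) (4 * i + 1)"])
        show "R (\<lambda>i l. holonomy (c l) (4 * i)) (\<lambda>i l. holonomy (c l) (4 * i + 1))" by (rule R0)
      qed (fact uni RA RB RE' nondeg | use unit[of d, OF d] in simp)+
      then obtain a b where R: "R a b" and near: "\<forall>i<g. \<forall>l. cmod (a i l - holonomy (d l) (4 * i)) < 1 / real (Suc m) \<and>
          cmod (b i l - holonomy (d l) (4 * i + 1)) < 1 / real (Suc m)" by blast
      from R obtain f f' where f: "homeomorphism S S f f'"
        and a: "\<And>i l. i < g \<Longrightarrow> a i l = holonomy (\<lambda>p. c l (f \<circ> p)) (4 * i)"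
        and b: "\<And>i l. i < g \<Longrightarrow> b i l = holonomy (\<lambda>p. c l (f \<circ> p)) (4 * i + 1)" by (rule RE) blast
      have "cmod (holonomy (\<lambda>p. c l (f \<circ> p)) j - holonomy (d l) j) < 1 / real (Suc m)" if "j \<in> generator_sides" for j l
        using that by (rule generator_sidesE) (use near a b in auto)
      then show ?thesis using f by blast
    qed
    then obtain f f' where f: "\<And>m. homeomorphism S S (f m) (f' m)"
      and near: "\<And>m j l. j \<in> generator_sides \<Longrightarrow>
        cmod (holonomy (\<lambda>p. c l (f m \<circ> p)) j - holonomy (d l) j) < 1 / real (Suc m)"
      by metis
    have holonomy_lim: "(\<lambda>m. holonomy (\<lambda>p. c l (f m \<circ> p)) j) \<longlonglongrightarrow> holonomy (d l) j" if "j \<in> generator_sides" for j l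
    proof (rule LIM_zero_cancel, rule Lim_null_comparison)
      show "\<forall>\<^sub>F m in sequentially. cmod (holonomy (\<lambda>p. c l (f m \<circ> p)) j - holonomy (d l) j) \<le> 1 / real (Suc m)"
        by (intro always_eventually allI less_imp_le near that)
      show "(\<lambda>m. 1 / real (Suc m)) \<longlonglongrightarrow> 0"
        using LIMSEQ_inverse_real_of_nat by (simp add: inverse_eq_divide)
    qed
    obtain w :: "nat \<Rightarrow> (real \<Rightarrow> 'a) \<Rightarrow> int" where
      w: "\<And>c p. path_character S c \<Longrightarrow> path p \<Longrightarrow> path_image p \<subseteq> S \<Longrightarrow> pathfinish p = pathstart p \<Longrightarrow>
        c p = (\<Prod>j\<in>generator_sides. holonomy c j powi w j p)"
      by (rule character_eq_prod_holonomy) (rule that)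
    define r where "r m = character_rep S x (\<lambda>l p. c l (f m \<circ> p))" for m
    have r: "r m \<in> representations S x" for m
      unfolding r_def by (rule character_rep_in_representations) (rule cf[OF f])
    have lim: "(\<lambda>m. r m A) \<longlonglongrightarrow> \<sigma> A" if "A \<in> carrier (fundamental_group S x)" for A
    proof -
      from that obtain p where p: "p \<in> based_loops S x" and A: "A = loop_class S x p"
        by (auto simp: carrier_fundamental_group)
      note pl = based_loopsD(1,2,5)[OF p]
      have nz: "holonomy (d l) j \<noteq> 0" for l j using norm_holonomy[OF d, of l j] by auto
      \<comment> \<open>The exponents \<open>w j p\<close> do not depend on \<open>m\<close>, so the
        finite product converges with the holonomies.\<close>
      have "(\<lambda>m. c l (f m \<circ> p)) \<longlonglongrightarrow> d l p" for l
        unfolding w[OF d pl] w[OF cf[OF f] pl]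
        by (intro tendsto_prod tendsto_power_int holonomy_lim nz)
      then have "(\<lambda>m. \<chi> l. c l (f m \<circ> p)) \<longlonglongrightarrow> (\<chi> l. d l p)"
        by (intro vec_tendstoI) simp
      moreover have "r m A = (\<chi> l. c l (f m \<circ> p))" for m
        unfolding r_def A by (rule character_rep_apply[OF cf[OF f] p])
      moreover have "\<sigma> A = (\<chi> l. d l p)"
        unfolding \<sigma>d A by (rule character_rep_apply[OF d p])
      ultimately show ?thesis by simp
    qed
    have "\<exists>y\<in>mapping_class_orbit S x (character_rep S x c). y \<in> W"
      if W: "\<sigma> \<in> W" "openin (representation_space S x) W" for W
    proof -
      have "\<forall>\<^sub>F m in sequentially. r m \<in> W"
        by (rule eventually_in_representation_space[OF r \<sigma> lim W(2,1)])
      then obtain m where "r m \<in> W" using eventually_happens trivial_limit_sequentially by blast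
      moreover have "r m \<in> mapping_class_orbit S x (character_rep S x c)"
        unfolding orbit r_def using f by blast
      ultimately show ?thesis by blast
    qed
    then show ?thesis
      unfolding in_closure_of topspace_representation_space using \<sigma> by blast
  qed
  then show ?thesis
    unfolding dense_in_def topspace_representation_space
    using sub closure_of_subset_topspace[of "representation_space S x"]
    by (auto simp: topspace_representation_space)
qed

section \<open>From a dense orbit to a dense image\<close>

text \<open>A loop dual to one crossing number can be given any value \<open>t\<close> by some
  representation. Evaluation at this loop is continuous, so an orbit point near that representation
  yields an element of the image near \<open>t\<close>.\<close>

lemma dense_image_if_dense_orbit:
  fixes c :: "'n::finite \<Rightarrow> (real \<Rightarrow> 'a) \<Rightarrow> complex"
  assumes c: "\<And>l. path_character S (c l)" and x: "x \<in> S"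
    and dense: "dense_in (representation_space S x) (mapping_class_orbit S x (character_rep S x c))"
  shows "dense_in torus_topology (character_rep S x c ` carrier (fundamental_group S x))"
proof -
  let ?I = "character_rep S x c ` carrier (fundamental_group S x)"
  note orbit = mapping_class_orbit_character_rep[where c = c, OF c x path_connected_surface]
  have I: "?I \<subseteq> carrier torus"
    using character_rep_in_representations[where c = c and x = x, OF c] by (auto simp: representations_def hom_def)
  have "t \<in> torus_topology closure_of ?I" if t: "t \<in> carrier torus" for t
  proof -
    have "\<exists>y\<in>?I. y \<in> U" if U: "t \<in> U" "openin torus_topology U" for U
    proof -
      have g0: "0 < g" and j0: "(0::nat) = 4 * 0 \<or> (0::nat) = 4 * 0 + 1" using genus by auto
      obtain w where wc: "\<And>s. path_character S (\<lambda>p. cis (s * w p))"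
        and wh: "\<And>s i' j. i' < g \<Longrightarrow> j = 4 * i' \<or> j = 4 * i' + 1 \<Longrightarrow>
          holonomy (\<lambda>p. cis (s * w p)) j = (if j = 0 then cis s else 1)"
        by (rule dual_crossing_number[OF g0 j0]) (rule that)
      define s where "s l = Arg (t $ l)" for l
      have s: "cis (s l) = t $ l" for l
      proof -
        have n: "cmod (t $ l) = 1" using t by (simp add: torus_def)
        then have "t $ l \<noteq> 0" by auto
        then show ?thesis using cis_Arg[of "t $ l"] n by (simp add: s_def sgn_div_norm)
      qed
      define d where "d l p = cis (s l * w p)" for l p
      have d: "path_character S (d l)" for l unfolding d_def by (rule wc)
      let ?e = "q \<circ> linepath (side (0 + 2) (1/2)) (side 0 (1/2))"
      have e: "path ?e" "path_image ?e \<subseteq> S" by (intro disc_chord_path side_in_disc)+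
      have eloop: "pathfinish ?e = pathstart ?e"
        using glue[OF g0 j0, of "1/2"] by (simp add: pathfinish_compose pathstart_compose)
      have "pathstart ?e \<in> S" using e by auto
      then obtain b where b: "path b" "path_image b \<subseteq> S" "pathstart b = x" "pathfinish b = pathstart ?e"
        using path_connected_surface x unfolding path_connected_def by blast
      define \<gamma> where "\<gamma> = b +++ ?e +++ reversepath b"
      have \<gamma>: "\<gamma> \<in> based_loops S x"
        unfolding \<gamma>_def using e eloop b by (intro conjugate_in_based_loops) auto
      have "d l \<gamma> = t $ l" for l
      proof -
        have "d l \<gamma> = d l ?e"
          unfolding \<gamma>_def by (rule path_character.conjugate[OF d]) (use e eloop b in auto)
        also have "\<dots> = holonomy (d l) 0" by (simp add: holonomy_def)
        also have "\<dots> = cis (s l)" unfolding d_def using wh[OF g0 j0] by simp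
        finally show ?thesis using s by simp
      qed
      then have dt: "character_rep S x d (loop_class S x \<gamma>) = t"
        by (simp add: character_rep_apply[OF d \<gamma>] vec_eq_iff)
      let ?W = "{\<rho> \<in> representations S x. \<rho> (loop_class S x \<gamma>) \<in> U}"
      have o: "openin (representation_space S x) ?W"
        by (rule openin_representation_space_eval[OF loop_class_in_carrier[OF \<gamma>] U(2)])
      have m: "character_rep S x d \<in> ?W"
        using character_rep_in_representations[OF d] dt U(1) by auto
      have "character_rep S x d \<in>
          representation_space S x closure_of (mapping_class_orbit S x (character_rep S x c))"
        using dense character_rep_in_representations[OF d]
        by (simp add: dense_in_def topspace_representation_space)
      then have "\<forall>T. character_rep S x d \<in> T \<and> openin (representation_space S x) T \<longrightarrow>
          (\<exists>y. y \<in> mapping_class_orbit S x (character_rep S x c) \<and> y \<in> T)"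
        unfolding in_closure_of by (rule conjunct2)
      from this[rule_format, OF conjI[OF m o]] obtain \<sigma>
        where \<sigma>: "\<sigma> \<in> mapping_class_orbit S x (character_rep S x c)" "\<sigma> \<in> ?W"
        by (elim exE conjE) (rule that)
      from \<sigma>(1) obtain f f' where f: "homeomorphism S S f f'"
        and \<sigma>f: "\<sigma> = character_rep S x (\<lambda>i p. c i (f \<circ> p))"
        unfolding orbit by (elim CollectE exE conjE) (rule that)
      have fU: "character_rep S x (\<lambda>i p. c i (f \<circ> p)) \<in> ?W"
        using \<sigma>(2) unfolding \<sigma>f .
      have fc: "continuous_on S f" "f ` S \<subseteq> S" using f by (auto simp: homeomorphism_def)
      have cf: "path_character S (\<lambda>p. c l (f \<circ> p))" for l
        by (rule path_character_compose[OF c fc])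
      have "f x \<in> S" using fc x by auto
      then obtain h where h: "path h" "path_image h \<subseteq> S" "pathstart h = x" "pathfinish h = f x"
        using path_connected_surface x unfolding path_connected_def by blast
      note \<gamma>l = based_loopsD[OF \<gamma>]
      have f\<gamma>: "path (f \<circ> \<gamma>)" "path_image (f \<circ> \<gamma>) \<subseteq> S" "pathstart (f \<circ> \<gamma>) = f x" "pathfinish (f \<circ> \<gamma>) = f x"
        using \<gamma>l fc(2) continuous_on_subset[OF fc(1) \<gamma>l(2)]
        by (auto intro!: path_continuous_image simp: path_image_compose pathstart_compose pathfinish_compose)
      have loop: "h +++ (f \<circ> \<gamma>) +++ reversepath h \<in> based_loops S x"
        using f\<gamma> h by (intro conjugate_in_based_loops) auto
      \<comment> \<open>The value of the orbit point at \<gamma> is the value of the original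
        representation at a loop conjugate to \<open>f \<circ> \<gamma>\<close>.\<close>
      have "c l (h +++ (f \<circ> \<gamma>) +++ reversepath h) = c l (f \<circ> \<gamma>)" for l
        by (rule path_character.conjugate[OF c]) (use f\<gamma> h in auto)
      then have "character_rep S x c (loop_class S x (h +++ (f \<circ> \<gamma>) +++ reversepath h)) =
          character_rep S x (\<lambda>i p. c i (f \<circ> p)) (loop_class S x \<gamma>)"
        using character_rep_apply[where c = c, OF c loop]
          character_rep_apply[where c = "\<lambda>i p. c i (f \<circ> p)", OF cf \<gamma>] by simp
      then show ?thesis
        using fU loop_class_in_carrier[OF loop] by (metis (no_types, lifting) imageI mem_Collect_eq)
    qed
    then show ?thesis unfolding in_closure_of using t by auto
  qed
  then show ?thesis
    unfolding dense_in_def using I closure_of_subset_topspace[of torus_topology ?I] by auto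
qed

end

theorem theorem1:
  fixes S :: "'a::topological_space set" and x\<^sub>0 :: 'a and g :: nat
    and \<rho> :: "(real \<Rightarrow> 'a) set \<Rightarrow> complex ^ 'n::finite"
  assumes "g \<ge> 1"
    and "closed_oriented_surface g S"
    and "x\<^sub>0 \<in> S"
    and "\<rho> \<in> representations S x\<^sub>0"
  shows "dense_in torus_topology (\<rho> ` carrier (fundamental_group S x\<^sub>0)) \<longleftrightarrow>
         dense_in (representation_space S x\<^sub>0) (mapping_class_orbit S x\<^sub>0 \<rho>)"
proof -
  obtain q where "quotient_map (top_of_set (cball 0 1)) (top_of_set S) q"
    and "\<forall>z\<in>cball 0 1. \<forall>w\<in>cball 0 1. q z = q w \<longleftrightarrow> (z, w) \<in> gluing g"
    using assms(2) unfolding closed_oriented_surface_def by blast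
  then interpret glued_surface g S q
    using assms(1,2) by unfold_locales (auto simp: closed_oriented_surface_def closed_surface_def)
  obtain c where c: "\<And>l. path_character S (c l)" and \<rho>: "\<rho> = character_rep S x\<^sub>0 c"
    by (rule representation_eq_character_rep[OF assms(4) path_connected_surface assms(3)]) (rule that)
  show ?thesis
    unfolding \<rho> using dense_orbit_if_dense_image[where c = c, OF c assms(3)]
      dense_image_if_dense_orbit[where c = c, OF c assms(3)] by blast
qed

end
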